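(* Let $\mathcal{B}$ be a smooth $2$-dimensional manifold, and let $(df)^*\alpha=0$ be a 2D symplectic Monge-Ampère equation on $\mathcal{B}$ such that $\mathrm{Pf}(\alpha)\neq0$ everywhere on $T^*\mathcal{B}$. Then there is a unique family of generalized almost geometries $\mathbb{A}\in\mathrm{End}(\mathbb{T}T^*\mathcal{B})$ on $T^*\mathcal{B}$, namely the quadric family (described in the context) determined by a non-degenerate Monge-Ampère structure, which are associated with the equation.
   Context: Let $\Omega$ be the canonical symplectic form on $T^*\mathcal{B}$; in Darboux coordinates $x,y,p,q$, $\Omega=dx\wedge dp+dy\wedge dq$. A (symplectic) Monge-Ampère structure on $T^*\mathcal{B}$ is a pair $(\Omega,\alpha)$ with $\alpha\in\Omega^2(T^*\mathcal{B})$ and $\Omega\wedge\alpha=0$. Its Pfaffian is the function $\mathrm{Pf}(\alpha)$ with $\alpha\wedge\alpha=\mathrm{Pf}(\alpha)\,\Omega\wedge\Omega$; the structure is non-degenerate if $\mathrm{Pf}(\alpha)$ is nowhere zero. The associated 2D symplectic Monge-Ampère equation is the PDE $(df)^*\alpha=0$ for $f\in C^\infty(\mathcal{B})$, where $df:\mathcal{B}\to T^*\mathcal{B}$ is viewed as a section. The normalization of a non-degenerate structure is $(\Omega,n(\alpha))$ with $n(\alpha)=|\mathrm{Pf}(\alpha)|^{-1/2}\alpha$; it corresponds to the same equation. For a $2$-form $\sigma$ on a manifold $\mathcal{M}$, $\sigma_\#:T\mathcal{M}\to T^*\mathcal{M}$ is $\sigma_\#(X)=\sigma(X,\cdot)$;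 if $\sigma$ is non-degenerate, $\pi_\sigma^\#:=(\sigma_\#)^{-1}:T^*\mathcal{M}\to T\mathcal{M}$. For $A\in\mathrm{End}(T\mathcal{M})$, $A^*\in\mathrm{End}(T^*\mathcal{M})$ is the dual map. $\mathbb{T}\mathcal{M}=T\mathcal{M}\oplus T^*\mathcal{M}$ carries the pairing $\eta((X,\xi),(Y,\zeta))=\frac12(\xi(Y)+\zeta(X))$. A generalized almost geometry (generalized almost structure) on $\mathcal{M}$ is a bundle map $\mathbb{J}:\mathbb{T}\mathcal{M}\to\mathbb{T}\mathcal{M}$ with $\mathbb{J}^2=\gamma_1\mathrm{Id}$ and $\eta(\mathbb{J}u,\mathbb{J}v)=\gamma_2\eta(u,v)$ for all $u,v$, where $\gamma_1,\gamma_2\in\{-1,1\}$; it is GaPC (generalized almost para-complex) if $(\gamma_1,\gamma_2)=(1,-1)$ and GaC (generalized almost complex) if $(\gamma_1,\gamma_2)=(-1,1)$. Block matrices are with respect to $T\mathcal{M}\oplus T^*\mathcal{M}$, with $\mathcal{M}=T^*\mathcal{B}$. Quadric family determined by a non-degenerate Monge-Ampère structure $(\Omega,\beta)$: put $\rho=|\mathrm{Pf}(\beta)|^{-1/2}\pi_\Omega^\#\circ\beta_\#$ and, for $a_1,a_2,a_3\in\mathbb{R}$ and $\epsilon_2,\epsilon_3\in\{-1,1\}$, $$\mathbb{A}=\begin{pmatrix} a_1\rho & a_2\pi_\beta^\#+a_3\pi_\Omega^\#\\ a_2\epsilon_2\beta_\#+a_3\epsilon_3\Omega_\# & -a_1\rho^*\end{pmatrix},\qquad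 k=-\mathrm{sgn}\,\mathrm{Pf}(\beta)\,a_1^2+\epsilon_2a_2^2+\epsilon_3a_3^2 .$$ The family consists of GaPC structures ($k=1$) and GaC structures ($k=-1$), parameterized by quadric surfaces of points $(a_1,a_2,a_3)\in\mathbb{R}^3$, listed here for $(\epsilon_2,\epsilon_3)=(1,1),(1,-1),(-1,1),(-1,-1)$ in this order. If $\mathrm{Pf}(\beta)>0$: for $k=1$ a $1$-sheeted hyperboloid, a $2$-sheeted hyperboloid, a $2$-sheeted hyperboloid, the empty set; for $k=-1$ a $2$-sheeted hyperboloid, a $1$-sheeted hyperboloid, a $1$-sheeted hyperboloid, a $2$-sphere. If $\mathrm{Pf}(\beta)<0$: for $k=1$ a $2$-sphere, a $1$-sheeted hyperboloid, a $1$-sheeted hyperboloid, a $2$-sheeted hyperboloid; for $k=-1$ the empty set, a $2$-sheeted hyperboloid, a $2$-sheeted hyperboloid, a $1$-sheeted hyperboloid. Two different points of any of the quadrics parameterize two different geometries. A generalized almost geometry associated with the equation $(df)^*\alpha=0$, where $\mathrm{Pf}(\alpha)\neq0$, is by definition a generalized almost geometry determined by the normalized Monge-Ampère structure $(\Omega,n(\alpha))$ corresponding to the equation.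
   Formalization: B is assumed connected and non-empty (uniqueness fails on disconnected B), and the family keeps only quadric points with a₂a₃=0 or ε₂=sgn Pf·ε₃, since at the others 𝔸² is not ±Id, contrary to the description of the family. *)

theory Defs
  imports "HOL-Analysis.Analysis" "HOL-Library.Function_Algebras"
begin

section \<open>Smooth maps between Euclidean spaces\<close>

text \<open>The set \<open>S\<close> is meant to be open.\<close>

primrec C_on :: "nat \<Rightarrow> 'a::euclidean_space set \<Rightarrow> ('a \<Rightarrow> 'b::real_normed_vector) \<Rightarrow> bool" where
  "C_on 0 S f \<longleftrightarrow> continuous_on S f"
| "C_on (Suc k) S f \<longleftrightarrow>
     f differentiable_on S \<and> (\<forall>v. C_on k S (\<lambda>x. frechet_derivative f (at x) v))"

definition smooth_on :: "'a::euclidean_space set \<Rightarrow> ('a \<Rightarrow> 'b::real_normed_vector) \<Rightarrow> bool" where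
  "smooth_on S f \<longleftrightarrow> (\<forall>k. C_on k S f)"


section \<open>Smooth manifolds\<close>

text \<open>A manifold modelled on the Euclidean space \<open>'e\<close> is given by an atlas; its points are the
  points of the chart domains. A chart is a pair of a domain and a map, of which only the values
  on the domain matter.\<close>

type_synonym ('m, 'e) chart = "'m set \<times> ('m \<Rightarrow> 'e)"
type_synonym ('m, 'e) atlas = "('m, 'e) chart set"

definition points :: "('m, 'e) atlas \<Rightarrow> 'm set" where
  "points M = (\<Union>c\<in>M. fst c)"

definition charts_at :: "('m, 'e) atlas \<Rightarrow> 'm \<Rightarrow> ('m, 'e) chart set" where
  "charts_at M m = {c \<in> M. m \<in> fst c}"

definition some_chart :: "('m, 'e) atlas \<Rightarrow> 'm \<Rightarrow> ('m, 'e) chart" where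
  "some_chart M m = (SOME c. c \<in> charts_at M m)"

definition chart_image :: "('m, 'e) chart \<Rightarrow> 'e set" where
  "chart_image c = snd c ` fst c"

definition chart_inv :: "('m, 'e) chart \<Rightarrow> 'e \<Rightarrow> 'm" where
  "chart_inv c = inv_into (fst c) (snd c)"

definition transition :: "('m, 'e) chart \<Rightarrow> ('m, 'e) chart \<Rightarrow> 'e \<Rightarrow> 'e" where
  "transition c c' = snd c' \<circ> chart_inv c"

definition manifold_topology :: "('m, 'e::euclidean_space) atlas \<Rightarrow> 'm topology" where
  "manifold_topology M =
     topology (\<lambda>W. W \<subseteq> points M \<and> (\<forall>c\<in>M. open (snd c ` (W \<inter> fst c))))"

definition smooth_manifold :: "('m, 'e::euclidean_space) atlas \<Rightarrow> bool" where
  "smooth_manifold M \<longleftrightarrow>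
     (\<forall>c\<in>M. inj_on (snd c) (fst c) \<and> open (chart_image c)) \<and>
     (\<forall>c\<in>M. \<forall>c'\<in>M. open (snd c ` (fst c \<inter> fst c')) \<and>
        smooth_on (snd c ` (fst c \<inter> fst c')) (transition c c')) \<and>
     Hausdorff_space (manifold_topology M) \<and> second_countable (manifold_topology M)"

lemma openin_manifold_topology:
  assumes "smooth_manifold M"
  shows "openin (manifold_topology M) W \<longleftrightarrow>
    W \<subseteq> points M \<and> (\<forall>c\<in>M. open (snd c ` (W \<inter> fst c)))"
proof -
  have inj: "inj_on (snd c) (fst c)" if "c \<in> M" for c
    using assms that by (auto simp: smooth_manifold_def)
  have "istopology (\<lambda>W. W \<subseteq> points M \<and> (\<forall>c\<in>M. open (snd c ` (W \<inter> fst c))))"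
    unfolding istopology_def
  proof (intro conjI allI impI ballI)
    fix S T c
    assume S: "S \<subseteq> points M \<and> (\<forall>c\<in>M. open (snd c ` (S \<inter> fst c)))"
      and T: "T \<subseteq> points M \<and> (\<forall>c\<in>M. open (snd c ` (T \<inter> fst c)))"
    show "S \<inter> T \<subseteq> points M" using S by auto
    assume c: "c \<in> M"
    have "snd c ` (S \<inter> T \<inter> fst c) = snd c ` (S \<inter> fst c) \<inter> snd c ` (T \<inter> fst c)"
      using inj[OF c] by (auto simp: inj_on_def)
    then show "open (snd c ` (S \<inter> T \<inter> fst c))" using S T c by (auto intro: open_Int)
  next
    fix K
    assume K: "\<forall>W\<in>K. W \<subseteq> points M \<and> (\<forall>c\<in>M. open (snd c ` (W \<inter> fst c)))"
    then show "\<Union>K \<subseteq> points M" by auto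
    fix c assume "c \<in> M"
    moreover have "snd c ` (\<Union>K \<inter> fst c) = (\<Union>W\<in>K. snd c ` (W \<inter> fst c))" by auto
    ultimately show "open (snd c ` (\<Union>K \<inter> fst c))" using K by auto
  qed
  then show ?thesis by (simp add: manifold_topology_def topology_inverse')
qed

definition smooth_function :: "('m, 'e::euclidean_space) atlas \<Rightarrow> ('m \<Rightarrow> real) \<Rightarrow> bool" where
  "smooth_function M f \<longleftrightarrow> (\<forall>c\<in>M. smooth_on (chart_image c) (f \<circ> chart_inv c))"


section \<open>Tangent and cotangent spaces\<close>

text \<open>A tangent vector at \<open>m\<close> assigns to each chart around \<open>m\<close> its coordinate vector in this chart,
  subject to the usual transformation law, and is \<open>0\<close> on all other charts. A covector at \<open>m\<close> is a
  linear form on the tangent space, and is \<open>0\<close> outside of it. Addition of such functions is the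
  pointwise one of \<^theory>\<open>HOL-Library.Function_Algebras\<close>; scalar multiplication is \<open>smul\<close>.\<close>

type_synonym ('m, 'e) tangent = "('m, 'e) chart \<Rightarrow> 'e"
type_synonym ('m, 'e) cotangent = "('m, 'e) tangent \<Rightarrow> real"

definition smul :: "real \<Rightarrow> ('a \<Rightarrow> 'b::real_vector) \<Rightarrow> 'a \<Rightarrow> 'b" where
  "smul r f = (\<lambda>x. r *\<^sub>R f x)"

definition tangent_space ::
    "('m, 'e::euclidean_space) atlas \<Rightarrow> 'm \<Rightarrow> ('m, 'e) tangent set" where
  "tangent_space M m = {X.
     (\<forall>c\<in>charts_at M m. \<forall>c'\<in>charts_at M m.
        X c' = frechet_derivative (transition c c') (at (snd c m)) (X c)) \<and>
     (\<forall>c. c \<notin> charts_at M m \<longrightarrow> X c = 0)}"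

definition cotangent_space ::
    "('m, 'e::euclidean_space) atlas \<Rightarrow> 'm \<Rightarrow> ('m, 'e) cotangent set" where
  "cotangent_space M m = {\<xi>.
     (\<forall>X\<in>tangent_space M m. \<forall>Y\<in>tangent_space M m. \<xi> (X + Y) = \<xi> X + \<xi> Y) \<and>
     (\<forall>r. \<forall>X\<in>tangent_space M m. \<xi> (smul r X) = r * \<xi> X) \<and>
     (\<forall>X. X \<notin> tangent_space M m \<longrightarrow> \<xi> X = 0)}"

text \<open>The (co)vector with given components in the chart \<open>c\<close>, and the components of a covector.
  Covectors of the model space are identified with vectors by the inner product.\<close>

definition coord_vector ::
    "('m, 'e::euclidean_space) atlas \<Rightarrow> ('m, 'e) chart \<Rightarrow> 'm \<Rightarrow> 'e \<Rightarrow> ('m, 'e) tangent" where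
  "coord_vector M c m v = (\<lambda>c'.
     if c' \<in> charts_at M m then frechet_derivative (transition c c') (at (snd c m)) v else 0)"

definition coord_covector ::
    "('m, 'e::euclidean_space) atlas \<Rightarrow> ('m, 'e) chart \<Rightarrow> 'm \<Rightarrow> 'e \<Rightarrow> ('m, 'e) cotangent" where
  "coord_covector M c m p = (\<lambda>X. if X \<in> tangent_space M m then p \<bullet> X c else 0)"

definition covector_components ::
    "('m, 'e::euclidean_space) atlas \<Rightarrow> ('m, 'e) chart \<Rightarrow> 'm \<Rightarrow> ('m, 'e) cotangent \<Rightarrow> 'e" where
  "covector_components M c m \<xi> = (\<Sum>i\<in>Basis. \<xi> (coord_vector M c m i) *\<^sub>R i)"

definition differential ::
    "('m, 'e::euclidean_space) atlas \<Rightarrow> ('m \<Rightarrow> real) \<Rightarrow> 'm \<Rightarrow> ('m, 'e) cotangent" where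
  "differential M f m = (\<lambda>X.
     if X \<in> tangent_space M m then
       let c = some_chart M m
       in frechet_derivative (f \<circ> chart_inv c) (at (snd c m)) (X c)
     else 0)"

definition tangent_map ::
    "('m, 'e::euclidean_space) atlas \<Rightarrow> ('n, 'd::euclidean_space) atlas \<Rightarrow> ('m \<Rightarrow> 'n) \<Rightarrow> 'm \<Rightarrow>
     ('m, 'e) tangent \<Rightarrow> ('n, 'd) tangent" where
  "tangent_map M N F m X = (\<lambda>c'.
     if c' \<in> charts_at N (F m) then
       let c = some_chart M m
       in frechet_derivative (snd c' \<circ> F \<circ> chart_inv c) (at (snd c m)) (X c)
     else 0)"


section \<open>Two-forms\<close>

text \<open>Only the values of a two-form on tangent vectors at the points of the manifold matter.\<close>

type_synonym ('m, 'e) two_form = "'m \<Rightarrow> ('m, 'e) tangent \<Rightarrow> ('m, 'e) tangent \<Rightarrow> real"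

text \<open>The maps \<open>\<sigma>\<^sub>#\<close> and \<open>\<pi>\<^sub>\<sigma>\<^sup>#\<close>.\<close>

definition lower ::
    "('m, 'e::euclidean_space) atlas \<Rightarrow> ('m, 'e) two_form \<Rightarrow> 'm \<Rightarrow>
     ('m, 'e) tangent \<Rightarrow> ('m, 'e) cotangent" where
  "lower M \<sigma> m X = (\<lambda>Y. if Y \<in> tangent_space M m then \<sigma> m X Y else 0)"

definition raise ::
    "('m, 'e::euclidean_space) atlas \<Rightarrow> ('m, 'e) two_form \<Rightarrow> 'm \<Rightarrow>
     ('m, 'e) cotangent \<Rightarrow> ('m, 'e) tangent" where
  "raise M \<sigma> m = inv_into (tangent_space M m) (lower M \<sigma> m)"

definition smooth_two_form :: "('m, 'e::euclidean_space) atlas \<Rightarrow> ('m, 'e) two_form \<Rightarrow> bool" where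
  "smooth_two_form M \<sigma> \<longleftrightarrow>
     (\<forall>m\<in>points M. \<forall>X\<in>tangent_space M m.
        lower M \<sigma> m X \<in> cotangent_space M m \<and>
        (\<forall>Y\<in>tangent_space M m. \<sigma> m Y X = - \<sigma> m X Y)) \<and>
     (\<forall>c\<in>M. \<forall>u v. smooth_on (chart_image c) (\<lambda>x.
        let m = chart_inv c x in \<sigma> m (coord_vector M c m u) (coord_vector M c m v)))"

definition wedge :: "('m, 'e) two_form \<Rightarrow> ('m, 'e) two_form \<Rightarrow> 'm \<Rightarrow>
    ('m, 'e) tangent \<Rightarrow> ('m, 'e) tangent \<Rightarrow> ('m, 'e) tangent \<Rightarrow> ('m, 'e) tangent \<Rightarrow> real" where
  "wedge \<sigma> \<tau> m X\<^sub>1 X\<^sub>2 X\<^sub>3 X\<^sub>4 =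
     \<sigma> m X\<^sub>1 X\<^sub>2 * \<tau> m X\<^sub>3 X\<^sub>4 - \<sigma> m X\<^sub>1 X\<^sub>3 * \<tau> m X\<^sub>2 X\<^sub>4 + \<sigma> m X\<^sub>1 X\<^sub>4 * \<tau> m X\<^sub>2 X\<^sub>3
   + \<sigma> m X\<^sub>2 X\<^sub>3 * \<tau> m X\<^sub>1 X\<^sub>4 - \<sigma> m X\<^sub>2 X\<^sub>4 * \<tau> m X\<^sub>1 X\<^sub>3 + \<sigma> m X\<^sub>3 X\<^sub>4 * \<tau> m X\<^sub>1 X\<^sub>2"


section \<open>Generalized almost structures\<close>

definition big_tangent_space ::
    "('m, 'e::euclidean_space) atlas \<Rightarrow> 'm \<Rightarrow> (('m, 'e) tangent \<times> ('m, 'e) cotangent) set" where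
  "big_tangent_space M m = tangent_space M m \<times> cotangent_space M m"

definition big_smul :: "real \<Rightarrow> ('m, 'e::euclidean_space) tangent \<times> ('m, 'e) cotangent \<Rightarrow>
    ('m, 'e) tangent \<times> ('m, 'e) cotangent" where
  "big_smul r u = (smul r (fst u), smul r (snd u))"

definition pairing :: "('m, 'e) tangent \<times> ('m, 'e) cotangent \<Rightarrow>
    ('m, 'e) tangent \<times> ('m, 'e) cotangent \<Rightarrow> real" where
  "pairing u v = (1/2) * (snd u (fst v) + snd v (fst u))"

type_synonym ('m, 'e) big_endo =
  "'m \<Rightarrow> ('m, 'e) tangent \<times> ('m, 'e) cotangent \<Rightarrow> ('m, 'e) tangent \<times> ('m, 'e) cotangent"

text \<open>Smooth bundle endomorphisms of the sum of the tangent and the cotangent bundle. They are \<open>0\<close>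
  outside of the fibres, so that equal bundle maps are equal as functions.\<close>

definition bundle_endomorphism ::
    "('m, 'e::euclidean_space) atlas \<Rightarrow> ('m, 'e) big_endo \<Rightarrow> bool" where
  "bundle_endomorphism M J \<longleftrightarrow>
     (\<forall>m\<in>points M. \<forall>u\<in>big_tangent_space M m.
        J m u \<in> big_tangent_space M m \<and>
        (\<forall>v\<in>big_tangent_space M m. J m (u + v) = J m u + J m v) \<and>
        (\<forall>r. J m (big_smul r u) = big_smul r (J m u))) \<and>
     (\<forall>m u. m \<notin> points M \<or> u \<notin> big_tangent_space M m \<longrightarrow> J m u = 0) \<and>
     (\<forall>c\<in>M. \<forall>v p. smooth_on (chart_image c) (\<lambda>x.
        let m = chart_inv c x;
            w = J m (coord_vector M c m v, coord_covector M c m p)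
        in (fst w c, covector_components M c m (snd w))))"

definition almost_structure ::
    "real \<Rightarrow> real \<Rightarrow> ('m, 'e::euclidean_space) atlas \<Rightarrow> ('m, 'e) big_endo \<Rightarrow> bool" where
  "almost_structure \<gamma>\<^sub>1 \<gamma>\<^sub>2 M J \<longleftrightarrow> bundle_endomorphism M J \<and>
     (\<forall>m\<in>points M. \<forall>u\<in>big_tangent_space M m.
        J m (J m u) = big_smul \<gamma>\<^sub>1 u \<and>
        (\<forall>v\<in>big_tangent_space M m. pairing (J m u) (J m v) = \<gamma>\<^sub>2 * pairing u v))"

definition generalized_almost_structure ::
    "('m, 'e::euclidean_space) atlas \<Rightarrow> ('m, 'e) big_endo \<Rightarrow> bool" where
  "generalized_almost_structure M J \<longleftrightarrow>
     (\<exists>\<gamma>\<^sub>1\<in>{-1, 1}. \<exists>\<gamma>\<^sub>2\<in>{-1, 1}. almost_structure \<gamma>\<^sub>1 \<gamma>\<^sub>2 M J)"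

definition GaPC :: "('m, 'e::euclidean_space) atlas \<Rightarrow> ('m, 'e) big_endo \<Rightarrow> bool" where
  "GaPC M J \<longleftrightarrow> almost_structure 1 (-1) M J"

definition GaC :: "('m, 'e::euclidean_space) atlas \<Rightarrow> ('m, 'e) big_endo \<Rightarrow> bool" where
  "GaC M J \<longleftrightarrow> almost_structure (-1) 1 M J"


section \<open>The cotangent bundle of a surface\<close>

type_synonym 'b surface = "('b, real^2) atlas"
type_synonym 'b phase = "'b \<times> ('b, real^2) cotangent"
type_synonym phase_coords = "(real^2) \<times> (real^2)"

text \<open>A chart \<open>c\<close> of the surface induces the chart \<open>((x, y), (p, q))\<close> of the cotangent bundle.\<close>

definition cotangent_chart :: "'b surface \<Rightarrow> ('b, real^2) chart \<Rightarrow> ('b phase, phase_coords) chart"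
  where
  "cotangent_chart B c =
     ({(b, \<xi>). b \<in> fst c \<and> \<xi> \<in> cotangent_space B b},
      \<lambda>(b, \<xi>). (snd c b, covector_components B c b \<xi>))"

definition cotangent_bundle :: "'b surface \<Rightarrow> ('b phase, phase_coords) atlas" where
  "cotangent_bundle B = cotangent_chart B ` B"

text \<open>The form \<open>dx \<and> dp + dy \<and> dq\<close>. Coordinate changes of the cotangent bundle induced from the base
  are symplectic, so the choice of the chart is immaterial.\<close>

definition canonical_form :: "'b surface \<Rightarrow> ('b phase, phase_coords) two_form" where
  "canonical_form B m X Y =
     (let c = some_chart (cotangent_bundle B) m
      in fst (X c) \<bullet> snd (Y c) - fst (Y c) \<bullet> snd (X c))"


section \<open>Monge-Ampere structures and equations\<close>

definition monge_ampere_structure ::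
    "'b surface \<Rightarrow> ('b phase, phase_coords) two_form \<Rightarrow> bool" where
  "monge_ampere_structure B \<alpha> \<longleftrightarrow> smooth_two_form (cotangent_bundle B) \<alpha> \<and>
     (\<forall>m\<in>points (cotangent_bundle B).
      \<forall>X\<^sub>1\<in>tangent_space (cotangent_bundle B) m. \<forall>X\<^sub>2\<in>tangent_space (cotangent_bundle B) m.
      \<forall>X\<^sub>3\<in>tangent_space (cotangent_bundle B) m. \<forall>X\<^sub>4\<in>tangent_space (cotangent_bundle B) m.
        wedge (canonical_form B) \<alpha> m X\<^sub>1 X\<^sub>2 X\<^sub>3 X\<^sub>4 = 0)"

definition Pf :: "'b surface \<Rightarrow> ('b phase, phase_coords) two_form \<Rightarrow> 'b phase \<Rightarrow> real" where
  "Pf B \<alpha> m = (THE r.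
      \<forall>X\<^sub>1\<in>tangent_space (cotangent_bundle B) m. \<forall>X\<^sub>2\<in>tangent_space (cotangent_bundle B) m.
      \<forall>X\<^sub>3\<in>tangent_space (cotangent_bundle B) m. \<forall>X\<^sub>4\<in>tangent_space (cotangent_bundle B) m.
        wedge \<alpha> \<alpha> m X\<^sub>1 X\<^sub>2 X\<^sub>3 X\<^sub>4 =
        r * wedge (canonical_form B) (canonical_form B) m X\<^sub>1 X\<^sub>2 X\<^sub>3 X\<^sub>4)"

definition nondegenerate_structure ::
    "'b surface \<Rightarrow> ('b phase, phase_coords) two_form \<Rightarrow> bool" where
  "nondegenerate_structure B \<alpha> \<longleftrightarrow> monge_ampere_structure B \<alpha> \<and>
     (\<forall>m\<in>points (cotangent_bundle B). Pf B \<alpha> m \<noteq> 0)"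

definition normalization :: "'b surface \<Rightarrow> ('b phase, phase_coords) two_form \<Rightarrow>
    ('b phase, phase_coords) two_form" where
  "normalization B \<alpha> m X Y = \<bar>Pf B \<alpha> m\<bar> powr (-1/2) * \<alpha> m X Y"

definition differential_section :: "'b surface \<Rightarrow> ('b \<Rightarrow> real) \<Rightarrow> 'b \<Rightarrow> 'b phase" where
  "differential_section B f b = (b, differential B f b)"

text \<open>The equation \<open>(df)\<^sup>*\<alpha> = 0\<close> as a condition on the second jets of \<open>f\<close>: the pairs of a smooth
  function \<open>f\<close> and a point at which \<open>f\<close> satisfies it. The equality of equations is the equality of
  these sets; comparing only the functions which are solutions on the whole surface would identify,
  for instance, all equations without global solutions.\<close>

definition monge_ampere_equation ::
    "'b surface \<Rightarrow> ('b phase, phase_coords) two_form \<Rightarrow> (('b \<Rightarrow> real) \<times> 'b) set" where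
  "monge_ampere_equation B \<alpha> = {(f, b). smooth_function B f \<and> b \<in> points B \<and>
     (\<forall>X\<in>tangent_space B b. \<forall>Y\<in>tangent_space B b.
        \<alpha> (differential_section B f b)
          (tangent_map B (cotangent_bundle B) (differential_section B f) b X)
          (tangent_map B (cotangent_bundle B) (differential_section B f) b Y) = 0)}"


section \<open>The quadric family\<close>

definition quadric_endo :: "'b surface \<Rightarrow> ('b phase, phase_coords) two_form \<Rightarrow> real \<Rightarrow> real \<Rightarrow>
    real \<times> real \<times> real \<Rightarrow> ('b phase, phase_coords) big_endo" where
  "quadric_endo B \<beta> \<epsilon>\<^sub>2 \<epsilon>\<^sub>3 = (\<lambda>(a\<^sub>1, a\<^sub>2, a\<^sub>3) m (X, \<xi>).
     let M = cotangent_bundle B; \<Omega> = canonical_form B;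
         \<rho> = (\<lambda>Y. smul (\<bar>Pf B \<beta> m\<bar> powr (-1/2)) (raise M \<Omega> m (lower M \<beta> m Y)));
         \<rho>_dual = (\<lambda>\<zeta> Y. if Y \<in> tangent_space M m then \<zeta> (\<rho> Y) else 0)
     in if m \<in> points M \<and> (X, \<xi>) \<in> big_tangent_space M m then
          (smul a\<^sub>1 (\<rho> X) + smul a\<^sub>2 (raise M \<beta> m \<xi>) + smul a\<^sub>3 (raise M \<Omega> m \<xi>),
           smul (a\<^sub>2 * \<epsilon>\<^sub>2) (lower M \<beta> m X) + smul (a\<^sub>3 * \<epsilon>\<^sub>3) (lower M \<Omega> m X) + smul (- a\<^sub>1) (\<rho>_dual \<xi>))
        else 0)"

definition quadric :: "'b surface \<Rightarrow> ('b phase, phase_coords) two_form \<Rightarrow> real \<Rightarrow> real \<Rightarrow> real \<Rightarrow>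
    (real \<times> real \<times> real) set" where
  "quadric B \<beta> k \<epsilon>\<^sub>2 \<epsilon>\<^sub>3 = {(a\<^sub>1, a\<^sub>2, a\<^sub>3). \<forall>m\<in>points (cotangent_bundle B).
     - sgn (Pf B \<beta> m) * a\<^sub>1\<^sup>2 + \<epsilon>\<^sub>2 * a\<^sub>2\<^sup>2 + \<epsilon>\<^sub>3 * a\<^sub>3\<^sup>2 = k}"

text \<open>Since \<open>\<pi>\<^sub>\<Omega>\<^sup># \<circ> \<beta>\<^sub>#\<close> squares to \<open>-Pf(\<beta>)\<close>, the square of the endomorphism \<open>A\<close> given by
  \<open>(a\<^sub>1, a\<^sub>2, a\<^sub>3)\<close> has on the tangent bundle the cross term
  \<open>a\<^sub>2 a\<^sub>3 (\<epsilon>\<^sub>2 - \<epsilon>\<^sub>3 / Pf(\<beta>)) \<pi>\<^sub>\<Omega>\<^sup># \<circ> \<beta>\<^sub>#\<close>. For a normalized structure it vanishes if \<open>a\<^sub>2 a\<^sub>3 = 0\<close> or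
  \<open>\<epsilon>\<^sub>2 = Pf(\<beta>) \<epsilon>\<^sub>3\<close>, but not otherwise. Hence a point of a quadric need not give a generalized
  almost structure, and this has to be required explicitly.\<close>

definition quadric_family :: "'b surface \<Rightarrow> ('b phase, phase_coords) two_form \<Rightarrow>
    ('b phase, phase_coords) big_endo set" where
  "quadric_family B \<beta> = {J. generalized_almost_structure (cotangent_bundle B) J \<and>
     (\<exists>k\<in>{1, -1}. \<exists>\<epsilon>\<^sub>2\<in>{1, -1}. \<exists>\<epsilon>\<^sub>3\<in>{1, -1}. \<exists>a\<in>quadric B \<beta> k \<epsilon>\<^sub>2 \<epsilon>\<^sub>3.
        J = quadric_endo B \<beta> \<epsilon>\<^sub>2 \<epsilon>\<^sub>3 a)}"

definition associated_geometry :: "'b surface \<Rightarrow> (('b \<Rightarrow> real) \<times> 'b) set \<Rightarrow>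
    ('b phase, phase_coords) big_endo \<Rightarrow> bool" where
  "associated_geometry B E J \<longleftrightarrow> (\<exists>\<alpha>. nondegenerate_structure B \<alpha> \<and>
     monge_ampere_equation B \<alpha> = E \<and> J \<in> quadric_family B (normalization B \<alpha>))"


section \<open>The types of the quadrics\<close>

datatype quadric_type = Empty | Sphere | One_Sheeted | Two_Sheeted

fun has_type :: "(real \<times> real \<times> real) set \<Rightarrow> quadric_type \<Rightarrow> bool" where
  "has_type S Empty \<longleftrightarrow> S = {}"
| "has_type S Sphere \<longleftrightarrow> (\<exists>z r. r > 0 \<and> S = sphere z r)"
| "has_type S One_Sheeted \<longleftrightarrow> (\<exists>(f :: real \<times> real \<times> real \<Rightarrow> real \<times> real \<times> real) l\<^sub>1 l\<^sub>2 l\<^sub>3.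
     orthogonal_transformation f \<and>
     l\<^sub>1 > 0 \<and> l\<^sub>2 > 0 \<and> l\<^sub>3 > 0 \<and>
     S = f ` {(x, y, z). l\<^sub>1 * x\<^sup>2 + l\<^sub>2 * y\<^sup>2 - l\<^sub>3 * z\<^sup>2 = 1})"
| "has_type S Two_Sheeted \<longleftrightarrow> (\<exists>(f :: real \<times> real \<times> real \<Rightarrow> real \<times> real \<times> real) l\<^sub>1 l\<^sub>2 l\<^sub>3.
     orthogonal_transformation f \<and>
     l\<^sub>1 > 0 \<and> l\<^sub>2 > 0 \<and> l\<^sub>3 > 0 \<and>
     S = f ` {(x, y, z). l\<^sub>1 * x\<^sup>2 + l\<^sub>2 * y\<^sup>2 - l\<^sub>3 * z\<^sup>2 = -1})"

text \<open>The types listed by the sign \<open>s\<close> of the Pfaffian, by \<open>k\<close>, and by \<open>(\<epsilon>\<^sub>2, \<epsilon>\<^sub>3)\<close> in the order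
  \<open>(1, 1)\<close>, \<open>(1, -1)\<close>, \<open>(-1, 1)\<close>, \<open>(-1, -1)\<close>.\<close>

definition listed_type :: "real \<Rightarrow> real \<Rightarrow> real \<Rightarrow> real \<Rightarrow> quadric_type" where
  "listed_type s k \<epsilon>\<^sub>2 \<epsilon>\<^sub>3 =
     (let row = (if s > 0
        then (if k = 1 then [One_Sheeted, Two_Sheeted, Two_Sheeted, Empty]
                       else [Two_Sheeted, One_Sheeted, One_Sheeted, Sphere])
        else (if k = 1 then [Sphere, One_Sheeted, One_Sheeted, Two_Sheeted]
                       else [Empty, Two_Sheeted, Two_Sheeted, One_Sheeted]))
      in row ! (if (\<epsilon>\<^sub>2, \<epsilon>\<^sub>3) = (1, 1) then 0 else if (\<epsilon>\<^sub>2, \<epsilon>\<^sub>3) = (1, -1) then 1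
                else if (\<epsilon>\<^sub>2, \<epsilon>\<^sub>3) = (-1, 1) then 2 else 3))"

end

theory Submission
  imports Defs
begin

text \<open>In a Darboux chart, an effective form \<open>\<alpha>\<close> restricted to the Lagrangian plane that is the graph of a
  symmetric matrix \<open>(x, y; y, z)\<close> is \<open>A + B x + 2 C y + D z + E (x z - y\<^sup>2)\<close>, and
  \<open>Pf(\<alpha>) = B D - C\<^sup>2 - A E\<close>. If the Pfaffian does not vanish, the zero set of this function determines
  its coefficients up to a common factor. All such planes are tangent to the graph of some \<open>df\<close>, so that
  two non-degenerate structures with the same equation are proportional at each point, and their
  normalizations agree up to a sign, which is constant since the cotangent bundle is connected.
  Changing the sign of the structure only moves the point \<open>(a\<^sub>1, a\<^sub>2, a\<^sub>3)\<close> of the quadric to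
  \<open>(-a\<^sub>1, -a\<^sub>2, a\<^sub>3)\<close>.

  Identifying covectors with vectors by \<open>\<Omega>\<close> turns the blocks of the endomorphisms of the family into
  elements of the commutative algebra generated by \<open>\<rho>\<close>, where \<open>\<rho>\<^sup>2 = -Pf\<close>. Hence their squares are
  \<open>k + a\<^sub>2 a\<^sub>3 (\<epsilon>\<^sub>2 - Pf \<epsilon>\<^sub>3) \<rho>\<close>, and \<open>\<rho>\<close> is not a multiple of the identity.\<close>

section \<open>Calculus of smooth maps\<close>

text \<open>Equations are compared as sets of pairs of a function and a point. Passing from equal
  equations to proportional forms therefore needs, for every covector and every symmetric matrix at
  a point, a function on the whole surface with this first and second derivative there. A bump
  function built from \<open>exp (- inverse t)\<close> provides it in a chart, and the Hausdorff
  property makes its extension by zero smooth. The factor between two structures is obtained at each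
  point separately and comes without any continuity; its sign is controlled through a smooth
  function that has the same sign. Connectedness is given for the base alone, so it is carried over
  by hand: along each fibre, and then along the zero section. All pointwise algebra is done in a
  single chart. This is legitimate because the canonical form has the same expression in every
  induced chart, which rests on the symmetry of the second derivatives of coordinate changes; hence
  the calculus at the beginning.\<close>

abbreviation fderiv :: "('a::real_normed_vector \<Rightarrow> 'b::real_normed_vector) \<Rightarrow> 'a \<Rightarrow> 'a \<Rightarrow> 'b" where
  "fderiv f x \<equiv> frechet_derivative f (at x)"

lemma fderiv_eq: "(f has_derivative f') (at x) \<Longrightarrow> fderiv f x = f'"
  using frechet_derivative_at by metis

lemma has_fderiv: "f differentiable at x \<Longrightarrow> (f has_derivative fderiv f x) (at x)"
  by (simp add: frechet_derivative_works)

text \<open>Both functions have the same set of derivatives at \<open>x\<close>, so the choice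
  operator inside \<open>frechet_derivative\<close> returns the same map, also at points where
  neither function is differentiable.\<close>

lemma fderiv_cong_open:
  assumes "open S" "x \<in> S" "\<And>y. y \<in> S \<Longrightarrow> f y = g y"
  shows "fderiv f x = fderiv g x"
proof -
  have "(f has_derivative D) (at x) \<longleftrightarrow> (g has_derivative D) (at x)" for D
    using has_derivative_transform_within_open[OF _ assms(1,2), of f D UNIV g]
      has_derivative_transform_within_open[OF _ assms(1,2), of g D UNIV f] assms(3) by auto
  then show ?thesis by (simp add: frechet_derivative_def)
qed

lemma linear_basis_expand:
  fixes f :: "'a::euclidean_space \<Rightarrow> 'b::real_vector"
  assumes "linear f"
  shows "f v = (\<Sum>i\<in>Basis. (v \<bullet> i) *\<^sub>R f i)"
proof -
  have "f v = f (\<Sum>i\<in>Basis. (v \<bullet> i) *\<^sub>R i)" by (simp add: euclidean_representation)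
  also have "\<dots> = (\<Sum>i\<in>Basis. (v \<bullet> i) *\<^sub>R f i)"
    by (simp add: linear_sum[OF assms] linear_scale[OF assms])
  finally show ?thesis .
qed

section \<open>Maps of a fixed order of differentiability\<close>

lemma C_on_Suc_differentiable:
  assumes "C_on (Suc k) S f" "open S" "x \<in> S"
  shows "f differentiable at x"
  using assms(1) at_within_open[OF assms(3,2)] assms(3) by (auto simp: differentiable_on_def)

lemma C_on_cong:
  assumes "open S" "C_on k S f" "\<And>x. x \<in> S \<Longrightarrow> f x = g x"
  shows "C_on k S g"
  using assms(2,3)
proof (induction k arbitrary: f g)
  case 0
  then show ?case using continuous_on_cong[of S S f g] by auto
next
  case (Suc k)
  have "g differentiable_on S"
    using Suc.prems differentiable_transform_within[of f _ S 1 g]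
    by (auto simp: differentiable_on_def)
  moreover have "C_on k S (\<lambda>x. fderiv g x v)" for v
  proof (rule Suc.IH)
    show "C_on k S (\<lambda>x. fderiv f x v)" using Suc.prems by simp
    show "fderiv f x v = fderiv g x v" if "x \<in> S" for x
      using fderiv_cong_open[OF assms(1) that, of f g] Suc.prems(2) by auto
  qed
  ultimately show ?case by simp
qed

text \<open>Allows different arguments near different points; the extension of a function by zero is
  smooth for one reason inside a chart and for another one outside of its support.\<close>

lemma C_on_local:
  assumes "\<And>x. x \<in> S \<Longrightarrow> \<exists>U. open U \<and> x \<in> U \<and> C_on k U f"
  shows "C_on k S f"
  using assms
proof (induction k arbitrary: f)
  case 0
  have "continuous (at x) f" if "x \<in> S" for x
    using 0[OF that] by (auto simp: continuous_on_eq_continuous_at)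
  then show ?case by (auto simp: continuous_on_eq_continuous_within continuous_at_imp_continuous_at_within)
next
  case (Suc k)
  have "f differentiable at x" if "x \<in> S" for x
    using Suc.prems[OF that] C_on_Suc_differentiable by blast
  then have "f differentiable_on S"
    by (auto simp: differentiable_on_def intro: differentiable_at_withinI)
  moreover have "C_on k S (\<lambda>x. fderiv f x v)" for v
    using Suc.prems by (intro Suc.IH) (metis C_on.simps(2))
  ultimately show ?case by simp
qed

lemma C_on_SucD:
  assumes "open S" "C_on (Suc k) S f"
  shows "C_on k S f"
  using assms(2)
  by (induction k arbitrary: f) (auto intro: differentiable_imp_continuous_on)

lemma C_on_const: "C_on k S (\<lambda>x. c)"
proof (induction k arbitrary: c)
  case (Suc k)
  show ?case using Suc.IH[of 0] by (simp add: zero_fun_def)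
qed simp

lemma C_on_bounded_linear_compose:
  assumes "bounded_linear h" "open S" "C_on k S f"
  shows "C_on k S (\<lambda>x. h (f x))"
  using assms(3)
proof (induction k arbitrary: f)
  case 0
  then show ?case using assms(1) by (auto intro: bounded_linear.continuous_on)
next
  case (Suc k)
  have d: "((\<lambda>x. h (f x)) has_derivative (\<lambda>v. h (fderiv f x v))) (at x)" if "x \<in> S" for x
    using bounded_linear.has_derivative[OF assms(1) has_fderiv[OF C_on_Suc_differentiable[OF Suc.prems assms(2) that]]]
    by simp
  have "(\<lambda>x. h (f x)) differentiable_on S"
    using d by (auto simp: differentiable_on_def intro: differentiableI differentiable_at_withinI)
  moreover have "C_on k S (\<lambda>x. fderiv (\<lambda>x. h (f x)) x v)" for v
    by (rule C_on_cong[OF assms(2), of _ "\<lambda>x. h (fderiv f x v)"])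
       (use Suc d in \<open>auto simp: fderiv_eq[OF d]\<close>)
  ultimately show ?case by simp
qed

lemma C_on_id: "C_on k S (\<lambda>x::'a::euclidean_space. x)"
proof (cases k)
  case (Suc n)
  then show ?thesis using C_on_const by auto
qed simp

lemma C_on_add:
  assumes "open S" "C_on k S f" "C_on k S g"
  shows "C_on k S (\<lambda>x. f x + g x)"
  using assms(2,3)
proof (induction k arbitrary: f g)
  case 0
  then show ?case by (auto intro: continuous_on_add)
next
  case (Suc k)
  have d: "((\<lambda>x. f x + g x) has_derivative (\<lambda>v. fderiv f x v + fderiv g x v)) (at x)" if "x \<in> S" for x
    by (intro has_derivative_add has_fderiv C_on_Suc_differentiable[OF Suc.prems(1) assms(1) that]
        C_on_Suc_differentiable[OF Suc.prems(2) assms(1) that])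
  have "(\<lambda>x. f x + g x) differentiable_on S"
    using d by (auto simp: differentiable_on_def intro: differentiableI differentiable_at_withinI)
  moreover have "C_on k S (\<lambda>x. fderiv (\<lambda>x. f x + g x) x v)" for v
    by (rule C_on_cong[OF assms(1), of _ "\<lambda>x. fderiv f x v + fderiv g x v"])
       (use Suc d in \<open>auto simp: fderiv_eq[OF d]\<close>)
  ultimately show ?case by simp
qed

lemma C_on_sum:
  assumes "open S" "\<And>i. i \<in> I \<Longrightarrow> C_on k S (f i)"
  shows "C_on k S (\<lambda>x. \<Sum>i\<in>I. f i x)"
  using assms(2)
proof (induction I rule: infinite_finite_induct)
  case (insert i I)
  then show ?case by (simp add: C_on_add[OF assms(1)])
qed (simp_all add: C_on_const)

text \<open>A general bounded bilinear \<open>pr\<close> covers scaling, multiplication and the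
  inner product at once. The product rule keeps one factor undifferentiated, so
  \<open>C_on_SucD\<close> has to lower the order of that factor before the induction hypothesis
  applies.\<close>

lemma C_on_bilinear:
  assumes "bounded_bilinear pr" "open S" "C_on k S f" "C_on k S g"
  shows "C_on k S (\<lambda>x. pr (f x) (g x))"
  using assms(3,4)
proof (induction k arbitrary: f g)
  case 0
  then show ?case by (auto intro: bounded_bilinear.continuous_on[OF assms(1)])
next
  case (Suc k)
  have d: "((\<lambda>x. pr (f x) (g x)) has_derivative
      (\<lambda>v. pr (f x) (fderiv g x v) + pr (fderiv f x v) (g x))) (at x)" if "x \<in> S" for x
    by (intro bounded_bilinear.FDERIV[OF assms(1)] has_fderiv
        C_on_Suc_differentiable[OF Suc.prems(1) assms(2) that]
        C_on_Suc_differentiable[OF Suc.prems(2) assms(2) that])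
  have "(\<lambda>x. pr (f x) (g x)) differentiable_on S"
    using d by (auto simp: differentiable_on_def intro: differentiableI differentiable_at_withinI)
  moreover have "C_on k S (\<lambda>x. fderiv (\<lambda>x. pr (f x) (g x)) x v)" for v
    by (rule C_on_cong[OF assms(2),
          of _ "\<lambda>x. pr (f x) (fderiv g x v) + pr (fderiv f x v) (g x)"])
       (use Suc.prems C_on_SucD[OF assms(2) Suc.prems(1)] C_on_SucD[OF assms(2) Suc.prems(2)]
         in \<open>auto simp: fderiv_eq[OF d] intro!: C_on_add[OF assms(2)] Suc.IH\<close>)
  ultimately show ?case by simp
qed

text \<open>\<open>C_on\<close> controls derivatives in fixed directions only, while the chain rule
  differentiates \<open>g\<close> in the direction \<open>fderiv f x v\<close>, which moves with
  \<open>x\<close>. Expanding this direction in \<open>Basis\<close> gives a sum of products of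
  functions that are controlled.\<close>

lemma C_on_compose:
  fixes f :: "'a::euclidean_space \<Rightarrow> 'b::euclidean_space"
    and g :: "'b \<Rightarrow> 'c::real_normed_vector"
  assumes "open S" "open T" "f ` S \<subseteq> T" "C_on k S f" "C_on k T g"
  shows "C_on k S (\<lambda>x. g (f x))"
  using assms(4,5)
proof (induction k arbitrary: g)
  case 0
  then show ?case using assms(3) by (auto intro: continuous_on_compose2[of T g S f])
next
  case (Suc k)
  have df: "(f has_derivative fderiv f x) (at x)" if "x \<in> S" for x
    by (intro has_fderiv C_on_Suc_differentiable[OF Suc.prems(1) assms(1) that])
  have dg: "(g has_derivative fderiv g (f x)) (at (f x))" if "x \<in> S" for x
    using that assms(3) by (intro has_fderiv C_on_Suc_differentiable[OF Suc.prems(2) assms(2)]) auto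
  have d: "((\<lambda>x. g (f x)) has_derivative (\<lambda>v. fderiv g (f x) (fderiv f x v))) (at x)" if "x \<in> S" for x
    using diff_chain_at[OF df[OF that] dg[OF that]] by (simp add: comp_def)
  have "(\<lambda>x. g (f x)) differentiable_on S"
    using d by (auto simp: differentiable_on_def intro: differentiableI differentiable_at_withinI)
  moreover have "C_on k S (\<lambda>x. fderiv (\<lambda>x. g (f x)) x v)" for v
  proof (rule C_on_cong[OF assms(1)])
    show "C_on k S (\<lambda>x. \<Sum>i\<in>Basis. (fderiv f x v \<bullet> i) *\<^sub>R fderiv g (f x) i)"
      using Suc.prems C_on_SucD[OF assms(1) Suc.prems(1)]
      by (intro C_on_sum[OF assms(1)] C_on_bilinear[OF bounded_bilinear_scaleR assms(1)]
          C_on_bounded_linear_compose[OF bounded_linear_inner_left assms(1)] Suc.IH) auto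
    fix x assume "x \<in> S"
    then show "(\<Sum>i\<in>Basis. (fderiv f x v \<bullet> i) *\<^sub>R fderiv g (f x) i) = fderiv (\<lambda>x. g (f x)) x v"
      using linear_basis_expand[OF has_derivative_linear[OF dg[OF \<open>x \<in> S\<close>]], of "fderiv f x v"]
      by (simp add: fderiv_eq[OF d])
  qed
  ultimately show ?case by simp
qed

section \<open>The same rules for smooth maps\<close>

lemma smooth_on_cong:
  "open S \<Longrightarrow> smooth_on S f \<Longrightarrow> (\<And>x. x \<in> S \<Longrightarrow> f x = g x) \<Longrightarrow> smooth_on S g"
  unfolding smooth_on_def using C_on_cong by blast

lemma smooth_on_local:
  "(\<And>x. x \<in> S \<Longrightarrow> \<exists>U. open U \<and> x \<in> U \<and> smooth_on U f) \<Longrightarrow> smooth_on S f"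
  unfolding smooth_on_def by (metis C_on_local)

lemma smooth_on_const [simp]: "smooth_on S (\<lambda>x. c)"
  by (simp add: smooth_on_def C_on_const)

lemma smooth_on_id [simp]: "smooth_on S (\<lambda>x. x)"
  by (simp add: smooth_on_def C_on_id)

lemma smooth_on_bounded_linear_compose:
  "bounded_linear h \<Longrightarrow> open S \<Longrightarrow> smooth_on S f \<Longrightarrow> smooth_on S (\<lambda>x. h (f x))"
  by (simp add: smooth_on_def C_on_bounded_linear_compose)

lemma smooth_on_add:
  "open S \<Longrightarrow> smooth_on S f \<Longrightarrow> smooth_on S g \<Longrightarrow> smooth_on S (\<lambda>x. f x + g x)"
  by (simp add: smooth_on_def C_on_add)

lemma smooth_on_sum:
  "open S \<Longrightarrow> (\<And>i. i \<in> I \<Longrightarrow> smooth_on S (f i)) \<Longrightarrow> smooth_on S (\<lambda>x. \<Sum>i\<in>I. f i x)"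
  by (simp add: smooth_on_def C_on_sum)

lemma smooth_on_bilinear:
  "bounded_bilinear pr \<Longrightarrow> open S \<Longrightarrow> smooth_on S f \<Longrightarrow> smooth_on S g \<Longrightarrow>
    smooth_on S (\<lambda>x. pr (f x) (g x))"
  by (simp add: smooth_on_def C_on_bilinear)

lemmas smooth_on_scaleR = smooth_on_bilinear[OF bounded_bilinear_scaleR]
lemmas smooth_on_mult = smooth_on_bilinear[OF bounded_bilinear_mult]
lemmas smooth_on_inner = smooth_on_bilinear[OF bounded_bilinear_inner]
lemmas smooth_on_minus = smooth_on_bounded_linear_compose[OF bounded_linear_minus[OF bounded_linear_ident]]
lemmas smooth_on_fst = smooth_on_bounded_linear_compose[OF bounded_linear_fst]
lemmas smooth_on_snd = smooth_on_bounded_linear_compose[OF bounded_linear_snd]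

lemma smooth_on_Pair:
  assumes "open S" "smooth_on S f" "smooth_on S g"
  shows "smooth_on S (\<lambda>x. (f x, g x))"
proof -
  have 1: "bounded_linear (\<lambda>y. (y, 0))" and 2: "bounded_linear (\<lambda>y. (0, y))"
    by (auto intro: bounded_linear_Pair bounded_linear_ident bounded_linear_zero)
  have "smooth_on S (\<lambda>x. (f x, 0) + (0, g x))"
    by (intro smooth_on_add[OF assms(1)] smooth_on_bounded_linear_compose[OF 1 assms(1)]
        smooth_on_bounded_linear_compose[OF 2 assms(1)] assms)
  then show ?thesis by simp
qed

lemma smooth_on_compose:
  fixes f :: "'a::euclidean_space \<Rightarrow> 'b::euclidean_space"
    and g :: "'b \<Rightarrow> 'c::real_normed_vector"
  shows "open S \<Longrightarrow> open T \<Longrightarrow> f ` S \<subseteq> T \<Longrightarrow> smooth_on S f \<Longrightarrow> smooth_on T g \<Longrightarrow>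
    smooth_on S (\<lambda>x. g (f x))"
  by (simp add: smooth_on_def C_on_compose)

lemma smooth_on_fderiv: "smooth_on S f \<Longrightarrow> smooth_on S (\<lambda>x. fderiv f x v)"
  unfolding smooth_on_def by (metis C_on.simps(2))

lemma smooth_on_differentiable:
  "smooth_on S f \<Longrightarrow> open S \<Longrightarrow> x \<in> S \<Longrightarrow> f differentiable at x"
  unfolding smooth_on_def using C_on_Suc_differentiable by blast

lemma smooth_on_has_derivative:
  "smooth_on S f \<Longrightarrow> open S \<Longrightarrow> x \<in> S \<Longrightarrow> (f has_derivative fderiv f x) (at x)"
  by (rule has_fderiv) (rule smooth_on_differentiable)

lemma smooth_on_continuous: "smooth_on S f \<Longrightarrow> continuous_on S f"
  unfolding smooth_on_def by (metis C_on.simps(1))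

text \<open>The exponent is generalized in the induction because each derivative lowers it by one;
  the instance needed is the exponent of the normalization.\<close>

lemma smooth_on_powr: "smooth_on {0<..} (\<lambda>t::real. t powr a)"
proof -
  have "C_on k {0<..} (\<lambda>t::real. t powr a)" for k
  proof (induction k arbitrary: a)
    case 0
    then show ?case by (auto intro!: continuous_intros)
  next
    case (Suc k)
    have d: "((\<lambda>t. t powr a) has_derivative (\<lambda>v. v *\<^sub>R (a * t powr (a - 1)))) (at t)" if "t > 0" for t :: real
      using has_real_derivative_powr[OF that, of a]
      by (simp add: has_field_derivative_def mult.commute[of _ "_ * _"] fun_eq_iff)
    have "(\<lambda>t::real. t powr a) differentiable_on {0<..}"
      using d by (auto simp: differentiable_on_def intro: differentiableI differentiable_at_withinI)
    moreover have "C_on k {0<..} (\<lambda>t. fderiv (\<lambda>t. t powr a) t v)" for v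
      by (rule C_on_cong[OF _ C_on_bounded_linear_compose[OF bounded_linear_scaleR_right[of "v * a"] _ Suc.IH[of "a - 1"]]])
         (auto simp: fderiv_eq[OF d])
    ultimately show ?case by simp
  qed
  then show ?thesis by (simp add: smooth_on_def)
qed

section \<open>A smooth function that is flat at zero\<close>

definition flat_exp :: "nat \<Rightarrow> real \<Rightarrow> real" where
  "flat_exp n t = (if t \<le> 0 then 0 else inverse t ^ n * exp (- inverse t))"

lemma flat_exp_at_right: "((\<lambda>t. inverse t ^ n * exp (- inverse t)) \<longlongrightarrow> (0::real)) (at_right 0)"
proof -
  have "((\<lambda>x::real. x ^ n / exp x) \<longlongrightarrow> 0) at_top"
    by (rule tendsto_power_div_exp_0)
  then have "((\<lambda>x::real. x ^ n * exp (- x)) \<longlongrightarrow> 0) at_top"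
    by (simp add: exp_minus divide_inverse)
  then show ?thesis
    by (rule filterlim_compose[OF _ filterlim_inverse_at_top_right])
qed

lemma flat_exp_tendsto_0: "(flat_exp n \<longlongrightarrow> 0) (at 0)"
proof (rule filterlim_split_at_real)
  show "(flat_exp n \<longlongrightarrow> 0) (at_left 0)"
    by (rule tendsto_eventually) (auto simp: flat_exp_def eventually_at_filter)
  show "(flat_exp n \<longlongrightarrow> 0) (at_right 0)"
    by (rule Lim_transform_eventually[OF flat_exp_at_right[of n]])
       (auto simp: flat_exp_def eventually_at_filter)
qed

text \<open>The function of interest is \<open>flat_exp 0\<close>. The powers of
  \<open>inverse t\<close> are included because the whole family is then closed under
  differentiation up to linear combinations, which lets smoothness be proved by induction for all
  \<open>n\<close> together.\<close>

lemma flat_exp_deriv: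
  "(flat_exp n has_real_derivative (flat_exp (n + 2) t - of_nat n * flat_exp (n + 1) t)) (at t)"
proof -
  consider "t < 0" | "t = 0" | "t > 0" by linarith
  then show ?thesis
  proof cases
    case 1
    have "((\<lambda>t. 0) has_real_derivative 0) (at t)" by simp
    then have "(flat_exp n has_real_derivative 0) (at t)"
      by (rule has_field_derivative_transform_within_open[of _ _ _ "{..<0}"])
         (use 1 in \<open>auto simp: flat_exp_def\<close>)
    then show ?thesis using 1 by (simp add: flat_exp_def)
  next
    case 2
    \<comment> \<open>At \<open>0\<close> the difference quotient of \<open>flat_exp n\<close> is
      \<open>flat_exp (n + 1)\<close> itself, on both sides.\<close>
    have "(\<lambda>h. (flat_exp n (0 + h) - flat_exp n 0) / h) \<midarrow>0\<rightarrow> 0"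
      by (rule Lim_transform_eventually[OF flat_exp_tendsto_0[of "n + 1"]])
         (auto simp: flat_exp_def eventually_at_filter field_simps)
    then show ?thesis using 2 by (simp add: DERIV_def flat_exp_def)
  next
    case 3
    have p: "t * t ^ (m - Suc 0) = t ^ m" if "m \<noteq> 0" for m
      using that by (cases m) auto
    have "((\<lambda>t. inverse t ^ n * exp (- inverse t)) has_real_derivative
        (flat_exp (n + 2) t - of_nat n * flat_exp (n + 1) t)) (at t)"
      using 3
      by (cases n)
        (auto intro!: derivative_eq_intros simp: flat_exp_def power2_eq_square field_simps, metis p)
    then show ?thesis
      by (rule has_field_derivative_transform_within_open[of _ _ _ "{0<..}"])
         (use 3 in \<open>auto simp: flat_exp_def\<close>)
  qed
qed

lemma smooth_flat_exp: "smooth_on UNIV (flat_exp n)"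
proof -
  have "C_on k UNIV (flat_exp n)" for k
  proof (induction k arbitrary: n)
    case 0
    show ?case using flat_exp_deriv[of n] by (auto simp: continuous_on_eq_continuous_at intro: DERIV_isCont)
  next
    case (Suc k)
    have d: "(flat_exp n has_derivative
        (\<lambda>v. v *\<^sub>R (flat_exp (n + 2) t + (- of_nat n) *\<^sub>R flat_exp (n + 1) t))) (at t)" for t
      by (rule has_derivative_eq_rhs[OF flat_exp_deriv[of n t, unfolded has_field_derivative_def]])
        (auto simp: fun_eq_iff algebra_simps)
    have "flat_exp n differentiable_on UNIV"
      using d by (auto simp: differentiable_on_def intro: differentiableI)
    moreover have "C_on k UNIV (\<lambda>t. fderiv (flat_exp n) t v)" for v
      unfolding fderiv_eq[OF d]
      by (intro C_on_bounded_linear_compose[OF bounded_linear_scaleR_right] C_on_add Suc.IH) auto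
    ultimately show ?case by simp
  qed
  then show ?thesis by (simp add: smooth_on_def)
qed

text \<open>Both iterated derivatives are the limit of the second difference quotient, by applying the
  mean value theorem twice.\<close>

lemma second_difference:
  fixes f :: "'a::real_normed_vector \<Rightarrow> real"
  assumes "open S" and f: "\<And>y. y \<in> S \<Longrightarrow> f differentiable at y"
    and fu: "\<And>y. y \<in> S \<Longrightarrow> (\<lambda>z. fderiv f z u) differentiable at y"
    and h: "0 < h" and box: "\<And>s t. 0 \<le> s \<Longrightarrow> s \<le> h \<Longrightarrow> 0 \<le> t \<Longrightarrow> t \<le> h \<Longrightarrow> x + s *\<^sub>R u + t *\<^sub>R v \<in> S"
  shows "\<exists>s t. 0 < s \<and> s < h \<and> 0 < t \<and> t < h \<and>
    f (x + h *\<^sub>R u + h *\<^sub>R v) - f (x + h *\<^sub>R u) - f (x + h *\<^sub>R v) + f x =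
    h * h * fderiv (\<lambda>z. fderiv f z u) (x + s *\<^sub>R u + t *\<^sub>R v) v"
proof -
  let ?g = "\<lambda>s. f (x + s *\<^sub>R u + h *\<^sub>R v) - f (x + s *\<^sub>R u)"
  have d1: "((\<lambda>s. f (x + s *\<^sub>R u + t *\<^sub>R v)) has_real_derivative fderiv f (x + s *\<^sub>R u + t *\<^sub>R v) u) (at s)"
    if "0 \<le> s" "s \<le> h" "0 \<le> t" "t \<le> h" for s t
  proof -
    have a: "((\<lambda>s. x + s *\<^sub>R u + t *\<^sub>R v) has_derivative (\<lambda>r. r *\<^sub>R u)) (at s)"
      by (auto intro!: derivative_eq_intros)
    have L: "linear (fderiv f (x + s *\<^sub>R u + t *\<^sub>R v))"
      using has_fderiv[OF f[OF box[OF that]]] has_derivative_linear by blast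
    show ?thesis
      unfolding has_field_derivative_def
      by (rule has_derivative_eq_rhs[OF
            diff_chain_at[OF a has_fderiv[OF f[OF box[OF that]]], unfolded comp_def]])
        (auto simp: linear_scale[OF L])
  qed
  have d2: "((\<lambda>t. fderiv f (x + s *\<^sub>R u + t *\<^sub>R v) u) has_real_derivative
      fderiv (\<lambda>z. fderiv f z u) (x + s *\<^sub>R u + t *\<^sub>R v) v) (at t)"
    if "0 \<le> s" "s \<le> h" "0 \<le> t" "t \<le> h" for s t
  proof -
    have a: "((\<lambda>t. x + s *\<^sub>R u + t *\<^sub>R v) has_derivative (\<lambda>r. r *\<^sub>R v)) (at t)"
      by (auto intro!: derivative_eq_intros)
    have L: "linear (fderiv (\<lambda>z. fderiv f z u) (x + s *\<^sub>R u + t *\<^sub>R v))"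
      using has_fderiv[OF fu[OF box[OF that]]] has_derivative_linear by blast
    show ?thesis
      unfolding has_field_derivative_def
      by (rule has_derivative_eq_rhs[OF
            diff_chain_at[OF a has_fderiv[OF fu[OF box[OF that]]], unfolded comp_def]])
        (auto simp: linear_scale[OF L])
  qed
  have "\<exists>s. 0 < s \<and> s < h \<and> ?g h - ?g 0 =
      (h - 0) * (fderiv f (x + s *\<^sub>R u + h *\<^sub>R v) u - fderiv f (x + s *\<^sub>R u + 0 *\<^sub>R v) u)"
  proof (rule MVT2[OF h])
    fix s assume "0 \<le> s" "s \<le> h"
    then show "(?g has_real_derivative fderiv f (x + s *\<^sub>R u + h *\<^sub>R v) u - fderiv f (x + s *\<^sub>R u + 0 *\<^sub>R v) u) (at s)"
      using DERIV_diff[OF d1[of s h] d1[of s 0]] h by simp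
  qed
  then obtain s where s: "0 < s" "s < h" and 1: "?g h - ?g 0 =
      h * (fderiv f (x + s *\<^sub>R u + h *\<^sub>R v) u - fderiv f (x + s *\<^sub>R u + 0 *\<^sub>R v) u)" by auto
  obtain t where t: "0 < t" "t < h" and 2:
    "fderiv f (x + s *\<^sub>R u + h *\<^sub>R v) u - fderiv f (x + s *\<^sub>R u + 0 *\<^sub>R v) u =
      (h - 0) * fderiv (\<lambda>z. fderiv f z u) (x + s *\<^sub>R u + t *\<^sub>R v) v"
    using MVT2[OF h d2[of s]] s by force
  show ?thesis
    using s t 1 unfolding 2 by (intro exI[of _ s] exI[of _ t]) (simp add: algebra_simps)
qed

lemma fderiv_symmetric_real:
  fixes f :: "'a::euclidean_space \<Rightarrow> real"
  assumes "smooth_on S f" "open S" "x \<in> S"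
  shows "fderiv (\<lambda>z. fderiv f z u) x v = fderiv (\<lambda>z. fderiv f z v) x u"
proof -
  define F where "F u v y = fderiv (\<lambda>z. fderiv f z u) y v" for u v y
  obtain e where e: "e > 0" "ball x e \<subseteq> S" using assms(2,3) open_contains_ball by blast
  \<comment> \<open>Parallelograms with both parameters up to \<open>c\<close> stay in the ball: the
    summand \<open>1\<close> keeps the denominator positive when \<open>u\<close> and
    \<open>v\<close> vanish, and the factor \<open>2\<close> makes the bound strict. The sides
    \<open>h n\<close> below start with \<open>c\<close> and tend to \<open>0\<close>.\<close>
  define c where "c = e / (2 * (norm u + norm v + 1))"
  have c: "c > 0" using e unfolding c_def by (intro divide_pos_pos mult_pos_pos add_nonneg_pos) auto
  have near: "norm (s *\<^sub>R u + t *\<^sub>R v) < e" if "0 \<le> s" "s \<le> c" "0 \<le> t" "t \<le> c" for s t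
  proof -
    have "norm (s *\<^sub>R u + t *\<^sub>R v) \<le> s * norm u + t * norm v"
      using norm_triangle_ineq[of "s *\<^sub>R u" "t *\<^sub>R v"] that by simp
    also have "\<dots> \<le> c * norm u + c * norm v" using that by (intro add_mono mult_right_mono) auto
    also have "\<dots> \<le> c * (norm u + norm v + 1)" using c by (simp add: algebra_simps)
    also have "\<dots> = e / 2"
    proof -
      have "norm u + norm v + 1 > 0" by (simp add: add_nonneg_pos)
      then show ?thesis unfolding c_def by (simp add: field_simps)
    qed
    also have "\<dots> < e" using e by simp
    finally show ?thesis .
  qed
  have box: "x + s *\<^sub>R u + t *\<^sub>R v \<in> S" "x + s *\<^sub>R v + t *\<^sub>R u \<in> S"
    if "0 \<le> s" "s \<le> c" "0 \<le> t" "t \<le> c" for s t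
  proof -
    have *: "x + w \<in> S" if "norm w < e" for w using e(2) that by (auto simp: dist_norm)
    show "x + s *\<^sub>R u + t *\<^sub>R v \<in> S" "x + s *\<^sub>R v + t *\<^sub>R u \<in> S"
      using *[OF near[OF that]] *[OF near[OF that(3,4,1,2)]] by (simp_all add: ac_simps)
  qed
  have ds: "f differentiable at y" "(\<lambda>z. fderiv f z w) differentiable at y" if "y \<in> S" for y w
    using smooth_on_differentiable[OF assms(1,2) that]
      smooth_on_differentiable[OF smooth_on_fderiv[OF assms(1)] assms(2) that] by auto
  define h where "h n = c / real (Suc n)" for n
  have h: "0 < h n" "h n \<le> c" for n using c by (auto simp: h_def field_simps)
  have h0: "h \<longlonglongrightarrow> 0"
    unfolding h_def using tendsto_mult[OF tendsto_const[of c] LIMSEQ_inverse_real_of_nat]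
    by (simp add: divide_inverse)
  have "\<exists>s t. 0 < s \<and> s < h n \<and> 0 < t \<and> t < h n \<and>
      f (x + h n *\<^sub>R u + h n *\<^sub>R v) - f (x + h n *\<^sub>R u) - f (x + h n *\<^sub>R v) + f x =
      h n * h n * F u v (x + s *\<^sub>R u + t *\<^sub>R v)" for n
    unfolding F_def
    by (rule second_difference[OF assms(2)]) (use h[of n] ds box(1) in \<open>auto intro: order_trans\<close>)
  then obtain s t where st: "\<And>n. 0 < s n \<and> s n < h n \<and> 0 < t n \<and> t n < h n \<and>
      f (x + h n *\<^sub>R u + h n *\<^sub>R v) - f (x + h n *\<^sub>R u) - f (x + h n *\<^sub>R v) + f x =
      h n * h n * F u v (x + s n *\<^sub>R u + t n *\<^sub>R v)" by metis
  have "\<exists>s t. 0 < s \<and> s < h n \<and> 0 < t \<and> t < h n \<and>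
      f (x + h n *\<^sub>R v + h n *\<^sub>R u) - f (x + h n *\<^sub>R v) - f (x + h n *\<^sub>R u) + f x =
      h n * h n * F v u (x + s *\<^sub>R v + t *\<^sub>R u)" for n
    unfolding F_def
    by (rule second_difference[OF assms(2)]) (use h[of n] ds box(2) in \<open>auto intro: order_trans\<close>)
  then obtain s' t' where st': "\<And>n. 0 < s' n \<and> s' n < h n \<and> 0 < t' n \<and> t' n < h n \<and>
      f (x + h n *\<^sub>R v + h n *\<^sub>R u) - f (x + h n *\<^sub>R v) - f (x + h n *\<^sub>R u) + f x =
      h n * h n * F v u (x + s' n *\<^sub>R v + t' n *\<^sub>R u)" by metis
  have z: "a \<longlonglongrightarrow> 0" if "\<And>n. 0 < a n \<and> a n < h n" for a :: "nat \<Rightarrow> real"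
    by (rule tendsto_sandwich[OF _ _ tendsto_const h0]) (use that in \<open>auto intro!: eventuallyI less_imp_le\<close>)
  have cont: "isCont (F a b) x" for a b
  proof -
    have "continuous_on S (F a b)"
      unfolding F_def by (intro smooth_on_continuous smooth_on_fderiv assms)
    then show ?thesis using assms(2,3) by (simp add: continuous_on_eq_continuous_at)
  qed
  have "(\<lambda>n. F u v (x + s n *\<^sub>R u + t n *\<^sub>R v)) \<longlonglongrightarrow> F u v x"
    by (rule isCont_tendsto_compose[OF cont]) (use z[of s] z[of t] st in \<open>auto intro!: tendsto_eq_intros\<close>)
  moreover have "(\<lambda>n. F v u (x + s' n *\<^sub>R v + t' n *\<^sub>R u)) \<longlonglongrightarrow> F v u x"
    by (rule isCont_tendsto_compose[OF cont]) (use z[of s'] z[of t'] st' in \<open>auto intro!: tendsto_eq_intros\<close>)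
  moreover have "F u v (x + s n *\<^sub>R u + t n *\<^sub>R v) = F v u (x + s' n *\<^sub>R v + t' n *\<^sub>R u)" for n
  proof -
    have "h n * h n * F u v (x + s n *\<^sub>R u + t n *\<^sub>R v) = h n * h n * F v u (x + s' n *\<^sub>R v + t' n *\<^sub>R u)"
      using st[of n] st'[of n] by (simp add: algebra_simps)
    then show ?thesis using h(1)[of n] by simp
  qed
  ultimately have "F u v x = F v u x" using LIMSEQ_unique by simp
  then show ?thesis by (simp add: F_def)
qed

lemma fderiv_inner:
  assumes "f differentiable at x"
  shows "fderiv (\<lambda>z. f z \<bullet> i) x v = fderiv f x v \<bullet> i"
  using fderiv_eq[OF has_derivative_inner_left[OF has_fderiv[OF assms]]] by simp

lemma fderiv_symmetric:
  fixes f :: "'a::euclidean_space \<Rightarrow> 'b::euclidean_space"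
  assumes "smooth_on S f" "open S" "x \<in> S"
  shows "fderiv (\<lambda>z. fderiv f z u) x v = fderiv (\<lambda>z. fderiv f z v) x u"
proof (rule euclidean_eqI)
  fix i :: 'b assume "i \<in> Basis"
  have s: "smooth_on S (\<lambda>z. f z \<bullet> i)"
    by (rule smooth_on_bounded_linear_compose[OF bounded_linear_inner_left assms(2,1)])
  have e: "fderiv (\<lambda>z. fderiv (\<lambda>z. f z \<bullet> i) z w) x w' = fderiv (\<lambda>z. fderiv f z w) x w' \<bullet> i" for w w'
  proof -
    have "fderiv (\<lambda>z. fderiv (\<lambda>z. f z \<bullet> i) z w) x = fderiv (\<lambda>z. fderiv f z w \<bullet> i) x"
      by (rule fderiv_cong_open[OF assms(2,3)]) (simp add: fderiv_inner smooth_on_differentiable[OF assms(1,2)])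
    then show ?thesis
      using fderiv_inner[OF smooth_on_differentiable[OF smooth_on_fderiv[OF assms(1)] assms(2,3)]] by simp
  qed
  show "fderiv (\<lambda>z. fderiv f z u) x v \<bullet> i = fderiv (\<lambda>z. fderiv f z v) x u \<bullet> i"
    using fderiv_symmetric_real[OF s assms(2,3), of u v] by (simp add: e)
qed

section \<open>Atlases and their tangent spaces\<close>

text \<open>The conditions of \<open>smooth_manifold\<close> on charts, separated from those on the
  topology. They are also established for \<open>cotangent_bundle B\<close>, so that one set of
  lemmas on tangent spaces serves the base and the phase space.\<close>

locale smooth_atlas =
  fixes M :: "('m, 'e::euclidean_space) atlas"
  assumes chart_inj: "c \<in> M \<Longrightarrow> inj_on (snd c) (fst c)"
    and chart_image_open: "c \<in> M \<Longrightarrow> open (chart_image c)"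
    and overlap_open: "c \<in> M \<Longrightarrow> c' \<in> M \<Longrightarrow> open (snd c ` (fst c \<inter> fst c'))"
    and transition_smooth:
      "c \<in> M \<Longrightarrow> c' \<in> M \<Longrightarrow> smooth_on (snd c ` (fst c \<inter> fst c')) (transition c c')"

lemma smooth_manifold_imp_smooth_atlas: "smooth_manifold M \<Longrightarrow> smooth_atlas M"
  unfolding smooth_manifold_def smooth_atlas_def by blast

context smooth_atlas
begin

abbreviation jac :: "('m, 'e) chart \<Rightarrow> ('m, 'e) chart \<Rightarrow> 'm \<Rightarrow> 'e \<Rightarrow> 'e" where
  "jac c c' m \<equiv> fderiv (transition c c') (snd c m)"

lemma charts_atD: "c \<in> charts_at M m \<Longrightarrow> c \<in> M \<and> m \<in> fst c"
  by (simp add: charts_at_def)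

lemma some_chart_in: "m \<in> points M \<Longrightarrow> some_chart M m \<in> charts_at M m"
  unfolding some_chart_def by (rule someI_ex) (auto simp: points_def charts_at_def)

lemma charts_at_imp_points: "c \<in> charts_at M m \<Longrightarrow> m \<in> points M"
  by (auto simp: points_def charts_at_def)

lemma chart_inv_chart: "c \<in> M \<Longrightarrow> m \<in> fst c \<Longrightarrow> chart_inv c (snd c m) = m"
  by (simp add: chart_inv_def chart_inj inv_into_f_f)

lemma chart_inv_in: "x \<in> chart_image c \<Longrightarrow> chart_inv c x \<in> fst c"
  by (simp add: chart_inv_def chart_image_def inv_into_into)

lemma chart_chart_inv: "x \<in> chart_image c \<Longrightarrow> snd c (chart_inv c x) = x"
  by (simp add: chart_inv_def chart_image_def f_inv_into_f)

lemma chart_inv_charts_at: "c \<in> M \<Longrightarrow> x \<in> chart_image c \<Longrightarrow> c \<in> charts_at M (chart_inv c x)"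
  by (simp add: charts_at_def chart_inv_in)

lemma chart_in_image: "m \<in> fst c \<Longrightarrow> snd c m \<in> chart_image c"
  by (simp add: chart_image_def)

lemma transition_apply: "c \<in> M \<Longrightarrow> m \<in> fst c \<Longrightarrow> transition c c' (snd c m) = snd c' m"
  by (simp add: transition_def chart_inv_chart)

lemma transition_has_derivative:
  assumes "c \<in> charts_at M m" "c' \<in> charts_at M m"
  shows "(transition c c' has_derivative jac c c' m) (at (snd c m))"
  using assms
  by (intro smooth_on_has_derivative[OF transition_smooth overlap_open])
     (auto simp: charts_at_def)

lemma linear_jac:
  assumes "c \<in> charts_at M m" "c' \<in> charts_at M m"
  shows "linear (jac c c' m)"
  using transition_has_derivative[OF assms] has_derivative_linear by blast

lemma jac_comp:
  assumes c: "c \<in> charts_at M m" "c' \<in> charts_at M m" "c'' \<in> charts_at M m"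
  shows "jac c' c'' m (jac c c' m v) = jac c c'' m v"
proof -
  note d = charts_atD[OF c(1)] charts_atD[OF c(2)] charts_atD[OF c(3)]
  let ?U = "snd c ` (fst c \<inter> fst c') \<inter> snd c ` (fst c \<inter> fst c'')"
  have U: "open ?U" using d by (intro open_Int overlap_open) auto
  have m: "snd c m \<in> ?U" using d by auto
  have t: "transition c' c'' (transition c c' y) = transition c c'' y" if y: "y \<in> ?U" for y
  proof -
    obtain b where "y = snd c b" "b \<in> fst c" "b \<in> fst c'"
      using y by auto
    then show ?thesis using d by (simp add: transition_apply)
  qed
  have "((\<lambda>y. transition c' c'' (transition c c' y)) has_derivative
      (\<lambda>v. jac c' c'' m (jac c c' m v))) (at (snd c m))"
    using diff_chain_at[OF transition_has_derivative[OF c(1,2)], of "transition c' c''" "jac c' c'' m"]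
      transition_has_derivative[OF c(2,3)] d by (simp add: comp_def transition_apply)
  then have "(transition c c'' has_derivative (\<lambda>v. jac c' c'' m (jac c c' m v))) (at (snd c m))"
    by (rule has_derivative_transform_within_open[OF _ U m]) (rule t)
  then show ?thesis by (simp add: fderiv_eq)
qed

lemma jac_self:
  assumes c: "c \<in> charts_at M m"
  shows "jac c c m v = v"
proof -
  have "((\<lambda>x. x) has_derivative (\<lambda>v. v)) (at (snd c m))" by simp
  then have "(transition c c has_derivative (\<lambda>v. v)) (at (snd c m))"
    by (rule has_derivative_transform_within_open[OF _ chart_image_open[of c] chart_in_image])
       (use charts_atD[OF c] in \<open>auto simp: chart_image_def transition_apply\<close>)
  then show ?thesis by (simp add: fderiv_eq)
qed

lemma tangent_change:
  "X \<in> tangent_space M m \<Longrightarrow> c \<in> charts_at M m \<Longrightarrow> c' \<in> charts_at M m \<Longrightarrow> X c' = jac c c' m (X c)"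
  unfolding tangent_space_def by blast

lemma tangent_outside: "X \<in> tangent_space M m \<Longrightarrow> c \<notin> charts_at M m \<Longrightarrow> X c = 0"
  unfolding tangent_space_def by blast

lemma coord_vector_in: "c \<in> charts_at M m \<Longrightarrow> coord_vector M c m v \<in> tangent_space M m"
  by (simp add: tangent_space_def coord_vector_def jac_comp)

lemma coord_vector_apply:
  "c' \<in> charts_at M m \<Longrightarrow> coord_vector M c m v c' = jac c c' m v"
  by (simp add: coord_vector_def)

lemma coord_vector_self: "c \<in> charts_at M m \<Longrightarrow> coord_vector M c m v c = v"
  by (simp add: coord_vector_def jac_self)

lemma coord_vector_eq:
  assumes "X \<in> tangent_space M m" "c \<in> charts_at M m"
  shows "coord_vector M c m (X c) = X"
proof
  fix c' show "coord_vector M c m (X c) c' = X c'"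
    using tangent_change[OF assms, of c'] tangent_outside[OF assms(1), of c']
    by (simp add: coord_vector_def)
qed

lemma tangent_eqI:
  "X \<in> tangent_space M m \<Longrightarrow> Y \<in> tangent_space M m \<Longrightarrow> c \<in> charts_at M m \<Longrightarrow> X c = Y c \<Longrightarrow> X = Y"
  using coord_vector_eq by metis

lemma coord_vector_add:
  "c \<in> charts_at M m \<Longrightarrow> coord_vector M c m (u + v) = coord_vector M c m u + coord_vector M c m v"
  by (auto simp: coord_vector_def fun_eq_iff linear_add[OF linear_jac])

lemma coord_vector_scale:
  "c \<in> charts_at M m \<Longrightarrow> coord_vector M c m (r *\<^sub>R v) = smul r (coord_vector M c m v)"
  by (auto simp: coord_vector_def smul_def fun_eq_iff linear_scale[OF linear_jac])

lemma tangent_add: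
  assumes "m \<in> points M" "X \<in> tangent_space M m" "Y \<in> tangent_space M m"
  shows "X + Y \<in> tangent_space M m"
proof -
  note c = some_chart_in[OF assms(1)]
  show ?thesis
    using coord_vector_add[OF c] coord_vector_eq[OF assms(2) c] coord_vector_eq[OF assms(3) c]
      coord_vector_in[OF c] by metis
qed

lemma tangent_smul:
  assumes "m \<in> points M" "X \<in> tangent_space M m"
  shows "smul r X \<in> tangent_space M m"
proof -
  note c = some_chart_in[OF assms(1)]
  show ?thesis
    using coord_vector_scale[OF c] coord_vector_eq[OF assms(2) c] coord_vector_in[OF c] by metis
qed

lemma covector_add:
  "\<xi> \<in> cotangent_space M m \<Longrightarrow> X \<in> tangent_space M m \<Longrightarrow> Y \<in> tangent_space M m \<Longrightarrow> \<xi> (X + Y) = \<xi> X + \<xi> Y"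
  by (simp add: cotangent_space_def)

lemma covector_smul:
  "\<xi> \<in> cotangent_space M m \<Longrightarrow> X \<in> tangent_space M m \<Longrightarrow> \<xi> (smul r X) = r * \<xi> X"
  by (simp add: cotangent_space_def)

lemma covector_outside:
  "\<xi> \<in> cotangent_space M m \<Longrightarrow> X \<notin> tangent_space M m \<Longrightarrow> \<xi> X = 0"
  by (simp add: cotangent_space_def)

lemma linear_covector_coord_vector:
  assumes "\<xi> \<in> cotangent_space M m" "c \<in> charts_at M m"
  shows "linear (\<lambda>v. \<xi> (coord_vector M c m v))"
  using assms
  by (intro linearI)
    (auto simp: coord_vector_add coord_vector_scale covector_add covector_smul coord_vector_in)

lemma covector_apply:
  assumes "\<xi> \<in> cotangent_space M m" "X \<in> tangent_space M m" "c \<in> charts_at M m"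
  shows "\<xi> X = covector_components M c m \<xi> \<bullet> X c"
  using linear_basis_expand[OF linear_covector_coord_vector[OF assms(1,3)], of "X c"]
    coord_vector_eq[OF assms(2,3)]
  by (simp add: covector_components_def inner_sum_left mult.commute inner_commute[of "X c"])

lemma coord_covector_in:
  assumes "c \<in> charts_at M m"
  shows "coord_covector M c m p \<in> cotangent_space M m"
  using tangent_add tangent_smul charts_at_imp_points[OF assms]
  by (auto simp: cotangent_space_def coord_covector_def inner_add_right smul_def)

lemma covector_components_coord_covector:
  assumes "c \<in> charts_at M m"
  shows "covector_components M c m (coord_covector M c m p) = p"
  by (simp add: covector_components_def coord_covector_def coord_vector_in[OF assms]
      coord_vector_self[OF assms] euclidean_representation)

lemma coord_covector_components:
  assumes "\<xi> \<in> cotangent_space M m" "c \<in> charts_at M m"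
  shows "coord_covector M c m (covector_components M c m \<xi>) = \<xi>"
  using covector_apply[OF assms(1) _ assms(2)] covector_outside[OF assms(1)]
  by (auto simp: coord_covector_def fun_eq_iff)

text \<open>The sum is the adjoint of \<open>jac c' c m\<close> applied to the components: covectors
  transform by the transposed inverse of the Jacobian.\<close>

lemma covector_components_change:
  assumes "\<xi> \<in> cotangent_space M m" "c \<in> charts_at M m" "c' \<in> charts_at M m"
  shows "covector_components M c' m \<xi> =
    (\<Sum>i\<in>Basis. (covector_components M c m \<xi> \<bullet> jac c' c m i) *\<^sub>R i)"
  unfolding covector_components_def[of M c']
  by (intro sum.cong refl)
    (simp add: covector_apply[OF assms(1) coord_vector_in[OF assms(3)] assms(2)] coord_vector_apply[OF assms(2)])

lemma cotangent_smul:
  assumes "m \<in> points M" "\<xi> \<in> cotangent_space M m"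
  shows "smul r \<xi> \<in> cotangent_space M m"
  using assms by (auto simp: cotangent_space_def algebra_simps smul_def)

end


section \<open>The cotangent bundle\<close>

locale smooth_surface = base: smooth_atlas B for B :: "'b surface"
begin

lemma fst_cotangent_chart: "fst (cotangent_chart B c) = {(b, \<xi>). b \<in> fst c \<and> \<xi> \<in> cotangent_space B b}"
  by (simp add: cotangent_chart_def)

lemma snd_cotangent_chart: "snd (cotangent_chart B c) (b, \<xi>) = (snd c b, covector_components B c b \<xi>)"
  by (simp add: cotangent_chart_def)

text \<open>With the parameter \<open>U\<close> this gives both the images of whole charts and those
  of overlaps. All of them are products with the full fibre, hence open.\<close>

lemma cotangent_chart_overlap_image:
  assumes "c \<in> B" "U \<subseteq> fst c"
  shows "snd (cotangent_chart B c) ` {(b, \<xi>). b \<in> U \<and> \<xi> \<in> cotangent_space B b} = (snd c ` U) \<times> UNIV"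
proof (intro equalityI subsetI)
  fix z assume "z \<in> (snd c ` U) \<times> (UNIV :: (real^2) set)"
  then obtain b p where z: "z = (snd c b, p)" "b \<in> U" by (cases z) auto
  then have c: "c \<in> charts_at B b" using assms by (auto simp: charts_at_def)
  have "z = snd (cotangent_chart B c) (b, coord_covector B c b p)"
    by (simp add: snd_cotangent_chart base.covector_components_coord_covector[OF c] z)
  then show "z \<in> snd (cotangent_chart B c) ` {(b, \<xi>). b \<in> U \<and> \<xi> \<in> cotangent_space B b}"
    using z base.coord_covector_in[OF c] by blast
qed (auto simp: snd_cotangent_chart)

lemma chart_image_cotangent_chart:
  "c \<in> B \<Longrightarrow> chart_image (cotangent_chart B c) = chart_image c \<times> UNIV"
  unfolding chart_image_def fst_cotangent_chart by (rule cotangent_chart_overlap_image) auto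

lemma cotangent_overlap:
  assumes "c \<in> B"
  shows "snd (cotangent_chart B c) ` (fst (cotangent_chart B c) \<inter> fst (cotangent_chart B c')) =
    (snd c ` (fst c \<inter> fst c')) \<times> UNIV"
proof -
  have "fst (cotangent_chart B c) \<inter> fst (cotangent_chart B c') =
      {(b, \<xi>). b \<in> fst c \<inter> fst c' \<and> \<xi> \<in> cotangent_space B b}"
    by (auto simp: fst_cotangent_chart)
  then show ?thesis using cotangent_chart_overlap_image[OF assms, of "fst c \<inter> fst c'"] by simp
qed

lemma inj_cotangent_chart:
  assumes "c \<in> B"
  shows "inj_on (snd (cotangent_chart B c)) (fst (cotangent_chart B c))"
proof (rule inj_onI)
  fix u v assume u: "u \<in> fst (cotangent_chart B c)" and v: "v \<in> fst (cotangent_chart B c)"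
    and e: "snd (cotangent_chart B c) u = snd (cotangent_chart B c) v"
  obtain a \<xi> b \<zeta> where uv: "u = (a, \<xi>)" "v = (b, \<zeta>)" by (cases u, cases v)
  have ab: "a = b" using e u v base.chart_inj[OF assms]
    by (auto simp: uv snd_cotangent_chart fst_cotangent_chart inj_on_def)
  have c: "c \<in> charts_at B b" using v assms by (auto simp: uv fst_cotangent_chart charts_at_def)
  have "\<xi> = \<zeta>"
    using e u v base.coord_covector_components[OF _ c]
    by (simp add: uv ab snd_cotangent_chart fst_cotangent_chart) metis
  then show "u = v" by (simp add: uv ab)
qed

lemma chart_inv_cotangent_chart:
  assumes "c \<in> B" "x \<in> chart_image c"
  shows "chart_inv (cotangent_chart B c) (x, p) = (chart_inv c x, coord_covector B c (chart_inv c x) p)"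
proof -
  note c = base.chart_inv_charts_at[OF assms]
  have "(x, p) = snd (cotangent_chart B c) (chart_inv c x, coord_covector B c (chart_inv c x) p)"
    by (simp add: snd_cotangent_chart base.covector_components_coord_covector[OF c] base.chart_chart_inv[OF assms(2)])
  moreover have "(chart_inv c x, coord_covector B c (chart_inv c x) p) \<in> fst (cotangent_chart B c)"
    using base.coord_covector_in[OF c] base.charts_atD[OF c] by (simp add: fst_cotangent_chart)
  ultimately show ?thesis
    by (simp add: chart_inv_def inv_into_f_f[OF inj_cotangent_chart[OF assms(1)]])
qed

text \<open>The momenta are changed by the transposed Jacobian of the inverse transition, taken at
  the image point. This explicit formula is what gets differentiated, once for smoothness and once
  for the invariance of the canonical form.\<close>

lemma transition_cotangent_chart:
  assumes "c \<in> B" "c' \<in> B" "x \<in> snd c ` (fst c \<inter> fst c')"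
  shows "transition (cotangent_chart B c) (cotangent_chart B c') (x, p) =
    (transition c c' x, \<Sum>i\<in>Basis. (p \<bullet> fderiv (transition c' c) (transition c c' x) i) *\<^sub>R i)"
proof -
  obtain b where b: "x = snd c b" "b \<in> fst c" "b \<in> fst c'" using assms(3) by auto
  then have c: "c \<in> charts_at B b" "c' \<in> charts_at B b" using assms by (auto simp: charts_at_def)
  have x: "x \<in> chart_image c" "chart_inv c x = b"
    using b assms by (auto simp: chart_image_def base.chart_inv_chart)
  show ?thesis
    using b(2) assms(1) unfolding transition_def comp_def chart_inv_cotangent_chart[OF assms(1) x(1)] x(2) snd_cotangent_chart
      base.covector_components_change[OF base.coord_covector_in[OF c(1)] c]
      base.covector_components_coord_covector[OF c(1)]
    by simp
qed

lemma smooth_on_fst_arg: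
  assumes "open S" "smooth_on S f"
  shows "smooth_on (S \<times> UNIV) (\<lambda>z. f (fst z))"
  by (rule smooth_on_compose[of _ S fst f])
    (use assms in \<open>auto intro!: open_Times smooth_on_fst\<close>)

lemma smooth_transition_cotangent_chart:
  assumes "c \<in> B" "c' \<in> B"
  shows "smooth_on ((snd c ` (fst c \<inter> fst c')) \<times> UNIV)
    (transition (cotangent_chart B c) (cotangent_chart B c'))"
proof -
  let ?S = "snd c ` (fst c \<inter> fst c')" and ?S' = "snd c' ` (fst c' \<inter> fst c)"
  have S: "open ?S" "open ?S'" "open (?S \<times> (UNIV :: (real^2) set))"
    using assms by (auto intro!: open_Times base.overlap_open)
  have t: "transition c c' ` ?S \<subseteq> ?S'"
    using assms by (auto simp: base.transition_apply)
  have s1: "smooth_on ?S (transition c c')" by (rule base.transition_smooth[OF assms])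
  have s2: "smooth_on ?S (\<lambda>x. fderiv (transition c' c) (transition c c' x) i)" for i
    by (rule smooth_on_compose[OF S(1,2) t s1, of "\<lambda>y. fderiv (transition c' c) y i"])
       (rule smooth_on_fderiv[OF base.transition_smooth[OF assms(2,1)]])
  have "smooth_on (?S \<times> UNIV) (\<lambda>z. (transition c c' (fst z),
      \<Sum>i\<in>Basis. (snd z \<bullet> fderiv (transition c' c) (transition c c' (fst z)) i) *\<^sub>R i))"
    by (intro smooth_on_Pair S smooth_on_fst_arg[of _ "transition c c'"] s1 smooth_on_sum
        smooth_on_scaleR smooth_on_inner smooth_on_snd smooth_on_id smooth_on_const
        smooth_on_fst_arg[of _ "\<lambda>x. fderiv (transition c' c) (transition c c' x) _"] s2)
  then show ?thesis
    by (rule smooth_on_cong[OF S(3)]) (use transition_cotangent_chart[OF assms] in force)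
qed

text \<open>From here on the lemmas on atlases exist twice, with prefix \<open>base\<close> for the
  surface and with prefix \<open>phase\<close> for its cotangent bundle.\<close>

sublocale phase: smooth_atlas "cotangent_bundle B"
proof
  fix C C' assume "C \<in> cotangent_bundle B" "C' \<in> cotangent_bundle B"
  then obtain c c' where c: "c \<in> B" "C = cotangent_chart B c" "c' \<in> B" "C' = cotangent_chart B c'"
    by (auto simp: cotangent_bundle_def)
  show "inj_on (snd C) (fst C)" using inj_cotangent_chart c by simp
  show "open (chart_image C)"
    using c by (simp add: chart_image_cotangent_chart open_Times base.chart_image_open)
  show "open (snd C ` (fst C \<inter> fst C'))"
    using c by (simp add: cotangent_overlap open_Times base.overlap_open)
  show "smooth_on (snd C ` (fst C \<inter> fst C')) (transition C C')"
    using c by (simp add: cotangent_overlap smooth_transition_cotangent_chart)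
qed

lemma charts_at_cotangent_bundle:
  "C \<in> charts_at (cotangent_bundle B) (b, \<xi>) \<longleftrightarrow>
    (\<exists>c\<in>charts_at B b. C = cotangent_chart B c) \<and> \<xi> \<in> cotangent_space B b"
  unfolding charts_at_def cotangent_bundle_def using fst_cotangent_chart by blast

lemma points_cotangent_bundle:
  "points (cotangent_bundle B) = {(b, \<xi>). b \<in> points B \<and> \<xi> \<in> cotangent_space B b}"
  by (auto simp: points_def cotangent_bundle_def fst_cotangent_chart)

text \<open>The derivative of the lifted coordinate change contains the second derivative of the inverse
  coordinate change; the corresponding terms cancel in the canonical form by symmetry.\<close>

lemma jac_cotangent_symplectic:
  assumes C: "C \<in> charts_at (cotangent_bundle B) m" "C' \<in> charts_at (cotangent_bundle B) m"
  defines "T \<equiv> phase.jac C C' m"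
  shows "fst (T u) \<bullet> snd (T v) - fst (T v) \<bullet> snd (T u) = fst u \<bullet> snd v - fst v \<bullet> snd u"
proof -
  obtain b \<xi> where m: "m = (b, \<xi>)" by (cases m)
  obtain c c' where c: "c \<in> charts_at B b" "c' \<in> charts_at B b"
    and C_eq: "C = cotangent_chart B c" "C' = cotangent_chart B c'" and \<xi>: "\<xi> \<in> cotangent_space B b"
    using C by (auto simp: m charts_at_cotangent_bundle)
  note cc = base.charts_atD[OF c(1)] base.charts_atD[OF c(2)]
  let ?S = "snd c ` (fst c \<inter> fst c')" and ?S' = "snd c' ` (fst c' \<inter> fst c)"
  have S: "open ?S" "open ?S'" "open (?S \<times> (UNIV :: (real^2) set))"
    using cc by (auto intro!: open_Times base.overlap_open)
  define x p where "x = snd c b" and "p = covector_components B c b \<xi>"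
  have x: "x \<in> ?S" "snd c' b \<in> ?S'" using cc by (auto simp: x_def)
  have tx: "transition c c' x = snd c' b" using cc by (simp add: x_def base.transition_apply)
  define \<tau> where "\<tau> = base.jac c c' b"
  define \<sigma> where "\<sigma> = base.jac c' c b"
  define D where "D w i = fderiv (\<lambda>y. fderiv (transition c' c) y i) (snd c' b) w" for w i
  have sm': "smooth_on ?S' (transition c' c)" using cc by (intro base.transition_smooth) auto
  have dt: "(transition c c' has_derivative \<tau>) (at x)"
    unfolding x_def \<tau>_def by (rule base.transition_has_derivative[OF c])
  have ds: "((\<lambda>y. fderiv (transition c' c) y i) has_derivative (\<lambda>w. D w i)) (at (transition c c' x))" for i
    unfolding D_def tx by (rule smooth_on_has_derivative[OF smooth_on_fderiv[OF sm'] S(2) x(2)])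
  have ds': "((\<lambda>z. fderiv (transition c' c) (transition c c' (fst z)) i) has_derivative
      (\<lambda>u. D (\<tau> (fst u)) i)) (at (x, p))" for i
  proof -
    have "((\<lambda>z. transition c c' (fst z)) has_derivative (\<lambda>u. \<tau> (fst u))) (at (x, p))"
      using diff_chain_at[OF has_derivative_fst[OF has_derivative_ident], of "transition c c'" \<tau> "(x,p)"] dt
      by (simp add: comp_def)
    from diff_chain_at[OF this, of "\<lambda>y. fderiv (transition c' c) y i" "\<lambda>w. D w i"] ds
    show ?thesis by (simp add: comp_def)
  qed
  have dt': "((\<lambda>z. transition c c' (fst z)) has_derivative (\<lambda>u. \<tau> (fst u))) (at (x, p))"
    using diff_chain_at[OF has_derivative_fst[OF has_derivative_ident], of "transition c c'" \<tau> "(x,p)"] dt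
    by (simp add: comp_def)
  have Tu: "T u = (\<tau> (fst u), \<Sum>i\<in>Basis. (p \<bullet> D (\<tau> (fst u)) i + snd u \<bullet> \<sigma> i) *\<^sub>R i)" for u
  proof -
    have "((\<lambda>z. (transition c c' (fst z),
        \<Sum>i\<in>Basis. (snd z \<bullet> fderiv (transition c' c) (transition c c' (fst z)) i) *\<^sub>R i)) has_derivative
      (\<lambda>u. (\<tau> (fst u), \<Sum>i\<in>Basis. (p \<bullet> D (\<tau> (fst u)) i + snd u \<bullet> \<sigma> i) *\<^sub>R i))) (at (x, p))"
      by (auto intro!: derivative_eq_intros dt' ds' simp: \<sigma>_def tx)
    then have "(transition C C' has_derivative
      (\<lambda>u. (\<tau> (fst u), \<Sum>i\<in>Basis. (p \<bullet> D (\<tau> (fst u)) i + snd u \<bullet> \<sigma> i) *\<^sub>R i))) (at (x, p))"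
      by (rule has_derivative_transform_within_open[OF _ S(3)])
        (use x transition_cotangent_chart[of c c'] cc in \<open>auto simp: C_eq\<close>)
    moreover have "snd C m = (x, p)" by (simp add: C_eq m snd_cotangent_chart x_def p_def)
    ultimately show ?thesis unfolding T_def by (simp add: fderiv_eq)
  qed
  have L\<sigma>: "linear \<sigma>" unfolding \<sigma>_def by (rule base.linear_jac[OF c(2,1)])
  have sym: "D a b' = D b' a" for a b'
    unfolding D_def by (rule fderiv_symmetric[OF sm' S(2) x(2)])
  \<comment> \<open>\<open>D\<close> is linear in the direction of the outer derivative; linearity
    in the other slot is inherited through \<open>sym\<close>.\<close>
  have LD: "linear (D a)" for a
  proof -
    have "linear (\<lambda>i. D i a)" using has_derivative_linear[OF ds] by blast
    moreover have "D a = (\<lambda>i. D i a)" by (rule ext) (rule sym)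
    ultimately show ?thesis by simp
  qed
  have \<sigma>\<tau>: "\<sigma> (\<tau> w) = w" for w
    unfolding \<sigma>_def \<tau>_def using base.jac_comp[OF c(1,2,1)] base.jac_self[OF c(1)] by simp
  have *: "w \<bullet> (\<Sum>i\<in>Basis. (p \<bullet> D a i + r \<bullet> \<sigma> i) *\<^sub>R i) = p \<bullet> D a w + r \<bullet> \<sigma> w" for w a r
    unfolding linear_basis_expand[OF LD, of a w] linear_basis_expand[OF L\<sigma>, of w]
    by (simp add: inner_sum_right sum.distrib algebra_simps)
  show ?thesis
    unfolding Tu fst_conv snd_conv * \<sigma>\<tau> sym[of "\<tau> (fst v)" "\<tau> (fst u)"]
    by (simp add: inner_commute)
qed

text \<open>Frees the canonical form from the chart that its definition happens to choose; later
  computations select a convenient chart through this equation.\<close>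

lemma canonical_form_chart:
  assumes C: "C \<in> charts_at (cotangent_bundle B) m"
    and X: "X \<in> tangent_space (cotangent_bundle B) m" and Y: "Y \<in> tangent_space (cotangent_bundle B) m"
  shows "canonical_form B m X Y = fst (X C) \<bullet> snd (Y C) - fst (Y C) \<bullet> snd (X C)"
proof -
  have D: "some_chart (cotangent_bundle B) m \<in> charts_at (cotangent_bundle B) m"
    by (rule phase.some_chart_in[OF phase.charts_at_imp_points[OF C]])
  show ?thesis
    using jac_cotangent_symplectic[OF C D, of "X C" "Y C"]
    by (simp add: canonical_form_def phase.tangent_change[OF X C D] phase.tangent_change[OF Y C D])
qed

end

section \<open>Two-forms on the model space\<close>

definition alternating_form :: "(phase_coords \<Rightarrow> phase_coords \<Rightarrow> real) \<Rightarrow> bool" where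
  "alternating_form a \<longleftrightarrow> (\<forall>u. linear (a u)) \<and> (\<forall>u v. a u v = - a v u)"

lemma alternating_formD:
  "alternating_form a \<Longrightarrow> linear (a u)" "alternating_form a \<Longrightarrow> a u v = - a v u"
  unfolding alternating_form_def by blast+

definition e1 :: phase_coords where "e1 = (axis 1 1, 0)"
definition e2 :: phase_coords where "e2 = (axis 2 1, 0)"
definition e3 :: phase_coords where "e3 = (0, axis 1 1)"
definition e4 :: phase_coords where "e4 = (0, axis 2 1)"

definition std_form :: "phase_coords \<Rightarrow> phase_coords \<Rightarrow> real" where
  "std_form u v = fst u \<bullet> snd v - fst v \<bullet> snd u"

text \<open>The classical Pfaffian of the coefficient matrix with the opposite sign: in the order
  \<open>e1\<close>, \<open>e2\<close>, \<open>e3\<close>, \<open>e4\<close> the classical Pfaffian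
  of \<open>std_form\<close> is \<open>-1\<close>, and its value has to be normalized to
  \<open>1\<close>.\<close>

definition pfaff :: "(phase_coords \<Rightarrow> phase_coords \<Rightarrow> real) \<Rightarrow> real" where
  "pfaff a = - (a e1 e2 * a e3 e4 - a e1 e3 * a e2 e4 + a e1 e4 * a e2 e3)"

text \<open>Lowering an index with \<open>std_form\<close>; the result is represented as a vector
  through the inner product, as for components of covectors. \<open>sharp\<close> is the
  inverse.\<close>

definition flat :: "phase_coords \<Rightarrow> phase_coords" where
  "flat z = (- snd z, fst z)"

definition sharp :: "phase_coords \<Rightarrow> phase_coords" where
  "sharp g = (snd g, - fst g)"

text \<open>The endomorphism that turns \<open>std_form\<close> into \<open>a\<close>, that is,
  \<open>std_form (endo_of a u) v = a u v\<close>. For the local expression of a normalized form it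
  is the map \<rho>.\<close>

definition endo_of :: "(phase_coords \<Rightarrow> phase_coords \<Rightarrow> real) \<Rightarrow> phase_coords \<Rightarrow> phase_coords" where
  "endo_of a u = sharp (\<Sum>i\<in>Basis. a u i *\<^sub>R i)"

lemma sharp_flat [simp]: "sharp (flat z) = z" "flat (sharp z) = z"
  by (simp_all add: sharp_def flat_def)

lemma linear_sharp: "linear sharp" and linear_flat: "linear flat"
  by (auto simp: linear_iff sharp_def flat_def)

lemma std_form_flat: "std_form z v = flat z \<bullet> v"
  by (simp add: std_form_def flat_def inner_prod_def inner_commute)

lemma std_form_add: "std_form (u + w) v = std_form u v + std_form w v"
  "std_form v (u + w) = std_form v u + std_form v w"
  by (simp_all add: std_form_def inner_add_left inner_add_right algebra_simps)

lemma std_form_scale: "std_form (r *\<^sub>R u) v = r * std_form u v"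
  "std_form v (r *\<^sub>R u) = r * std_form v u"
  by (simp_all add: std_form_def algebra_simps)

lemma std_form_swap: "std_form u v = - std_form v u"
  by (simp add: std_form_def)

lemma phase_expand:
  "u = (fst u $ 1) *\<^sub>R e1 + (fst u $ 2) *\<^sub>R e2 + (snd u $ 1) *\<^sub>R e3 + (snd u $ 2) *\<^sub>R e4"
  by (auto simp: prod_eq_iff e1_def e2_def e3_def e4_def vec_eq_iff forall_2 axis_def)

lemma phase_eqI:
  "fst u $ 1 = fst v $ 1 \<Longrightarrow> fst u $ 2 = fst v $ 2 \<Longrightarrow> snd u $ 1 = snd v $ 1 \<Longrightarrow>
    snd u $ 2 = snd v $ 2 \<Longrightarrow> u = (v :: phase_coords)"
  by (auto simp: prod_eq_iff vec_eq_iff forall_2)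

lemma alternating_form_linear:
  assumes "alternating_form a"
  shows "a u (v + w) = a u v + a u w" "a (v + w) u = a v u + a w u"
    "a u (r *\<^sub>R v) = r * a u v" "a (r *\<^sub>R v) u = r * a v u" "a u u = 0"
proof -
  have l: "linear (a u)" and s: "a x y = - a y x" for x y
    using assms by (rule alternating_formD)+
  show 1: "a u (v + w) = a u v + a u w" and 2: "a u (r *\<^sub>R v) = r * a u v"
    using linear_add[OF l] linear_scale[OF l] by auto
  show "a (v + w) u = a v u + a w u" "a (r *\<^sub>R v) u = r * a v u"
    using 1 2 s[of _ u] by auto
  show "a u u = 0" using s[of u u] by simp
qed

text \<open>Reduces the identities about forms to polynomial identities in six coefficients and the
  vector components, which \<open>algebra\<close> can decide.\<close>

lemma alternating_form_expand:
  assumes "alternating_form a"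
  shows "a u v =
    a e1 e2 * (fst u $ 1 * fst v $ 2 - fst u $ 2 * fst v $ 1) +
    a e1 e3 * (fst u $ 1 * snd v $ 1 - snd u $ 1 * fst v $ 1) +
    a e1 e4 * (fst u $ 1 * snd v $ 2 - snd u $ 2 * fst v $ 1) +
    a e2 e3 * (fst u $ 2 * snd v $ 1 - snd u $ 1 * fst v $ 2) +
    a e2 e4 * (fst u $ 2 * snd v $ 2 - snd u $ 2 * fst v $ 2) +
    a e3 e4 * (snd u $ 1 * snd v $ 2 - snd u $ 2 * snd v $ 1)"
proof -
  have s: "a e2 e1 = - a e1 e2" "a e3 e1 = - a e1 e3" "a e4 e1 = - a e1 e4"
    "a e3 e2 = - a e2 e3" "a e4 e2 = - a e2 e4" "a e4 e3 = - a e3 e4"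
    using assms by (rule alternating_formD)+
  show ?thesis
    by (subst phase_expand[of u], subst phase_expand[of v])
      (simp add: alternating_form_linear[OF assms] s algebra_simps)
qed

lemma e_components [simp]:
  "fst e1 $ 1 = 1" "fst e1 $ 2 = 0" "snd e1 $ i = 0"
  "fst e2 $ 1 = 0" "fst e2 $ 2 = 1" "snd e2 $ i = 0"
  "fst e3 $ i = 0" "snd e3 $ 1 = 1" "snd e3 $ 2 = 0"
  "fst e4 $ i = 0" "snd e4 $ 1 = 0" "snd e4 $ 2 = 1"
  by (auto simp: e1_def e2_def e3_def e4_def axis_def)

lemma std_form_components:
  "std_form u v = fst u $ 1 * snd v $ 1 + fst u $ 2 * snd v $ 2
    - fst v $ 1 * snd u $ 1 - fst v $ 2 * snd u $ 2"
  by (simp add: std_form_def inner_vec_def sum_2)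

lemma std_form_endo_of:
  assumes "alternating_form a"
  shows "std_form (endo_of a u) v = a u v"
proof -
  have l: "linear (a u)" using assms by (rule alternating_formD)
  show ?thesis
    unfolding std_form_flat endo_of_def sharp_flat linear_basis_expand[OF l, of v]
    by (simp add: inner_sum_right inner_commute[of _ v] mult.commute)
qed

lemma endo_of_components:
  assumes "alternating_form a"
  shows "fst (endo_of a u) $ 1 = a u e3" "fst (endo_of a u) $ 2 = a u e4"
    "snd (endo_of a u) $ 1 = - a u e1" "snd (endo_of a u) $ 2 = - a u e2"
  using std_form_endo_of[OF assms, of u e3] std_form_endo_of[OF assms, of u e4]
    std_form_endo_of[OF assms, of u e1] std_form_endo_of[OF assms, of u e2]
  by (simp_all add: std_form_components)

lemma linear_endo_of:
  assumes "alternating_form a"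
  shows "linear (endo_of a)"
  unfolding linear_iff
  by (intro conjI allI phase_eqI) (simp_all add: endo_of_components[OF assms] alternating_form_linear[OF assms])

lemma endo_of_self_adjoint:
  assumes "alternating_form a"
  shows "std_form (endo_of a u) v = std_form u (endo_of a v)"
  using std_form_swap[of u] alternating_formD(2)[OF assms, of u v] by (simp add: std_form_endo_of[OF assms])

text \<open>This is the Cayley-Hamilton identity for the quadratic polynomial in \<open>t\<close>
  given by the Pfaffian of \<open>a - t * std_form\<close>. Its linear coefficient is
  \<open>- (a e1 e3 + a e2 e4)\<close>, which effectiveness makes vanish. The verification is
  componentwise.\<close>

lemma endo_of_square:
  assumes a: "alternating_form a" and e: "a e1 e3 + a e2 e4 = 0"
  shows "endo_of a (endo_of a u) = - pfaff a *\<^sub>R u"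
proof -
  have e': "a e2 e4 = - a e1 e3" using e by simp
  have s: "a e2 e1 = - a e1 e2" "a e3 e1 = - a e1 e3" "a e4 e1 = - a e1 e4"
    "a e3 e2 = - a e2 e3" "a e4 e2 = - a e2 e4" "a e4 e3 = - a e3 e4"
    using a by (rule alternating_formD)+
  note x = alternating_form_expand[OF a, of "endo_of a u"] alternating_form_expand[OF a, of u]
  show ?thesis
    by (rule phase_eqI; unfold endo_of_components[OF a]; unfold x; unfold endo_of_components[OF a];
        unfold x; simp add: e' pfaff_def; algebra)
qed

text \<open>With \<open>s\<close> nonzero, \<open>a\<close> would be a multiple of
  \<open>std_form\<close>. Effectiveness then forces the multiple to be zero, against the nonzero
  Pfaffian. Thus the identity and \<open>endo_of a\<close> are linearly independent, which is the
  form in which the fact is used.\<close>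

lemma endo_of_not_scalar:
  assumes a: "alternating_form a" and e: "a e1 e3 + a e2 e4 = 0" and p: "pfaff a \<noteq> 0"
    and s: "\<And>u. r *\<^sub>R u + s *\<^sub>R endo_of a u = 0"
  shows "r = 0 \<and> s = 0"
proof -
  have *: "r * std_form u v + s * a u v = 0" for u v
    using arg_cong[OF s, of "\<lambda>w. std_form w v" u]
    by (simp add: std_form_add std_form_scale std_form_endo_of[OF a]) (simp add: std_form_def)
  have "s = 0"
  proof (rule ccontr)
    assume "s \<noteq> 0"
    then have "a e1 e2 = 0" "a e1 e4 = 0" "a e2 e3 = 0" "a e3 e4 = 0" "r + s * a e1 e3 = 0" "r + s * a e2 e4 = 0"
      using *[of e1 e2] *[of e1 e4] *[of e2 e3] *[of e3 e4] *[of e1 e3] *[of e2 e4]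
      by (auto simp: std_form_components)
    moreover have "a e1 e3 = 0"
    proof -
      have "s * (a e1 e3 - a e2 e4) = 0" using calculation(5,6) unfolding right_diff_distrib by linarith
      then show ?thesis using e \<open>s \<noteq> 0\<close> by simp
    qed
    ultimately show False using p by (simp add: pfaff_def)
  qed
  then show ?thesis using *[of e1 e3] by (simp add: std_form_components)
qed

definition wedge_form ::
    "(phase_coords \<Rightarrow> phase_coords \<Rightarrow> real) \<Rightarrow> (phase_coords \<Rightarrow> phase_coords \<Rightarrow> real) \<Rightarrow>
     phase_coords \<Rightarrow> phase_coords \<Rightarrow> phase_coords \<Rightarrow> phase_coords \<Rightarrow> real" where
  "wedge_form a b u1 u2 u3 u4 =
     a u1 u2 * b u3 u4 - a u1 u3 * b u2 u4 + a u1 u4 * b u2 u3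
   + a u2 u3 * b u1 u4 - a u2 u4 * b u1 u3 + a u3 u4 * b u1 u2"

text \<open>Four-forms on a four-dimensional space are proportional to each other; the factor is
  read off at the basis.\<close>

lemma wedge_pfaff:
  assumes "alternating_form a"
  shows "wedge_form a a u1 u2 u3 u4 = pfaff a * wedge_form std_form std_form u1 u2 u3 u4"
  unfolding wedge_form_def pfaff_def std_form_components
    alternating_form_expand[OF assms, of u1] alternating_form_expand[OF assms, of u2]
    alternating_form_expand[OF assms, of u3]
  by algebra

lemma wedge_std_basis: "wedge_form std_form std_form e1 e2 e3 e4 = -2"
  by (simp add: wedge_form_def std_form_components)

lemma wedge_std_basis': "wedge_form std_form a e1 e2 e3 e4 = - (a e1 e3 + a e2 e4)"
  by (simp add: wedge_form_def std_form_components)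

text \<open>A hyperplane section of the Lagrangian Grassmannian is either a cone or a regular quadric
  surface with real points; the latter case is that of a nonzero Pfaffian, and then the section
  spans the hyperplane.\<close>

lemma lagrangian_section_spans:
  fixes A B C D E :: real
  assumes nz: "A * E + C\<^sup>2 - B * D \<noteq> 0"
    and imp: "\<And>x y z. A + B * x + 2 * C * y + D * z + E * (x * z - y\<^sup>2) = 0 \<Longrightarrow>
      A' + B' * x + 2 * C' * y + D' * z + E' * (x * z - y\<^sup>2) = 0"
  shows "\<exists>h. A' = h * A \<and> B' = h * B \<and> C' = h * C \<and> D' = h * D \<and> E' = h * E"
proof (cases "E = 0")
  case False
  \<comment> \<open>The shift \<open>X = x + D / E\<close>, \<open>Y = y - C / E\<close>,
    \<open>Z = z + B / E\<close> centres the quadric, whose equation becomes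
    \<open>X * Z - Y\<^sup>2 + K = 0\<close>. \<open>A2\<close>, \<open>B2\<close>,
    \<open>C2\<close>, \<open>D2\<close> are the coefficients of the primed polynomial after the
    same shift.\<close>
  define K where "K = (A * E + C\<^sup>2 - B * D) / E\<^sup>2"
  have K: "K \<noteq> 0" using nz False by (simp add: K_def)
  define A2 where "A2 = A' - B' * D / E + 2 * C' * C / E - D' * B / E + E' * (D * B / E\<^sup>2 - C\<^sup>2 / E\<^sup>2)"
  define B2 C2 D2 where "B2 = B' - E' * B / E" and "C2 = C' - E' * C / E" and "D2 = D' - E' * D / E"
  have G: "A2 + B2 * X + 2 * C2 * Y + D2 * Z - E' * K = 0" if "X * Z - Y\<^sup>2 + K = 0" for X Y Z
  proof -
    have "A + B * (X - D / E) + 2 * C * (Y + C / E) + D * (Z - B / E)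
        + E * ((X - D / E) * (Z - B / E) - (Y + C / E)\<^sup>2) = E * (X * Z - Y\<^sup>2 + K)"
      using False by (simp add: K_def field_simps power2_eq_square)
    also have "\<dots> = 0" by (simp add: that)
    finally have "A' + B' * (X - D / E) + 2 * C' * (Y + C / E) + D' * (Z - B / E)
        + E' * ((X - D / E) * (Z - B / E) - (Y + C / E)\<^sup>2) = 0" by (rule imp)
    moreover have "A' + B' * (X - D / E) + 2 * C' * (Y + C / E) + D' * (Z - B / E)
        + E' * ((X - D / E) * (Z - B / E) - (Y + C / E)\<^sup>2) =
        A2 + B2 * X + 2 * C2 * Y + D2 * Z + E' * (X * Z - Y\<^sup>2)"
      using False by (simp add: A2_def B2_def C2_def D2_def field_simps power2_eq_square)
    moreover have "X * Z - Y\<^sup>2 = - K" using that by simp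
    ultimately show ?thesis by simp
  qed
  \<comment> \<open>Four points of the centred quadric. The positional arguments come in the order
    \<open>X\<close>, \<open>Z\<close>, \<open>Y\<close>, in which the premise of \<open>G\<close>
    mentions them. The first three separate \<open>B2\<close> from \<open>D2\<close> because
    \<open>K\<close> is nonzero; the last one isolates \<open>C2\<close>.\<close>
  have g1: "A2 + B2 - D2 * K - E' * K = 0" using G[of 1 "- K" 0] by simp
  have g2: "A2 - B2 + D2 * K - E' * K = 0" using G[of "-1" "K" 0] by simp
  have g3: "A2 + 2 * B2 - D2 * (K / 2) - E' * K = 0" using G[of 2 "- K / 2" 0] by simp
  have g4: "A2 + B2 + 2 * C2 + D2 * (1 - K) - E' * K = 0" using G[of 1 "1 - K" 1] by simp
  have B2: "B2 = 0" and D2: "D2 = 0"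
  proof -
    have "B2 = D2 * K" using g1 g2 by linarith
    moreover have "4 * B2 = D2 * K" using g1 g2 g3 by linarith
    ultimately show "B2 = 0" "D2 = 0" using K by auto
  qed
  then have A2: "A2 = E' * K" using g1 by simp
  then have C2: "C2 = 0" using g4 B2 D2 by simp
  define h where "h = E' / E"
  have E': "E' = h * E" using False by (simp add: h_def)
  have B': "B' = h * B" and C': "C' = h * C" and D': "D' = h * D"
    using B2 C2 D2 False by (simp_all add: B2_def C2_def D2_def E')
  have "A' = h * A"
    using A2 False unfolding A2_def B' C' D' E' K_def by (simp add: field_simps power2_eq_square)
  with B' C' D' E' show ?thesis by blast
next
  case E: True
  have imp0: "A' + B' * x + 2 * C' * y + D' * z + E' * (x * z - y\<^sup>2) = 0"
    if "A + B * x + 2 * C * y + D * z = 0" for x y z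
    using imp[of x y z] that E by simp
  \<comment> \<open>The first polynomial is now affine. A variable with nonzero coefficient is
    eliminated, after which the primed polynomial vanishes identically in the two others and is
    tested at small arguments. The factor \<open>h\<close> is the quotient of the coefficients of
    the eliminated variable; the cases of \<open>B\<close> and \<open>D\<close> mirror each other
    under the exchange of \<open>x\<close> and \<open>z\<close>.\<close>
  have "C \<noteq> 0" if "B = 0" using nz E that by auto
  then consider "B \<noteq> 0" | "D \<noteq> 0" | "B = 0" "D = 0" "C \<noteq> 0" by blast
  then show ?thesis
  proof cases
    case 1
    define h where "h = B' / B"
    have B': "B' = h * B" using 1 by (simp add: h_def)
    have G: "(A' - h * A) + 2 * (C' - h * C) * y + (D' - h * D) * z
        + E' * (- (A + 2 * C * y + D * z) * z / B - y\<^sup>2) = 0" for y z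
    proof -
      have "A' + B' * (- (A + 2 * C * y + D * z) / B) + 2 * C' * y + D' * z
          + E' * ((- (A + 2 * C * y + D * z) / B) * z - y\<^sup>2) = 0"
        using 1 by (intro imp0) (simp add: field_simps)
      moreover have "B' * (- (A + 2 * C * y + D * z) / B) = - h * (A + 2 * C * y + D * z)"
        using 1 by (simp add: B' field_simps)
      ultimately show ?thesis by (simp add: algebra_simps)
    qed
    have a: "A' - h * A = 0" using G[of 0 0] by simp
    have e: "E' = 0" and c: "C' - h * C = 0" using G[of 1 0] G[of "-1" 0] a by auto
    have d: "D' - h * D = 0" using G[of 0 1] a e by simp
    show ?thesis using a e c d B' E by (intro exI[of _ h]) simp
  next
    case 2
    define h where "h = D' / D"
    have D': "D' = h * D" using 2 by (simp add: h_def)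
    have G: "(A' - h * A) + 2 * (C' - h * C) * y + (B' - h * B) * x
        + E' * (- (A + 2 * C * y + B * x) * x / D - y\<^sup>2) = 0" for y x
    proof -
      have "A' + B' * x + 2 * C' * y + D' * (- (A + 2 * C * y + B * x) / D)
          + E' * (x * (- (A + 2 * C * y + B * x) / D) - y\<^sup>2) = 0"
        using 2 by (intro imp0) (simp add: field_simps)
      moreover have "D' * (- (A + 2 * C * y + B * x) / D) = - h * (A + 2 * C * y + B * x)"
        using 2 by (simp add: D' field_simps)
      ultimately show ?thesis by (simp add: algebra_simps)
    qed
    have a: "A' - h * A = 0" using G[of 0 0] by simp
    have e: "E' = 0" and c: "C' - h * C = 0" using G[of 1 0] G[of "-1" 0] a by auto
    have d: "B' - h * B = 0" using G[of 0 1] a e by simp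
    show ?thesis using a e c d D' E by (intro exI[of _ h]) simp
  next
    case 3
    define h where "h = C' / C"
    have C': "C' = h * C" using 3 by (simp add: h_def)
    define y where "y = - A / (2 * C)"
    have y: "2 * C * y = - A" using 3 by (simp add: y_def)
    have G: "(A' - h * A) + B' * x + D' * z + E' * (x * z - y\<^sup>2) = 0" for x z
    proof -
      have "2 * C' * y = - h * A" unfolding C' using y by (metis mult.assoc mult.left_commute mult_minus_left mult_minus_right)
      then show ?thesis using imp0[of x y z] y 3 by simp
    qed
    have b: "B' = 0" using G[of 1 0] G[of 0 0] by simp
    moreover have "D' = 0" using G[of 0 1] G[of 0 0] by simp
    moreover have "E' = 0" using G[of 1 1] G[of 0 0] b \<open>D' = 0\<close> by (simp add: algebra_simps)
    ultimately show ?thesis using G[of 0 0] C' E 3 by (intro exI[of _ h]) simp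
  qed
qed

lemma effective_form_proportional:
  assumes a: "alternating_form a" "a e1 e3 + a e2 e4 = 0" "pfaff a \<noteq> 0"
    and b: "alternating_form b" "b e1 e3 + b e2 e4 = 0"
    and imp: "\<And>x y z. a (e1 + x *\<^sub>R e3 + y *\<^sub>R e4) (e2 + y *\<^sub>R e3 + z *\<^sub>R e4) = 0 \<Longrightarrow>
      b (e1 + x *\<^sub>R e3 + y *\<^sub>R e4) (e2 + y *\<^sub>R e3 + z *\<^sub>R e4) = 0"
  shows "\<exists>h. \<forall>u v. b u v = h * a u v"
proof -
  \<comment> \<open>The two vectors span the graph of the symmetric matrix with entries
    \<open>x\<close>, \<open>y\<close>, \<open>z\<close>. The two occurrences of \<open>y\<close>
    contribute \<open>c e1 e3 - c e2 e4\<close>, which is \<open>2 * c e1 e3\<close> for an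
    effective form.\<close>
  have val: "c (e1 + x *\<^sub>R e3 + y *\<^sub>R e4) (e2 + y *\<^sub>R e3 + z *\<^sub>R e4) =
      c e1 e2 + (- c e2 e3) * x + 2 * c e1 e3 * y + c e1 e4 * z + c e3 e4 * (x * z - y\<^sup>2)"
    if "alternating_form c" "c e1 e3 + c e2 e4 = 0" for c x y z
  proof -
    have e: "c e2 e4 = - c e1 e3" using that by simp
    show ?thesis
      unfolding alternating_form_expand[OF that(1), of "e1 + x *\<^sub>R e3 + y *\<^sub>R e4"]
      by (simp add: e power2_eq_square algebra_simps)
  qed
  have "\<exists>h. b e1 e2 = h * a e1 e2 \<and> - b e2 e3 = h * (- a e2 e3) \<and> b e1 e3 = h * a e1 e3 \<and>
      b e1 e4 = h * a e1 e4 \<and> b e3 e4 = h * a e3 e4"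
  proof (rule lagrangian_section_spans)
    have "a e2 e4 = - a e1 e3" using a(2) by simp
    then show "a e1 e2 * a e3 e4 + (a e1 e3)\<^sup>2 - (- a e2 e3) * a e1 e4 \<noteq> 0"
      using a(3) by (simp add: pfaff_def power2_eq_square mult.commute)
  qed (use imp in \<open>simp add: val[OF a(1,2)] val[OF b]\<close>)
  then obtain h where h: "b e1 e2 = h * a e1 e2" "b e2 e3 = h * a e2 e3" "b e1 e3 = h * a e1 e3"
      "b e1 e4 = h * a e1 e4" "b e3 e4 = h * a e3 e4" by auto
  have "b e2 e4 = - b e1 e3" "a e2 e4 = - a e1 e3" using a(2) b(2) by auto
  then have h': "b e2 e4 = h * a e2 e4" using h(3) by simp
  have "b u v = h * a u v" for u v
    unfolding alternating_form_expand[OF a(1), of u v] alternating_form_expand[OF b(1), of u v] h h'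
    by (simp add: algebra_simps)
  then show ?thesis by blast
qed

section \<open>The quadric family in a chart\<close>

text \<open>Pointwise versions of the algebraic conditions: multiplication by a function, as in
  \<open>normalization\<close>, is multiplication by a number at each point. Smoothness is tracked
  separately.\<close>

definition (in smooth_surface) two_form_at where
  "two_form_at \<sigma> m \<longleftrightarrow> (\<forall>X\<in>tangent_space (cotangent_bundle B) m.
     lower (cotangent_bundle B) \<sigma> m X \<in> cotangent_space (cotangent_bundle B) m \<and>
     (\<forall>Y\<in>tangent_space (cotangent_bundle B) m. \<sigma> m Y X = - \<sigma> m X Y))"

definition (in smooth_surface) effective_at where
  "effective_at \<sigma> m \<longleftrightarrow> two_form_at \<sigma> m \<and>
     (\<forall>X\<^sub>1\<in>tangent_space (cotangent_bundle B) m. \<forall>X\<^sub>2\<in>tangent_space (cotangent_bundle B) m.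
      \<forall>X\<^sub>3\<in>tangent_space (cotangent_bundle B) m. \<forall>X\<^sub>4\<in>tangent_space (cotangent_bundle B) m.
        wedge (canonical_form B) \<sigma> m X\<^sub>1 X\<^sub>2 X\<^sub>3 X\<^sub>4 = 0)"

definition (in smooth_surface) local_form where
  "local_form C \<sigma> m u v =
     \<sigma> m (coord_vector (cotangent_bundle B) C m u) (coord_vector (cotangent_bundle B) C m v)"

text \<open>A point of the model space squared gives a vector of the big tangent space, where covectors
  are represented through the canonical form. In these terms all blocks of the endomorphisms are
  combinations of the identity and of \<open>\<rho>\<close>, which commute.\<close>

definition (in smooth_surface) big_vector where
  "big_vector C m w = (coord_vector (cotangent_bundle B) C m (fst w),
     lower (cotangent_bundle B) (canonical_form B) m (coord_vector (cotangent_bundle B) C m (snd w)))"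

text \<open>The block matrix after covectors have been replaced by vectors. \<open>R\<close> stands
  for \<rho>. Raising with \<beta> becomes the inverse of \<open>R\<close>, which is
  \<open>- P * R\<close> since \<open>R\<close> squares to \<open>- P\<close> and \<open>P\<close>
  is a sign. The dual of \<open>R\<close> becomes \<open>R\<close> again because \<open>R\<close> is
  self-adjoint for \<open>std_form\<close>.\<close>

definition model_endo ::
    "('v \<Rightarrow> 'v) \<Rightarrow> real \<Rightarrow> real \<Rightarrow> real \<Rightarrow> real \<times> real \<times> real \<Rightarrow>
     'v \<times> 'v \<Rightarrow> 'v::real_vector \<times> 'v" where
  "model_endo R P \<epsilon>\<^sub>2 \<epsilon>\<^sub>3 a w = (case a of (a\<^sub>1, a\<^sub>2, a\<^sub>3) \<Rightarrow>
     (a\<^sub>1 *\<^sub>R R (fst w) - (a\<^sub>2 * P) *\<^sub>R R (snd w) + a\<^sub>3 *\<^sub>R snd w,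
      (a\<^sub>2 * \<epsilon>\<^sub>2) *\<^sub>R R (fst w) + (a\<^sub>3 * \<epsilon>\<^sub>3) *\<^sub>R fst w - a\<^sub>1 *\<^sub>R R (snd w)))"

lemma linear_model_endo:
  fixes R :: "'v::real_vector \<Rightarrow> 'v"
  assumes "linear R"
  shows "linear (model_endo R P \<epsilon>\<^sub>2 \<epsilon>\<^sub>3 a)"
proof -
  have "R (u + v) = R u + R v" "R (r *\<^sub>R u) = r *\<^sub>R R u" for u v r
    using assms by (auto simp: linear_add linear_scale)
  then show ?thesis
    by (cases a) (auto simp: linear_iff model_endo_def algebra_simps simp del: split_paired_All)
qed

text \<open>The blocks are polynomials in \<open>R\<close>, so this is a trace-free two by two
  matrix over a commutative ring. Its square is minus its determinant: the off-diagonal blocks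
  cancel, and both diagonal blocks agree.\<close>

lemma model_endo_square:
  fixes R :: "'v::real_vector \<Rightarrow> 'v"
  assumes R: "linear R" "\<And>u. R (R u) = - P *\<^sub>R u" and P: "P\<^sup>2 = 1"
  shows "model_endo R P \<epsilon>\<^sub>2 \<epsilon>\<^sub>3 (a\<^sub>1, a\<^sub>2, a\<^sub>3) (model_endo R P \<epsilon>\<^sub>2 \<epsilon>\<^sub>3 (a\<^sub>1, a\<^sub>2, a\<^sub>3) w) =
    (- P * a\<^sub>1\<^sup>2 + \<epsilon>\<^sub>2 * a\<^sub>2\<^sup>2 + \<epsilon>\<^sub>3 * a\<^sub>3\<^sup>2) *\<^sub>R w +
    (a\<^sub>2 * a\<^sub>3 * (\<epsilon>\<^sub>2 - P * \<epsilon>\<^sub>3)) *\<^sub>R (R (fst w), R (snd w))"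
proof -
  have l: "R (u + v) = R u + R v" "R (u - v) = R u - R v" "R (r *\<^sub>R u) = r *\<^sub>R R u" for u v r
    using R(1) by (auto simp: linear_add linear_scale linear_diff)
  have PP: "P * P = 1" "P * (P * x) = x" for x using P by (auto simp: power2_eq_square mult.assoc[symmetric])
  show ?thesis
    by (cases w) (simp add: model_endo_def l R(2) PP power2_eq_square scaleR_diff_right scaleR_add_right
        scaleR_add_left scaleR_diff_left mult.assoc mult.left_commute mult.commute right_diff_distrib)
qed

definition model_pairing :: "phase_coords \<times> phase_coords \<Rightarrow> phase_coords \<times> phase_coords \<Rightarrow> real" where
  "model_pairing w w' = (1/2) * (std_form (snd w) (fst w') + std_form (snd w') (fst w))"

lemma model_pairing_linear:
  "model_pairing w (r *\<^sub>R w') = r * model_pairing w w'"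
  by (simp add: model_pairing_def std_form_scale algebra_simps)

lemma std_form_diff: "std_form (u - w) v = std_form u v - std_form w v"
  "std_form v (u - w) = std_form v u - std_form v w"
  by (simp_all add: std_form_def inner_diff_left inner_diff_right algebra_simps)

text \<open>Holds for all parameters, on or off the quadrics. If the square is multiplication by
  \<open>k\<close>, skewness turns it into the factor \<open>- k\<close> for the pairing, so the
  second sign of the structure is always opposite to the first.\<close>

lemma model_endo_skew:
  assumes R: "\<And>u v. std_form (R u) v = std_form u (R v)"
  shows "model_pairing (model_endo R P \<epsilon>\<^sub>2 \<epsilon>\<^sub>3 a w) w' = - model_pairing w (model_endo R P \<epsilon>\<^sub>2 \<epsilon>\<^sub>3 a w')"
proof -
  obtain x y x' y' where w: "w = (x, y)" "w' = (x', y')" by (cases w, cases w')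
  have s: "std_form y' x = - std_form x y'" "std_form y' (R x) = - std_form x (R y')"
     "std_form y' y = - std_form y y'" "std_form y' (R y) = - std_form y (R y')"
     "std_form x' x = - std_form x x'" "std_form x' (R x) = - std_form x (R x')"
    using std_form_swap R by metis+
  show ?thesis
    by (cases a) (simp add: w model_endo_def model_pairing_def std_form_add std_form_diff std_form_scale R s algebra_simps)
qed

section \<open>Two-forms on the cotangent bundle in an induced chart\<close>

context smooth_surface
begin

abbreviation "TM \<equiv> tangent_space (cotangent_bundle B)"
abbreviation "CM \<equiv> cotangent_space (cotangent_bundle B)"
abbreviation "cv \<equiv> coord_vector (cotangent_bundle B)"
abbreviation "lowM \<equiv> lower (cotangent_bundle B)"
abbreviation "raiM \<equiv> raise (cotangent_bundle B)"
abbreviation "\<Omega> \<equiv> canonical_form B"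
abbreviation "atM \<equiv> charts_at (cotangent_bundle B)"

lemma two_form_apply:
  assumes "X \<in> TM m" "Y \<in> TM m" "C \<in> atM m"
  shows "\<sigma> m X Y = local_form C \<sigma> m (X C) (Y C)"
  by (simp add: local_form_def phase.coord_vector_eq[OF _ assms(3)] assms)

lemma local_form_alternating:
  assumes "two_form_at \<sigma> m" "C \<in> atM m"
  shows "alternating_form (local_form C \<sigma> m)"
  unfolding alternating_form_def
proof (intro conjI allI)
  fix u v
  note cv = phase.coord_vector_in[OF assms(2)]
  have "lowM \<sigma> m (cv C m u) \<in> CM m" using assms(1) cv unfolding two_form_at_def by blast
  from phase.linear_covector_coord_vector[OF this assms(2)]
  show "linear (local_form C \<sigma> m u)" by (simp add: lower_def cv local_form_def[abs_def])
  show "local_form C \<sigma> m u v = - local_form C \<sigma> m v u"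
    using assms(1) cv unfolding two_form_at_def local_form_def by blast
qed

lemma local_form_canonical:
  assumes "C \<in> atM m"
  shows "local_form C \<Omega> m = std_form"
  by (intro ext) (simp add: local_form_def canonical_form_chart[OF assms] phase.coord_vector_in[OF assms]
      phase.coord_vector_self[OF assms] std_form_def)

lemma wedge_local_form:
  assumes "C \<in> atM m" "X\<^sub>1 \<in> TM m" "X\<^sub>2 \<in> TM m" "X\<^sub>3 \<in> TM m" "X\<^sub>4 \<in> TM m"
  shows "wedge \<sigma> \<tau> m X\<^sub>1 X\<^sub>2 X\<^sub>3 X\<^sub>4 =
    wedge_form (local_form C \<sigma> m) (local_form C \<tau> m) (X\<^sub>1 C) (X\<^sub>2 C) (X\<^sub>3 C) (X\<^sub>4 C)"
  unfolding wedge_def wedge_form_def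
  using assms by (simp add: two_form_apply[of _ m _ C \<sigma>] two_form_apply[of _ m _ C \<tau>])

text \<open>Uniqueness of the number in the definite description is seen on the coordinate basis,
  where the square of the canonical form takes the nonzero value of
  \<open>wedge_std_basis\<close>.\<close>

lemma Pf_eq_pfaff:
  assumes "two_form_at \<sigma> m" "C \<in> atM m"
  shows "Pf B \<sigma> m = pfaff (local_form C \<sigma> m)"
  unfolding Pf_def
proof (rule the_equality, intro ballI)
  fix X\<^sub>1 X\<^sub>2 X\<^sub>3 X\<^sub>4
  assume "X\<^sub>1 \<in> TM m" "X\<^sub>2 \<in> TM m" "X\<^sub>3 \<in> TM m" "X\<^sub>4 \<in> TM m"
  then show "wedge \<sigma> \<sigma> m X\<^sub>1 X\<^sub>2 X\<^sub>3 X\<^sub>4 = pfaff (local_form C \<sigma> m) * wedge \<Omega> \<Omega> m X\<^sub>1 X\<^sub>2 X\<^sub>3 X\<^sub>4"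
    by (simp add: wedge_local_form[OF assms(2)] local_form_canonical[OF assms(2)]
        wedge_pfaff[OF local_form_alternating[OF assms]])
next
  fix r
  assume r: "\<forall>X\<^sub>1\<in>TM m. \<forall>X\<^sub>2\<in>TM m. \<forall>X\<^sub>3\<in>TM m. \<forall>X\<^sub>4\<in>TM m.
    wedge \<sigma> \<sigma> m X\<^sub>1 X\<^sub>2 X\<^sub>3 X\<^sub>4 = r * wedge \<Omega> \<Omega> m X\<^sub>1 X\<^sub>2 X\<^sub>3 X\<^sub>4"
  note cv = phase.coord_vector_in[OF assms(2)]
  have "wedge \<sigma> \<sigma> m (cv C m e1) (cv C m e2) (cv C m e3) (cv C m e4) =
      r * wedge \<Omega> \<Omega> m (cv C m e1) (cv C m e2) (cv C m e3) (cv C m e4)"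
    using r cv by blast
  then show "r = pfaff (local_form C \<sigma> m)"
    by (simp add: wedge_local_form[OF assms(2)] cv local_form_canonical[OF assms(2)]
        phase.coord_vector_self[OF assms(2)] wedge_pfaff[OF local_form_alternating[OF assms]] wedge_std_basis)
qed

lemma effective_local_form:
  assumes "effective_at \<sigma> m" "C \<in> atM m"
  shows "local_form C \<sigma> m e1 e3 + local_form C \<sigma> m e2 e4 = 0"
proof -
  note cv = phase.coord_vector_in[OF assms(2)]
  have "wedge \<Omega> \<sigma> m (cv C m e1) (cv C m e2) (cv C m e3) (cv C m e4) = 0"
    using assms(1) cv unfolding effective_at_def by blast
  then show ?thesis
    by (simp add: wedge_local_form[OF assms(2)] cv local_form_canonical[OF assms(2)]
        phase.coord_vector_self[OF assms(2)] wedge_std_basis')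
qed

lemma effective_at_two_form: "effective_at \<sigma> m \<Longrightarrow> two_form_at \<sigma> m"
  by (simp add: effective_at_def)

lemma local_form_scale:
  assumes "C \<in> atM m" "\<And>X Y. X \<in> TM m \<Longrightarrow> Y \<in> TM m \<Longrightarrow> \<tau> m X Y = r * \<sigma> m X Y"
  shows "local_form C \<tau> m u v = r * local_form C \<sigma> m u v"
  using assms phase.coord_vector_in[OF assms(1)] by (simp add: local_form_def)

lemma effective_at_scale:
  assumes m: "m \<in> points (cotangent_bundle B)" and \<sigma>: "effective_at \<sigma> m"
    and \<tau>: "\<And>X Y. X \<in> TM m \<Longrightarrow> Y \<in> TM m \<Longrightarrow> \<tau> m X Y = r * \<sigma> m X Y"
  shows "effective_at \<tau> m"
proof -
  have "lowM \<tau> m X = smul r (lowM \<sigma> m X)" if "X \<in> TM m" for X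
    using \<tau>[OF that] by (auto simp: lower_def smul_def)
  moreover have "\<tau> m Y X = - \<tau> m X Y" if "X \<in> TM m" "Y \<in> TM m" for X Y
  proof -
    have "\<sigma> m Y X = - \<sigma> m X Y"
      using \<sigma> that unfolding effective_at_def two_form_at_def by blast
    then show ?thesis using \<tau> that by simp
  qed
  moreover have "smul r (lowM \<sigma> m X) \<in> CM m" if "X \<in> TM m" for X
    using \<sigma> that phase.cotangent_smul[OF m] unfolding effective_at_def two_form_at_def by blast
  ultimately have "two_form_at \<tau> m"
    unfolding two_form_at_def by metis
  moreover have "wedge \<Omega> \<tau> m X\<^sub>1 X\<^sub>2 X\<^sub>3 X\<^sub>4 = r * wedge \<Omega> \<sigma> m X\<^sub>1 X\<^sub>2 X\<^sub>3 X\<^sub>4"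
    if "X\<^sub>1 \<in> TM m" "X\<^sub>2 \<in> TM m" "X\<^sub>3 \<in> TM m" "X\<^sub>4 \<in> TM m" for X\<^sub>1 X\<^sub>2 X\<^sub>3 X\<^sub>4
    using that by (simp add: wedge_def \<tau> algebra_simps)
  ultimately show ?thesis using \<sigma> by (simp add: effective_at_def)
qed

lemma Pf_scale:
  assumes m: "m \<in> points (cotangent_bundle B)" and \<sigma>: "effective_at \<sigma> m"
    and \<tau>: "\<And>X Y. X \<in> TM m \<Longrightarrow> Y \<in> TM m \<Longrightarrow> \<tau> m X Y = r * \<sigma> m X Y"
  shows "Pf B \<tau> m = r\<^sup>2 * Pf B \<sigma> m"
proof -
  note C = phase.some_chart_in[OF m]
  have "effective_at \<tau> m" by (rule effective_at_scale[where \<tau> = \<tau> and r = r, OF m \<sigma> \<tau>])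
  then show ?thesis
    using \<sigma> by (simp add: effective_at_def Pf_eq_pfaff[OF _ C] pfaff_def local_form_scale[where \<sigma> = \<sigma> and \<tau> = \<tau> and r = r, OF C \<tau>]
        power2_eq_square algebra_simps)
qed

lemma lower_canonical:
  assumes "C \<in> atM m"
  shows "lowM \<Omega> m (cv C m u) = coord_covector (cotangent_bundle B) C m (flat u)"
  by (auto simp: lower_def coord_covector_def fun_eq_iff canonical_form_chart[OF assms]
      phase.coord_vector_in[OF assms] phase.coord_vector_self[OF assms]
      std_form_flat[symmetric] std_form_def)

lemma lower_canonical_in: "C \<in> atM m \<Longrightarrow> lowM \<Omega> m (cv C m u) \<in> CM m"
  by (simp add: lower_canonical phase.coord_covector_in)

lemma covector_components_lower:
  assumes "C \<in> atM m"
  shows "covector_components (cotangent_bundle B) C m (lowM \<Omega> m (cv C m u)) = flat u"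
  by (simp add: lower_canonical[OF assms] phase.covector_components_coord_covector[OF assms])

lemma covector_as_lower:
  assumes "\<xi> \<in> CM m" "C \<in> atM m"
  shows "lowM \<Omega> m (cv C m (sharp (covector_components (cotangent_bundle B) C m \<xi>))) = \<xi>"
  by (simp add: lower_canonical[OF assms(2)] phase.coord_covector_components[OF assms])

text \<open>Lowering with \<sigma> factors through lowering with the canonical form. This identifies
  \<open>endo_of\<close> with the composition that defines \<rho> and reduces every lowering to the
  canonical one.\<close>

lemma lower_endo_of:
  assumes "two_form_at \<sigma> m" "C \<in> atM m"
  shows "lowM \<sigma> m (cv C m u) = lowM \<Omega> m (cv C m (endo_of (local_form C \<sigma> m) u))"
proof
  fix Y show "lowM \<sigma> m (cv C m u) Y = lowM \<Omega> m (cv C m (endo_of (local_form C \<sigma> m) u)) Y"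
    by (simp add: lower_def two_form_apply[where \<sigma> = \<sigma>, OF _ _ assms(2)]
        two_form_apply[where \<sigma> = \<Omega>, OF _ _ assms(2)] phase.coord_vector_in[OF assms(2)]
        phase.coord_vector_self[OF assms(2)] local_form_canonical[OF assms(2)]
        std_form_endo_of[OF local_form_alternating[OF assms]])
qed

lemma raise_lower:
  assumes inj: "inj_on (lowM \<sigma> m) (TM m)" and "X \<in> TM m"
  shows "raiM \<sigma> m (lowM \<sigma> m X) = X"
  unfolding raise_def using assms by (rule inv_into_f_f)

lemma inj_lower_canonical:
  assumes C: "C \<in> atM m"
  shows "inj_on (lowM \<Omega> m) (TM m)"
proof (rule inj_onI)
  fix X Y assume X: "X \<in> TM m" and Y: "Y \<in> TM m" and e: "lowM \<Omega> m X = lowM \<Omega> m Y"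
  have "lowM \<Omega> m (cv C m (X C)) = lowM \<Omega> m (cv C m (Y C))"
    using e by (simp add: phase.coord_vector_eq[OF _ C] X Y)
  then have "flat (X C) = flat (Y C)" using covector_components_lower[OF C] by metis
  then have "X C = Y C" using sharp_flat(1) by metis
  then show "X = Y" by (rule phase.tangent_eqI[OF X Y C])
qed

lemma lower_canonical_cv_inject:
  assumes C: "C \<in> atM m" and "lowM \<Omega> m (cv C m u) = lowM \<Omega> m (cv C m v)"
  shows "u = v"
  using covector_components_lower[OF C] sharp_flat(1) assms(2) by metis

lemma raise_canonical_lower:
  assumes "C \<in> atM m"
  shows "raiM \<Omega> m (lowM \<Omega> m (cv C m u)) = cv C m u"
  by (rule raise_lower[OF inj_lower_canonical[OF assms] phase.coord_vector_in[OF assms]])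

text \<open>Since lowering with \<sigma> is the canonical lowering after \<open>endo_of\<close>,
  raising a canonically lowered vector applies the inverse of \<open>endo_of\<close>. By
  \<open>endo_of_square\<close> this inverse is a multiple of \<open>endo_of\<close> itself, which
  also yields the injectivity behind \<open>raise\<close>.\<close>

lemma raise_form_lower:
  assumes \<sigma>: "effective_at \<sigma> m" and C: "C \<in> atM m" and nz: "Pf B \<sigma> m \<noteq> 0"
  shows "raiM \<sigma> m (lowM \<Omega> m (cv C m u)) =
    cv C m (- (1 / Pf B \<sigma> m) *\<^sub>R endo_of (local_form C \<sigma> m) u)"
proof -
  let ?R = "endo_of (local_form C \<sigma> m)"
  note \<sigma>2 = effective_at_two_form[OF \<sigma>]
  note alt = local_form_alternating[OF \<sigma>2 C]
  have RR: "?R (?R v) = - Pf B \<sigma> m *\<^sub>R v" for v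
    using endo_of_square[OF alt effective_local_form[OF \<sigma> C]] by (simp add: Pf_eq_pfaff[OF \<sigma>2 C])
  have inj: "inj_on (lowM \<sigma> m) (TM m)"
  proof (rule inj_onI)
    fix X Y assume X: "X \<in> TM m" and Y: "Y \<in> TM m" and e: "lowM \<sigma> m X = lowM \<sigma> m Y"
    have "lowM \<sigma> m (cv C m (X C)) = lowM \<sigma> m (cv C m (Y C))"
      using e by (simp add: phase.coord_vector_eq[OF _ C] X Y)
    then have "?R (X C) = ?R (Y C)"
      unfolding lower_endo_of[OF \<sigma>2 C] by (rule lower_canonical_cv_inject[OF C])
    then have "- Pf B \<sigma> m *\<^sub>R X C = - Pf B \<sigma> m *\<^sub>R Y C" using RR by metis
    then have "X C = Y C" using nz by (metis neg_equal_0_iff_equal scaleR_cancel_left)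
    then show "X = Y" by (rule phase.tangent_eqI[OF X Y C])
  qed
  have "lowM \<sigma> m (cv C m (- (1 / Pf B \<sigma> m) *\<^sub>R ?R u)) = lowM \<Omega> m (cv C m u)"
    unfolding lower_endo_of[OF \<sigma>2 C]
    by (subst linear_scale[OF linear_endo_of[OF alt]], subst RR) (simp add: nz)
  then show ?thesis
    using raise_lower[OF inj phase.coord_vector_in[OF C]] by metis
qed

section \<open>Generalized tangent vectors in coordinates\<close>

lemma big_vector_in: "C \<in> atM m \<Longrightarrow> big_vector C m w \<in> big_tangent_space (cotangent_bundle B) m"
  by (simp add: big_vector_def big_tangent_space_def phase.coord_vector_in lower_canonical_in)

lemma big_vector_surj:
  assumes "z \<in> big_tangent_space (cotangent_bundle B) m" "C \<in> atM m"
  obtains w where "z = big_vector C m w"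
proof -
  obtain X \<xi> where z: "z = (X, \<xi>)" "X \<in> TM m" "\<xi> \<in> CM m"
    using assms(1) by (auto simp: big_tangent_space_def)
  have "z = big_vector C m (X C, sharp (covector_components (cotangent_bundle B) C m \<xi>))"
    by (simp add: big_vector_def z covector_as_lower[OF _ assms(2)] phase.coord_vector_eq[OF _ assms(2)])
  then show ?thesis by (rule that)
qed

lemma big_vector_inject:
  assumes C: "C \<in> atM m" and e: "big_vector C m w = big_vector C m w'"
  shows "w = w'"
proof -
  have "fst w = fst w'"
    using e phase.coord_vector_self[OF C] unfolding big_vector_def by (metis prod.inject)
  moreover have "snd w = snd w'"
    using e unfolding big_vector_def by (auto intro: lower_canonical_cv_inject[OF C])
  ultimately show ?thesis by (simp add: prod_eq_iff)
qed

lemma lower_canonical_add: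
  assumes "C \<in> atM m"
  shows "lowM \<Omega> m (cv C m (u + v)) = lowM \<Omega> m (cv C m u) + lowM \<Omega> m (cv C m v)"
  unfolding lower_canonical[OF assms]
  by (auto simp: coord_covector_def fun_eq_iff linear_add[OF linear_flat] inner_add_left)

lemma lower_canonical_scale:
  assumes "C \<in> atM m"
  shows "lowM \<Omega> m (cv C m (r *\<^sub>R u)) = smul r (lowM \<Omega> m (cv C m u))"
  unfolding lower_canonical[OF assms]
  by (auto simp: coord_covector_def fun_eq_iff linear_scale[OF linear_flat] smul_def)

lemma big_vector_add:
  "C \<in> atM m \<Longrightarrow> big_vector C m (w + w') = big_vector C m w + big_vector C m w'"
  unfolding big_vector_def fst_add snd_add lower_canonical_add
  by (simp add: phase.coord_vector_add)

lemma big_vector_scale: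
  "C \<in> atM m \<Longrightarrow> big_vector C m (r *\<^sub>R w) = big_smul r (big_vector C m w)"
  unfolding big_vector_def fst_scaleR snd_scaleR lower_canonical_scale
  by (simp add: phase.coord_vector_scale big_smul_def)

lemma pairing_big_vector:
  assumes "C \<in> atM m"
  shows "pairing (big_vector C m w) (big_vector C m w') = model_pairing w w'"
  by (simp add: pairing_def model_pairing_def big_vector_def lower_def phase.coord_vector_in[OF assms]
      two_form_apply[where \<sigma> = \<Omega>, OF _ _ assms] local_form_canonical[OF assms] phase.coord_vector_self[OF assms])

text \<open>The dictionary between the bundle map and its model, after which only linear algebra
  remains. A Pfaffian of absolute value one makes the factor in \<rho> equal to one and the Pfaffian
  equal to its own inverse. Self-adjointness of \<open>endo_of\<close> turns the dual of \<rho> into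
  \<rho>.\<close>

lemma quadric_endo_big_vector:
  assumes \<sigma>: "effective_at \<sigma> m" and C: "C \<in> atM m" and P: "Pf B \<sigma> m = P" "\<bar>P\<bar> = 1"
  shows "quadric_endo B \<sigma> \<epsilon>\<^sub>2 \<epsilon>\<^sub>3 a m (big_vector C m w) =
    big_vector C m (model_endo (endo_of (local_form C \<sigma> m)) P \<epsilon>\<^sub>2 \<epsilon>\<^sub>3 a w)"
proof -
  obtain a\<^sub>1 a\<^sub>2 a\<^sub>3 where a: "a = (a\<^sub>1, a\<^sub>2, a\<^sub>3)" by (cases a)
  obtain u v where w: "w = (u, v)" by (cases w)
  let ?R = "endo_of (local_form C \<sigma> m)"
  note \<sigma>2 = effective_at_two_form[OF \<sigma>]
  note alt = local_form_alternating[OF \<sigma>2 C]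
  have pw: "\<bar>P\<bar> powr (-1/2) = 1" using P(2) by simp
  have iP: "- (1 / P) = - P" using P(2) by (auto simp: abs_if split: if_splits)
  have nz: "Pf B \<sigma> m \<noteq> 0" using P by auto
  have m: "m \<in> points (cotangent_bundle B)" by (rule phase.charts_at_imp_points[OF C])
  have \<rho>: "smul 1 (raiM \<Omega> m (lowM \<sigma> m (cv C m x))) = cv C m (?R x)" for x
    by (simp add: lower_endo_of[OF \<sigma>2 C] raise_canonical_lower[OF C] smul_def)
  have \<rho>d: "(\<lambda>Y. if Y \<in> TM m then lowM \<Omega> m (cv C m v) (smul 1 (raiM \<Omega> m (lowM \<sigma> m Y))) else 0) =
      lowM \<Omega> m (cv C m (?R v))"
  proof
    fix Y show "(if Y \<in> TM m then lowM \<Omega> m (cv C m v) (smul 1 (raiM \<Omega> m (lowM \<sigma> m Y))) else 0) =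
        lowM \<Omega> m (cv C m (?R v)) Y"
    proof (cases "Y \<in> TM m")
      case True
      have "smul 1 (raiM \<Omega> m (lowM \<sigma> m Y)) = cv C m (?R (Y C))"
        using \<rho>[of "Y C"] by (simp add: phase.coord_vector_eq[OF True C])
      then show ?thesis
        using True by (simp add: lower_def two_form_apply[where \<sigma> = \<Omega>, OF _ _ C] phase.coord_vector_in[OF C]
            phase.coord_vector_self[OF C] local_form_canonical[OF C] endo_of_self_adjoint[OF alt])
    qed (simp add: lower_def)
  qed
  have in_big: "(cv C m u, lowM \<Omega> m (cv C m v)) \<in> big_tangent_space (cotangent_bundle B) m"
    using big_vector_in[OF C, of w] by (simp add: big_vector_def w)
  have smul1: "smul 1 (cv C m x) = cv C m x" for x by (simp add: smul_def)
  have low: "lowM \<sigma> m (cv C m u) = lowM \<Omega> m (cv C m (?R u))" by (rule lower_endo_of[OF \<sigma>2 C])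
  have rai: "raiM \<sigma> m (lowM \<Omega> m (cv C m v)) = cv C m (- P *\<^sub>R ?R v)"
    using raise_form_lower[OF \<sigma> C nz] by (simp add: P(1) iP)
  have "quadric_endo B \<sigma> \<epsilon>\<^sub>2 \<epsilon>\<^sub>3 a m (big_vector C m w) =
    (smul a\<^sub>1 (cv C m (?R u)) + smul a\<^sub>2 (cv C m (- P *\<^sub>R ?R v)) + smul a\<^sub>3 (cv C m v),
     smul (a\<^sub>2 * \<epsilon>\<^sub>2) (lowM \<Omega> m (cv C m (?R u))) + smul (a\<^sub>3 * \<epsilon>\<^sub>3) (lowM \<Omega> m (cv C m u))
       + smul (- a\<^sub>1) (lowM \<Omega> m (cv C m (?R v))))"
    unfolding quadric_endo_def a w big_vector_def Let_def
    using m in_big by (simp only: prod.case fst_conv snd_conv P(1) pw \<rho> \<rho>d smul1 rai raise_canonical_lower[OF C] low if_True simp_thms)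
  also have "\<dots> = (cv C m (a\<^sub>1 *\<^sub>R ?R u + a\<^sub>2 *\<^sub>R (- P *\<^sub>R ?R v) + a\<^sub>3 *\<^sub>R v),
      lowM \<Omega> m (cv C m ((a\<^sub>2 * \<epsilon>\<^sub>2) *\<^sub>R ?R u + (a\<^sub>3 * \<epsilon>\<^sub>3) *\<^sub>R u + (- a\<^sub>1) *\<^sub>R ?R v)))"
    unfolding lower_canonical_add[OF C] lower_canonical_scale[OF C]
    by (simp only: phase.coord_vector_add[OF C] phase.coord_vector_scale[OF C])
  also have "\<dots> = big_vector C m (model_endo ?R P \<epsilon>\<^sub>2 \<epsilon>\<^sub>3 a w)"
    by (simp add: big_vector_def model_endo_def a w)
  finally show ?thesis .
qed

lemma quadric_endo_outside:
  "m \<notin> points (cotangent_bundle B) \<or> z \<notin> big_tangent_space (cotangent_bundle B) m \<Longrightarrow>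
    quadric_endo B \<sigma> \<epsilon>\<^sub>2 \<epsilon>\<^sub>3 a m z = 0"
  by (cases a; cases z) (auto simp: quadric_endo_def Let_def)

text \<open>What is used of a normalization, with \<open>s\<close> the constant sign of the
  Pfaffian. Stated for an arbitrary form, it applies alike to the normalizations of all structures
  with the given equation.\<close>

definition normalized_structure where
  "normalized_structure s \<beta> \<longleftrightarrow>
     (\<forall>m\<in>points (cotangent_bundle B). effective_at \<beta> m \<and> Pf B \<beta> m = s) \<and>
     (\<forall>C\<in>cotangent_bundle B. \<forall>u v.
        smooth_on (chart_image C) (\<lambda>x. local_form C \<beta> (chart_inv C x) u v))"

lemma normalized_structureD:
  "normalized_structure s \<beta> \<Longrightarrow> C \<in> atM m \<Longrightarrow> effective_at \<beta> m"
  "normalized_structure s \<beta> \<Longrightarrow> C \<in> atM m \<Longrightarrow> Pf B \<beta> m = s"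
  "normalized_structure s \<beta> \<Longrightarrow> C \<in> cotangent_bundle B \<Longrightarrow>
    smooth_on (chart_image C) (\<lambda>x. local_form C \<beta> (chart_inv C x) u v)"
  using phase.charts_at_imp_points unfolding normalized_structure_def by blast+

lemma bundle_endomorphism_quadric_endo:
  assumes \<beta>: "normalized_structure s \<beta>" and s: "\<bar>s\<bar> = 1"
  shows "bundle_endomorphism (cotangent_bundle B) (quadric_endo B \<beta> \<epsilon>\<^sub>2 \<epsilon>\<^sub>3 a)"
  unfolding bundle_endomorphism_def
proof (intro conjI ballI allI impI)
  fix m z assume m: "m \<in> points (cotangent_bundle B)" and z: "z \<in> big_tangent_space (cotangent_bundle B) m"
  note C = phase.some_chart_in[OF m]
  let ?C = "some_chart (cotangent_bundle B) m"
  note q = quadric_endo_big_vector[OF normalized_structureD(1)[OF \<beta> C] C normalized_structureD(2)[OF \<beta> C] s]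
  note l = linear_model_endo[OF linear_endo_of[OF local_form_alternating[OF effective_at_two_form[OF normalized_structureD(1)[OF \<beta> C]] C]]]
  obtain w where w: "z = big_vector ?C m w" using big_vector_surj[OF z C] .
  show "quadric_endo B \<beta> \<epsilon>\<^sub>2 \<epsilon>\<^sub>3 a m z \<in> big_tangent_space (cotangent_bundle B) m"
    by (simp add: w q big_vector_in[OF C])
  show "quadric_endo B \<beta> \<epsilon>\<^sub>2 \<epsilon>\<^sub>3 a m (big_smul r z) = big_smul r (quadric_endo B \<beta> \<epsilon>\<^sub>2 \<epsilon>\<^sub>3 a m z)" for r
    by (simp add: w q big_vector_scale[OF C, symmetric] linear_scale[OF l])
  fix z' assume "z' \<in> big_tangent_space (cotangent_bundle B) m"
  then obtain w' where w': "z' = big_vector ?C m w'" using big_vector_surj[OF _ C] by blast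
  show "quadric_endo B \<beta> \<epsilon>\<^sub>2 \<epsilon>\<^sub>3 a m (z + z') = quadric_endo B \<beta> \<epsilon>\<^sub>2 \<epsilon>\<^sub>3 a m z + quadric_endo B \<beta> \<epsilon>\<^sub>2 \<epsilon>\<^sub>3 a m z'"
    by (simp add: w w' q big_vector_add[OF C, symmetric] linear_add[OF l])
next
  fix m z assume "m \<notin> points (cotangent_bundle B) \<or> z \<notin> big_tangent_space (cotangent_bundle B) m"
  then show "quadric_endo B \<beta> \<epsilon>\<^sub>2 \<epsilon>\<^sub>3 a m z = 0" by (rule quadric_endo_outside)
next
  fix C v p assume CM: "C \<in> cotangent_bundle B"
  let ?R = "\<lambda>x. endo_of (local_form C \<beta> (chart_inv C x))"
  obtain a\<^sub>1 a\<^sub>2 a\<^sub>3 where a: "a = (a\<^sub>1, a\<^sub>2, a\<^sub>3)" by (cases a)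
  have op: "open (chart_image C)" by (rule phase.chart_image_open[OF CM])
  have bl: "bounded_linear sharp" "bounded_linear flat"
    using linear_sharp linear_flat linear_conv_bounded_linear by auto
  have sm: "smooth_on (chart_image C) (\<lambda>x. ?R x u)" for u
    unfolding endo_of_def
    by (intro smooth_on_bounded_linear_compose[OF bl(1) op] smooth_on_sum[OF op]
        smooth_on_scaleR[OF op] smooth_on_const normalized_structureD(3)[OF \<beta> CM])
  \<comment> \<open>The vectors fed to \<open>?R x\<close> do not depend on \<open>x\<close>, so
    smoothness of the local coefficients is enough; the fixed covector \<open>p\<close> enters as
    the fixed vector \<open>sharp p\<close>.\<close>
  have "smooth_on (chart_image C) (\<lambda>x.
      (a\<^sub>1 *\<^sub>R ?R x v + (- (a\<^sub>2 * s)) *\<^sub>R ?R x (sharp p) + a\<^sub>3 *\<^sub>R sharp p,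
       flat ((a\<^sub>2 * \<epsilon>\<^sub>2) *\<^sub>R ?R x v + (a\<^sub>3 * \<epsilon>\<^sub>3) *\<^sub>R v + (- a\<^sub>1) *\<^sub>R ?R x (sharp p))))"
    by (intro smooth_on_Pair[OF op] smooth_on_bounded_linear_compose[OF bl(2) op] smooth_on_add[OF op]
        smooth_on_scaleR[OF op] smooth_on_const sm)
  then show "smooth_on (chart_image C) (\<lambda>x.
        let m = chart_inv C x;
            w = quadric_endo B \<beta> \<epsilon>\<^sub>2 \<epsilon>\<^sub>3 a m (cv C m v, coord_covector (cotangent_bundle B) C m p)
        in (fst w C, covector_components (cotangent_bundle B) C m (snd w)))"
  proof (rule smooth_on_cong[OF op])
    fix x assume "x \<in> chart_image C"
    then have C: "C \<in> atM (chart_inv C x)" by (rule phase.chart_inv_charts_at[OF CM])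
    note q = quadric_endo_big_vector[OF normalized_structureD(1)[OF \<beta> C] C normalized_structureD(2)[OF \<beta> C] s]
    have "(cv C (chart_inv C x) v, coord_covector (cotangent_bundle B) C (chart_inv C x) p) =
        big_vector C (chart_inv C x) (v, sharp p)"
      by (simp add: big_vector_def lower_canonical[OF C])
    then show "(a\<^sub>1 *\<^sub>R ?R x v + (- (a\<^sub>2 * s)) *\<^sub>R ?R x (sharp p) + a\<^sub>3 *\<^sub>R sharp p,
       flat ((a\<^sub>2 * \<epsilon>\<^sub>2) *\<^sub>R ?R x v + (a\<^sub>3 * \<epsilon>\<^sub>3) *\<^sub>R v + (- a\<^sub>1) *\<^sub>R ?R x (sharp p))) =
       (let m = chart_inv C x;
            w = quadric_endo B \<beta> \<epsilon>\<^sub>2 \<epsilon>\<^sub>3 a m (cv C m v, coord_covector (cotangent_bundle B) C m p)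
        in (fst w C, covector_components (cotangent_bundle B) C m (snd w)))"
      unfolding Let_def
      by (simp add: q, simp add: big_vector_def phase.coord_vector_self[OF C]
          covector_components_lower[OF C] model_endo_def a)
  qed
qed

lemma quadric_endo_square:
  assumes \<beta>: "normalized_structure s \<beta>" and s: "\<bar>s\<bar> = 1" and C: "C \<in> atM m"
  shows "quadric_endo B \<beta> \<epsilon>\<^sub>2 \<epsilon>\<^sub>3 (a\<^sub>1, a\<^sub>2, a\<^sub>3) m
      (quadric_endo B \<beta> \<epsilon>\<^sub>2 \<epsilon>\<^sub>3 (a\<^sub>1, a\<^sub>2, a\<^sub>3) m (big_vector C m w)) =
    big_vector C m ((- s * a\<^sub>1\<^sup>2 + \<epsilon>\<^sub>2 * a\<^sub>2\<^sup>2 + \<epsilon>\<^sub>3 * a\<^sub>3\<^sup>2) *\<^sub>R w +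
      (a\<^sub>2 * a\<^sub>3 * (\<epsilon>\<^sub>2 - s * \<epsilon>\<^sub>3)) *\<^sub>R (endo_of (local_form C \<beta> m) (fst w), endo_of (local_form C \<beta> m) (snd w)))"
proof -
  note e = normalized_structureD(1)[OF \<beta> C] and P = normalized_structureD(2)[OF \<beta> C]
  note alt = local_form_alternating[OF effective_at_two_form[OF e] C]
  have R: "endo_of (local_form C \<beta> m) (endo_of (local_form C \<beta> m) u) = - s *\<^sub>R u" for u
    using endo_of_square[OF alt effective_local_form[OF e C]] P
    by (simp add: Pf_eq_pfaff[OF effective_at_two_form[OF e] C])
  have "s\<^sup>2 = 1" using s by (metis abs_square_eq_1)
  then show ?thesis
    unfolding quadric_endo_big_vector[OF e C P s]
    by (simp add: model_endo_square[OF linear_endo_of[OF alt] R])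
qed

lemma almost_structure_quadric_endo:
  assumes \<beta>: "normalized_structure s \<beta>" and s: "\<bar>s\<bar> = 1"
    and k: "- s * a\<^sub>1\<^sup>2 + \<epsilon>\<^sub>2 * a\<^sub>2\<^sup>2 + \<epsilon>\<^sub>3 * a\<^sub>3\<^sup>2 = k" and \<mu>: "a\<^sub>2 * a\<^sub>3 * (\<epsilon>\<^sub>2 - s * \<epsilon>\<^sub>3) = 0"
  shows "almost_structure k (- k) (cotangent_bundle B) (quadric_endo B \<beta> \<epsilon>\<^sub>2 \<epsilon>\<^sub>3 (a\<^sub>1, a\<^sub>2, a\<^sub>3))"
  unfolding almost_structure_def
proof (intro conjI ballI)
  show "bundle_endomorphism (cotangent_bundle B) (quadric_endo B \<beta> \<epsilon>\<^sub>2 \<epsilon>\<^sub>3 (a\<^sub>1, a\<^sub>2, a\<^sub>3))"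
    by (rule bundle_endomorphism_quadric_endo[OF \<beta> s])
  fix m z assume m: "m \<in> points (cotangent_bundle B)" and z: "z \<in> big_tangent_space (cotangent_bundle B) m"
  note C = phase.some_chart_in[OF m]
  let ?C = "some_chart (cotangent_bundle B) m" and ?J = "quadric_endo B \<beta> \<epsilon>\<^sub>2 \<epsilon>\<^sub>3 (a\<^sub>1, a\<^sub>2, a\<^sub>3)"
  note e = normalized_structureD(1)[OF \<beta> C] and P = normalized_structureD(2)[OF \<beta> C]
  note alt = local_form_alternating[OF effective_at_two_form[OF e] C]
  let ?A = "model_endo (endo_of (local_form ?C \<beta> m)) s \<epsilon>\<^sub>2 \<epsilon>\<^sub>3 (a\<^sub>1, a\<^sub>2, a\<^sub>3)"
  note q = quadric_endo_big_vector[OF e C P s]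
  obtain w where w: "z = big_vector ?C m w" using big_vector_surj[OF z C] .
  have sq: "?J m (?J m (big_vector ?C m x)) = big_vector ?C m (k *\<^sub>R x)" for x
    unfolding quadric_endo_square[OF \<beta> s C] k \<mu> by (simp add: zero_prod_def[symmetric])
  show "?J m (?J m z) = big_smul k z"
    by (simp add: w sq big_vector_scale[OF C])
  fix z' assume "z' \<in> big_tangent_space (cotangent_bundle B) m"
  then obtain w' where w': "z' = big_vector ?C m w'" using big_vector_surj[OF _ C] by blast
  \<comment> \<open>Skewness moves the first endomorphism onto \<open>?A w'\<close>, so the pairing
    needs the square on the model side.\<close>
  have "?A (?A w') = k *\<^sub>R w'"
    using sq[of w'] by (intro big_vector_inject[OF C]) (simp add: q)
  then show "pairing (?J m z) (?J m z') = - k * pairing z z'"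
    using model_endo_skew[of "endo_of (local_form ?C \<beta> m)" s \<epsilon>\<^sub>2 \<epsilon>\<^sub>3 "(a\<^sub>1, a\<^sub>2, a\<^sub>3)" w "?A w'"]
      endo_of_self_adjoint[OF alt]
    by (simp add: w w' q pairing_big_vector[OF C] model_pairing_linear)
qed

text \<open>On vectors \<open>(u, 0)\<close> the square acts as a combination of the identity and
  \<rho>. These are independent, so a scalar square forces the coefficient of \<rho> to vanish; a
  single point of the bundle is enough.\<close>

lemma quadric_endo_square_scalar:
  assumes \<beta>: "normalized_structure s \<beta>" and s: "\<bar>s\<bar> = 1" and C: "C \<in> atM m"
    and g: "\<And>z. z \<in> big_tangent_space (cotangent_bundle B) m \<Longrightarrow>
      quadric_endo B \<beta> \<epsilon>\<^sub>2 \<epsilon>\<^sub>3 (a\<^sub>1, a\<^sub>2, a\<^sub>3) m (quadric_endo B \<beta> \<epsilon>\<^sub>2 \<epsilon>\<^sub>3 (a\<^sub>1, a\<^sub>2, a\<^sub>3) m z) = big_smul \<gamma> z"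
  shows "a\<^sub>2 * a\<^sub>3 * (\<epsilon>\<^sub>2 - s * \<epsilon>\<^sub>3) = 0"
proof -
  note e = normalized_structureD(1)[OF \<beta> C] and P = normalized_structureD(2)[OF \<beta> C]
  note alt = local_form_alternating[OF effective_at_two_form[OF e] C]
  let ?R = "endo_of (local_form C \<beta> m)"
  let ?\<kappa> = "- s * a\<^sub>1\<^sup>2 + \<epsilon>\<^sub>2 * a\<^sub>2\<^sup>2 + \<epsilon>\<^sub>3 * a\<^sub>3\<^sup>2" and ?\<mu> = "a\<^sub>2 * a\<^sub>3 * (\<epsilon>\<^sub>2 - s * \<epsilon>\<^sub>3)"
  have "(?\<kappa> - \<gamma>) *\<^sub>R u + ?\<mu> *\<^sub>R ?R u = 0" for u
  proof -
    have "?\<kappa> *\<^sub>R (u, 0) + ?\<mu> *\<^sub>R (?R u, ?R 0) = \<gamma> *\<^sub>R (u, 0)"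
      using g[OF big_vector_in[OF C, of "(u, 0)"]] quadric_endo_square[OF \<beta> s C, of \<epsilon>\<^sub>2 \<epsilon>\<^sub>3 a\<^sub>1 a\<^sub>2 a\<^sub>3 "(u, 0)"]
      by (intro big_vector_inject[OF C]) (simp only: big_vector_scale[OF C] fst_conv snd_conv)
    then have "?\<kappa> *\<^sub>R u + ?\<mu> *\<^sub>R ?R u = \<gamma> *\<^sub>R u" by simp
    then show ?thesis by (simp add: algebra_simps)
  qed
  moreover have "pfaff (local_form C \<beta> m) \<noteq> 0"
    using P s by (auto simp: Pf_eq_pfaff[OF effective_at_two_form[OF e] C])
  ultimately show ?thesis
    using endo_of_not_scalar[OF alt effective_local_form[OF e C]] by blast
qed

text \<open>The first component of the image of \<open>(u, 0)\<close> shows \<open>a\<^sub>1\<close>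
  as the coefficient of \<rho>. That of \<open>(0, u)\<close> shows \<open>a\<^sub>3\<close> and, up
  to sign, \<open>a\<^sub>2\<close> as coefficients of the identity and of \<rho>. Independence of
  the two maps separates them.\<close>

lemma quadric_endo_inject:
  assumes \<beta>: "normalized_structure s \<beta>" and s: "\<bar>s\<bar> = 1" and C: "C \<in> atM m"
    and eq: "quadric_endo B \<beta> \<epsilon>\<^sub>2 \<epsilon>\<^sub>3 a = quadric_endo B \<beta> \<epsilon>\<^sub>2 \<epsilon>\<^sub>3 b"
  shows "a = b"
proof -
  obtain a\<^sub>1 a\<^sub>2 a\<^sub>3 b\<^sub>1 b\<^sub>2 b\<^sub>3 where ab: "a = (a\<^sub>1, a\<^sub>2, a\<^sub>3)" "b = (b\<^sub>1, b\<^sub>2, b\<^sub>3)" by (cases a, cases b)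
  note e = normalized_structureD(1)[OF \<beta> C] and P = normalized_structureD(2)[OF \<beta> C]
  note alt = local_form_alternating[OF effective_at_two_form[OF e] C]
  let ?R = "endo_of (local_form C \<beta> m)"
  have eq': "model_endo ?R s \<epsilon>\<^sub>2 \<epsilon>\<^sub>3 a w = model_endo ?R s \<epsilon>\<^sub>2 \<epsilon>\<^sub>3 b w" for w
    using fun_cong[OF fun_cong[OF eq, of m], of "big_vector C m w"]
    by (intro big_vector_inject[OF C]) (simp add: quadric_endo_big_vector[OF e C P s])
  have R0: "?R 0 = 0" by (rule linear_0[OF linear_endo_of[OF alt]])
  have pf: "pfaff (local_form C \<beta> m) \<noteq> 0"
    using P s by (auto simp: Pf_eq_pfaff[OF effective_at_two_form[OF e] C])
  note ns = endo_of_not_scalar[OF alt effective_local_form[OF e C] pf]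
  have "0 *\<^sub>R u + (a\<^sub>1 - b\<^sub>1) *\<^sub>R ?R u = 0" for u
    using eq'[of "(u, 0)"] by (simp add: model_endo_def ab R0 algebra_simps)
  then have 1: "a\<^sub>1 - b\<^sub>1 = 0" using ns by blast
  have "(a\<^sub>3 - b\<^sub>3) *\<^sub>R u + (- s * (a\<^sub>2 - b\<^sub>2)) *\<^sub>R ?R u = 0" for u
    using eq'[of "(0, u)"] by (simp add: model_endo_def ab R0 algebra_simps)
  then have "a\<^sub>3 - b\<^sub>3 = 0 \<and> - s * (a\<^sub>2 - b\<^sub>2) = 0" using ns by blast
  then show ?thesis using 1 s by (auto simp: ab)
qed

text \<open>In \<open>model_endo\<close> the parameters \<open>a\<^sub>1\<close> and
  \<open>a\<^sub>2\<close> occur only as factors of \<open>R\<close>, and \<open>a\<^sub>3\<close>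
  never does. The sign of \<open>R\<close> can therefore be absorbed into the first two.\<close>

lemma quadric_endo_sign:
  assumes \<beta>: "normalized_structure s \<beta>" and s: "\<bar>s\<bar> = 1" and \<beta>': "normalized_structure s \<beta>'"
    and \<sigma>: "\<And>m X Y. m \<in> points (cotangent_bundle B) \<Longrightarrow> X \<in> TM m \<Longrightarrow> Y \<in> TM m \<Longrightarrow> \<beta>' m X Y = \<sigma> * \<beta> m X Y"
  shows "quadric_endo B \<beta>' \<epsilon>\<^sub>2 \<epsilon>\<^sub>3 (a\<^sub>1, a\<^sub>2, a\<^sub>3) = quadric_endo B \<beta> \<epsilon>\<^sub>2 \<epsilon>\<^sub>3 (\<sigma> * a\<^sub>1, \<sigma> * a\<^sub>2, a\<^sub>3)"
proof (intro ext)
  fix m z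
  show "quadric_endo B \<beta>' \<epsilon>\<^sub>2 \<epsilon>\<^sub>3 (a\<^sub>1, a\<^sub>2, a\<^sub>3) m z = quadric_endo B \<beta> \<epsilon>\<^sub>2 \<epsilon>\<^sub>3 (\<sigma> * a\<^sub>1, \<sigma> * a\<^sub>2, a\<^sub>3) m z"
  proof (cases "m \<in> points (cotangent_bundle B) \<and> z \<in> big_tangent_space (cotangent_bundle B) m")
    case True
    then have m: "m \<in> points (cotangent_bundle B)" by simp
    note C = phase.some_chart_in[OF m]
    let ?C = "some_chart (cotangent_bundle B) m"
    obtain w where w: "z = big_vector ?C m w" using True big_vector_surj[OF _ C] by blast
    have "local_form ?C \<beta>' m u v = \<sigma> * local_form ?C \<beta> m u v" for u v
      by (rule local_form_scale[where \<sigma> = \<beta> and \<tau> = \<beta>' and r = \<sigma>, OF C \<sigma>[OF m]])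
    then have "endo_of (local_form ?C \<beta>' m) u = \<sigma> *\<^sub>R endo_of (local_form ?C \<beta> m) u" for u
      by (simp add: endo_of_def scaleR_sum_right[symmetric] linear_scale[OF linear_sharp] flip: scaleR_scaleR)
    then show ?thesis
      unfolding w quadric_endo_big_vector[OF normalized_structureD(1)[OF \<beta> C] C normalized_structureD(2)[OF \<beta> C] s]
        quadric_endo_big_vector[OF normalized_structureD(1)[OF \<beta>' C] C normalized_structureD(2)[OF \<beta>' C] s]
      by (simp add: model_endo_def mult.commute mult.left_commute)
  qed (simp add: quadric_endo_outside)
qed

end

section \<open>Realizing second jets\<close>

text \<open>Since \<open>q\<close> vanishes at \<open>x\<^sub>0\<close> and the derivative of the radial bump function does so too, the bump
  function influences the second jet of the product only by its value at \<open>x\<^sub>0\<close>.\<close>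

lemma smooth_function_with_jet:
  fixes x\<^sub>0 p :: "'a::euclidean_space" and H :: "'a \<Rightarrow> 'a"
  assumes r: "r > 0" and H: "linear H" and sym: "\<And>v w. H v \<bullet> w = v \<bullet> H w"
  obtains g :: "'a \<Rightarrow> real" where "smooth_on UNIV g" "\<And>y. r \<le> dist x\<^sub>0 y \<Longrightarrow> g y = 0"
    "\<And>v. fderiv g x\<^sub>0 v = p \<bullet> v" "\<And>u v. fderiv (\<lambda>y. fderiv g y v) x\<^sub>0 u = H u \<bullet> v"
proof -
  \<comment> \<open>\<open>\<phi> 0\<close> is the bump; \<open>\<phi> 2\<close> appears in its
    derivative, as \<open>flat_exp 2\<close> is the derivative of \<open>flat_exp 0\<close>.
    \<open>q\<close> is the prescribed Taylor polynomial without constant term, and \<kappa> is the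
    value of the bump at the centre, to be divided out.\<close>
  define \<phi> where "\<phi> n y = flat_exp n (r\<^sup>2 - (y - x\<^sub>0) \<bullet> (y - x\<^sub>0))" for n y
  define q where "q y = p \<bullet> (y - x\<^sub>0) + (1/2) * (H (y - x\<^sub>0) \<bullet> (y - x\<^sub>0))" for y
  define \<kappa> where "\<kappa> = flat_exp 0 (r\<^sup>2)"
  have \<kappa>: "\<kappa> \<noteq> 0" using r by (simp add: \<kappa>_def flat_exp_def)
  have bH: "bounded_linear H" using H linear_conv_bounded_linear by auto
  have dH: "((\<lambda>y. H (y - x\<^sub>0)) has_derivative H) (at y)" for y
    using bounded_linear.has_derivative[OF bH has_derivative_diff[OF has_derivative_ident has_derivative_const[of x\<^sub>0]]]
    by simp
  have sm\<phi>: "smooth_on UNIV (\<phi> n)" for n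
  proof -
    have "smooth_on UNIV (\<lambda>y. r\<^sup>2 + (- 1) *\<^sub>R ((y + (- x\<^sub>0)) \<bullet> (y + (- x\<^sub>0))))"
      by (intro smooth_on_add smooth_on_inner smooth_on_scaleR smooth_on_const smooth_on_id open_UNIV)
    then have "smooth_on UNIV (\<lambda>y. flat_exp n (r\<^sup>2 + (- 1) *\<^sub>R ((y + (- x\<^sub>0)) \<bullet> (y + (- x\<^sub>0)))))"
      by (rule smooth_on_compose[OF open_UNIV open_UNIV subset_UNIV]) (rule smooth_flat_exp)
    then show ?thesis by (simp add: \<phi>_def[abs_def])
  qed
  have smq: "smooth_on UNIV q"
  proof -
    have "smooth_on UNIV (\<lambda>y. p \<bullet> (y + (- x\<^sub>0)) + (1/2) *\<^sub>R (H (y + (- x\<^sub>0)) \<bullet> (y + (- x\<^sub>0))))"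
      by (intro smooth_on_add smooth_on_inner smooth_on_scaleR smooth_on_const smooth_on_id open_UNIV
          smooth_on_bounded_linear_compose[OF bH])
    then show ?thesis by (simp add: q_def[abs_def])
  qed
  define g where "g y = (1 / \<kappa>) *\<^sub>R (\<phi> 0 y * q y)" for y
  have smg: "smooth_on UNIV g"
    unfolding g_def[abs_def] by (intro smooth_on_scaleR smooth_on_mult sm\<phi> smq open_UNIV smooth_on_const)
  have d\<phi>: "(\<phi> 0 has_derivative (\<lambda>v. - 2 * ((y - x\<^sub>0) \<bullet> v) * \<phi> 2 y)) (at y)" for y
  proof -
    have 1: "((\<lambda>y. r\<^sup>2 - (y - x\<^sub>0) \<bullet> (y - x\<^sub>0)) has_derivative (\<lambda>v. - 2 * ((y - x\<^sub>0) \<bullet> v))) (at y)"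
      by (auto intro!: derivative_eq_intros simp: inner_commute algebra_simps)
    show ?thesis
      using diff_chain_at[OF 1 flat_exp_deriv[of 0, unfolded has_field_derivative_def]]
      by (simp add: comp_def \<phi>_def[abs_def] mult.commute numeral_2_eq_2)
  qed
  have dq: "(q has_derivative (\<lambda>v. p \<bullet> v + H (y - x\<^sub>0) \<bullet> v)) (at y)" for y
  proof -
    have *: "H v \<bullet> (y - x\<^sub>0) = H (y - x\<^sub>0) \<bullet> v" for v
      using sym[of v "y - x\<^sub>0"] by (simp add: inner_commute)
    have "(q has_derivative
        (\<lambda>v. p \<bullet> (v - 0) + (1/2) * (H (y - x\<^sub>0) \<bullet> (v - 0) + H v \<bullet> (y - x\<^sub>0)))) (at y)"
      unfolding q_def[abs_def]
      by (intro has_derivative_add has_derivative_inner_right has_derivative_mult_right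
          has_derivative_inner dH has_derivative_diff has_derivative_ident has_derivative_const)
    then show ?thesis by (rule has_derivative_eq_rhs) (simp add: fun_eq_iff *)
  qed
  have dg: "(g has_derivative (\<lambda>v. (1 / \<kappa>) * (\<phi> 0 y * (p \<bullet> v + H (y - x\<^sub>0) \<bullet> v)
      - 2 * ((y - x\<^sub>0) \<bullet> v) * \<phi> 2 y * q y))) (at y)" for y
    unfolding g_def[abs_def]
    by (rule has_derivative_eq_rhs, (rule derivative_eq_intros d\<phi> dq refl)+) (simp add: fun_eq_iff algebra_simps)
  have q0: "q x\<^sub>0 = 0" by (simp add: q_def)
  have \<phi>0: "\<phi> 0 x\<^sub>0 = \<kappa>" by (simp add: \<phi>_def \<kappa>_def)
  have H0: "H 0 = 0" using linear_0[OF H] .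
  have "fderiv g x\<^sub>0 v = p \<bullet> v" for v
    using \<kappa> by (simp add: fderiv_eq[OF dg] q0 \<phi>0 H0)
  moreover have "fderiv (\<lambda>y. fderiv g y v) x\<^sub>0 u = H u \<bullet> v" for u v
  proof -
    have d2: "(\<phi> 2 has_derivative fderiv (\<phi> 2) x\<^sub>0) (at x\<^sub>0)"
      by (rule smooth_on_has_derivative[OF sm\<phi>]) auto
    have "((\<lambda>y. (1 / \<kappa>) * (\<phi> 0 y * (p \<bullet> v + H (y - x\<^sub>0) \<bullet> v)
      - 2 * ((y - x\<^sub>0) \<bullet> v) * \<phi> 2 y * q y)) has_derivative (\<lambda>u. H u \<bullet> v)) (at x\<^sub>0)"
      by (rule has_derivative_eq_rhs, (rule derivative_eq_intros d\<phi> dq dH d2 refl)+)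
        (simp add: fun_eq_iff q0 \<phi>0 H0 \<kappa>)
    then show ?thesis by (simp add: fderiv_eq[OF dg] fderiv_eq)
  qed
  moreover have "g y = 0" if "r \<le> dist x\<^sub>0 y" for y
  proof -
    have "r\<^sup>2 \<le> (dist x\<^sub>0 y)\<^sup>2" using that r by (intro power_mono) auto
    also have "\<dots> = (y - x\<^sub>0) \<bullet> (y - x\<^sub>0)"
      by (simp add: dist_norm norm_minus_commute[of x\<^sub>0] power2_norm_eq_inner)
    finally show ?thesis by (simp add: g_def \<phi>_def flat_exp_def)
  qed
  ultimately show ?thesis using that smg by blast
qed

section \<open>The topology of a manifold and extension by zero\<close>

lemma topspace_manifold_topology:
  assumes "smooth_manifold M"
  shows "topspace (manifold_topology M) = points M"
proof -
  have "snd c ` (points M \<inter> fst c) = chart_image c" if "c \<in> M" for c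
    using that by (auto simp: points_def chart_image_def)
  then have "openin (manifold_topology M) (points M)"
    using assms unfolding openin_manifold_topology[OF assms] by (simp add: smooth_manifold_def)
  moreover have "topspace (manifold_topology M) \<subseteq> points M"
    using openin_topspace[of "manifold_topology M"] unfolding openin_manifold_topology[OF assms] by blast
  ultimately show ?thesis using openin_subset by blast
qed

lemma continuous_chart_inv:
  assumes M: "smooth_manifold M" and c: "c \<in> M"
  shows "continuous_map (top_of_set (chart_image c)) (manifold_topology M) (chart_inv c)"
proof -
  interpret smooth_atlas M by (rule smooth_manifold_imp_smooth_atlas[OF M])
  have "openin (top_of_set (chart_image c)) {x \<in> chart_image c. chart_inv c x \<in> W}"
    if "openin (manifold_topology M) W" for W
  proof -
    have "{x \<in> chart_image c. chart_inv c x \<in> W} = snd c ` (W \<inter> fst c)"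
      using chart_chart_inv chart_inv_in chart_inv_chart[OF c] by (force simp: chart_image_def)
    moreover have "open (snd c ` (W \<inter> fst c))"
      using that c unfolding openin_manifold_topology[OF M] by blast
    ultimately show ?thesis by (auto intro: open_subset)
  qed
  then show ?thesis
    using chart_inv_in[of _ c] c
    by (auto simp: continuous_map_def topspace_manifold_topology[OF M] points_def)
qed

text \<open>The Hausdorff property enters here: the compact set \<open>K\<close> is carried to a
  compact, hence closed subset of the manifold. A point outside of the chart thus has a
  neighbourhood that avoids this subset, and there the function is zero.\<close>

lemma smooth_function_extend_zero:
  fixes M :: "('m, 'e::euclidean_space) atlas"
  assumes M: "smooth_manifold M" and c: "c \<in> M"
    and K: "compact K" "K \<subseteq> chart_image c" and g: "smooth_on UNIV g" "\<And>y. y \<notin> K \<Longrightarrow> g y = 0"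
  shows "smooth_function M (\<lambda>b. if b \<in> fst c then g (snd c b) else 0)"
  unfolding smooth_function_def
proof
  interpret smooth_atlas M by (rule smooth_manifold_imp_smooth_atlas[OF M])
  let ?f = "\<lambda>b. if b \<in> fst c then g (snd c b) else 0"
  let ?L = "chart_inv c ` K"
  have "compactin (manifold_topology M) ?L"
    by (rule image_compactin[OF _ continuous_chart_inv[OF M c]])
      (use K in \<open>simp add: compactin_subtopology\<close>)
  then have "closedin (manifold_topology M) ?L"
    using M by (intro compactin_imp_closedin) (auto simp: smooth_manifold_def)
  then have W: "openin (manifold_topology M) (points M - ?L)"
    by (simp add: closedin_def topspace_manifold_topology[OF M])
  fix c' assume c': "c' \<in> M"
  show "smooth_on (chart_image c') (?f \<circ> chart_inv c')"
  proof (rule smooth_on_local)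
    fix x assume x: "x \<in> chart_image c'"
    show "\<exists>U. open U \<and> x \<in> U \<and> smooth_on U (?f \<circ> chart_inv c')"
    proof (cases "chart_inv c' x \<in> fst c")
      case True
      let ?U = "snd c' ` (fst c' \<inter> fst c)"
      have U: "open ?U" by (rule overlap_open[OF c' c])
      have "snd c' (chart_inv c' x) \<in> ?U" using True chart_inv_in[OF x] by blast
      then have "x \<in> ?U" by (simp only: chart_chart_inv[OF x])
      moreover have "smooth_on ?U (\<lambda>y. g (transition c' c y))"
        by (rule smooth_on_compose[OF U open_UNIV _ transition_smooth[OF c' c] g(1)]) simp
      then have "smooth_on ?U (?f \<circ> chart_inv c')"
        by (rule smooth_on_cong[OF U]) (auto simp: transition_apply chart_inv_chart c')
      ultimately show ?thesis using U by blast
    next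
      case False
      let ?U = "snd c' ` ((points M - ?L) \<inter> fst c')"
      have U: "open ?U" using W c' unfolding openin_manifold_topology[OF M] by blast
      have "chart_inv c' x \<notin> ?L" using False K(2) chart_inv_in[of _ c] by auto
      then have "snd c' (chart_inv c' x) \<in> ?U"
        using chart_inv_in[OF x] charts_at_imp_points[OF chart_inv_charts_at[OF c' x]] by blast
      then have "x \<in> ?U" by (simp only: chart_chart_inv[OF x])
      moreover have "smooth_on ?U (?f \<circ> chart_inv c')"
      proof (rule smooth_on_cong[OF U smooth_on_const])
        fix y assume "y \<in> ?U"
        then obtain b where b: "y = snd c' b" "b \<in> fst c'" "b \<notin> ?L" by blast
        have "snd c b \<notin> K" if "b \<in> fst c" using b(3) chart_inv_chart[OF c that] by force
        then show "0 = (?f \<circ> chart_inv c') y" by (simp add: b chart_inv_chart[OF c'] g(2))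
      qed
      ultimately show ?thesis using U by blast
    qed
  qed
qed

section \<open>Differentials of functions in charts\<close>

context smooth_atlas
begin

lemma differential_chart:
  assumes f: "smooth_function M f" and c: "c \<in> charts_at M b" and X: "X \<in> tangent_space M b"
  shows "differential M f b X = fderiv (f \<circ> chart_inv c) (snd c b) (X c)"
proof -
  let ?c = "some_chart M b"
  have c1: "?c \<in> charts_at M b" by (rule some_chart_in[OF charts_at_imp_points[OF c]])
  note cc = charts_atD[OF c] charts_atD[OF c1]
  let ?U = "snd c ` (fst c \<inter> fst ?c)"
  have U: "open ?U" "snd c b \<in> ?U" using cc by (auto intro!: overlap_open)
  have sf: "smooth_on (chart_image ?c) (f \<circ> chart_inv ?c)"
    using f cc by (simp add: smooth_function_def)
  have "((f \<circ> chart_inv ?c) has_derivative fderiv (f \<circ> chart_inv ?c) (snd ?c b)) (at (transition c ?c (snd c b)))"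
    using smooth_on_has_derivative[OF sf chart_image_open chart_in_image] cc by (simp add: transition_apply)
  from diff_chain_at[OF transition_has_derivative[OF c c1] this]
  have "((f \<circ> chart_inv c) has_derivative (\<lambda>v. fderiv (f \<circ> chart_inv ?c) (snd ?c b) (jac c ?c b v))) (at (snd c b))"
    unfolding comp_def[of "fderiv _ _"]
    by (rule has_derivative_transform_within_open[OF _ U]) (use cc in \<open>auto simp: transition_apply chart_inv_chart\<close>)
  then have "fderiv (f \<circ> chart_inv c) (snd c b) (X c) = fderiv (f \<circ> chart_inv ?c) (snd ?c b) (jac c ?c b (X c))"
    by (simp add: fderiv_eq)
  then show ?thesis
    using tangent_change[OF X c c1] X by (simp add: differential_def Let_def)
qed

lemma smooth_function_chart: "smooth_function M f \<Longrightarrow> c \<in> M \<Longrightarrow> smooth_on (chart_image c) (f \<circ> chart_inv c)"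
  by (simp add: smooth_function_def)

lemma linear_fderiv_chart:
  assumes f: "smooth_function M f" and c: "c \<in> charts_at M b"
  shows "linear (fderiv (f \<circ> chart_inv c) (snd c b))"
  using smooth_on_has_derivative[OF smooth_function_chart[OF f] chart_image_open chart_in_image]
    charts_atD[OF c] has_derivative_linear by blast

lemma differential_in:
  assumes f: "smooth_function M f" and b: "b \<in> points M"
  shows "differential M f b \<in> cotangent_space M b"
proof -
  let ?c = "some_chart M b"
  have c: "?c \<in> charts_at M b" by (rule some_chart_in[OF b])
  note l = linear_fderiv_chart[OF f c]
  show ?thesis
    unfolding cotangent_space_def mem_Collect_eq
    using tangent_add[OF b] tangent_smul[OF b]
    by (simp add: differential_chart[OF f c] linear_add[OF l] linear_scale[OF l] smul_def)
      (simp add: differential_def)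
qed

lemma covector_components_differential:
  assumes f: "smooth_function M f" and c: "c \<in> charts_at M b"
  shows "covector_components M c b (differential M f b) =
    (\<Sum>i\<in>Basis. fderiv (f \<circ> chart_inv c) (snd c b) i *\<^sub>R i)"
  by (simp add: covector_components_def differential_chart[OF f c] coord_vector_in[OF c] coord_vector_self[OF c])

end

section \<open>Second jets and the equation\<close>

context smooth_surface
begin

text \<open>The coordinate expression of the tangent map of the section \<open>df\<close>: a vector
  together with its image under the Hessian of \<open>f\<close> in the chart.\<close>

definition section_jet :: "('b \<Rightarrow> real) \<Rightarrow> 'b \<Rightarrow> real^2 \<Rightarrow> phase_coords" where
  "section_jet f b v = (let c = some_chart B b in
     (v, \<Sum>i\<in>Basis. fderiv (\<lambda>y. fderiv (f \<circ> chart_inv c) y i) (snd c b) v *\<^sub>R i))"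

text \<open>\<open>tangent_map\<close> is defined in each target chart separately. The computation
  is done in the lift of the chosen base chart, and the chain rule with the transition transports it
  to the other charts, as \<open>coord_vector\<close> does.\<close>

lemma tangent_map_differential_section:
  assumes f: "smooth_function B f" and b: "b \<in> points B" and X: "X \<in> tangent_space B b"
  shows "tangent_map B (cotangent_bundle B) (differential_section B f) b X =
    cv (cotangent_chart B (some_chart B b)) (differential_section B f b)
      (section_jet f b (X (some_chart B b)))"
proof
  fix C'
  define c where "c = some_chart B b"
  define C where "C = cotangent_chart B c"
  define m where "m = differential_section B f b"
  have c: "c \<in> charts_at B b" unfolding c_def by (rule base.some_chart_in[OF b])
  note cc = base.charts_atD[OF c]
  have m: "m = (b, differential B f b)" by (simp add: m_def differential_section_def)
  have C: "C \<in> atM m" unfolding m C_def charts_at_cotangent_bundle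
    using c base.differential_in[OF f b] by blast
  let ?S = "\<lambda>x. (x, \<Sum>i\<in>Basis. fderiv (f \<circ> chart_inv c) x i *\<^sub>R i)"
  have sm: "smooth_on (chart_image c) (f \<circ> chart_inv c)" using base.smooth_function_chart[OF f] cc by blast
  have op: "open (chart_image c)" using base.chart_image_open cc by blast
  have x: "snd c b \<in> chart_image c" using cc by (simp add: chart_image_def)
  have S: "snd C (differential_section B f (chart_inv c y)) = ?S y"
      "differential_section B f (chart_inv c y) \<in> fst C" if y: "y \<in> chart_image c" for y
  proof -
    have c': "c \<in> charts_at B (chart_inv c y)" using base.chart_inv_charts_at[OF _ y] cc by blast
    show "snd C (differential_section B f (chart_inv c y)) = ?S y"
      by (simp add: C_def differential_section_def snd_cotangent_chart base.chart_chart_inv[OF y]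
          base.covector_components_differential[OF f c'])
    show "differential_section B f (chart_inv c y) \<in> fst C"
      using base.differential_in[OF f base.charts_at_imp_points[OF c']] base.chart_inv_in[OF y]
      by (simp add: C_def differential_section_def fst_cotangent_chart)
  qed
  have dS: "(?S has_derivative section_jet f b) (at (snd c b))"
  proof -
    have "((\<lambda>y. fderiv (f \<circ> chart_inv c) y i) has_derivative
        fderiv (\<lambda>y. fderiv (f \<circ> chart_inv c) y i) (snd c b)) (at (snd c b))" for i
      by (rule smooth_on_has_derivative[OF smooth_on_fderiv[OF sm] op x])
    then show ?thesis
      unfolding section_jet_def[abs_def] Let_def c_def[symmetric]
      by (intro has_derivative_Pair has_derivative_ident has_derivative_sum has_derivative_scaleR_left)
  qed
  have Sx: "?S (snd c b) = snd C m"
    using S(1)[OF x] by (simp add: m_def base.chart_inv_chart cc)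
  show "tangent_map B (cotangent_bundle B) (differential_section B f) b X C' =
      cv (cotangent_chart B (some_chart B b)) (differential_section B f b)
        (section_jet f b (X (some_chart B b))) C'"
  proof (cases "C' \<in> atM m")
    case True
    then obtain c' where c': "c' \<in> charts_at B b" and C': "C' = cotangent_chart B c'"
      by (auto simp: m charts_at_cotangent_bundle)
    note cc' = base.charts_atD[OF c']
    let ?U = "snd c ` (fst c \<inter> fst c')"
    have U: "open ?U" "snd c b \<in> ?U" using cc cc' by (auto intro!: base.overlap_open)
    have "(transition C C' has_derivative phase.jac C C' m) (at (?S (snd c b)))"
      unfolding Sx by (rule phase.transition_has_derivative[OF C True])
    from diff_chain_at[OF dS this]
    have "((snd C' \<circ> differential_section B f \<circ> chart_inv c) has_derivative
        (\<lambda>v. phase.jac C C' m (section_jet f b v))) (at (snd c b))"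
      unfolding comp_def[of "phase.jac C C' m"]
    proof (rule has_derivative_transform_within_open[OF _ U])
      fix y assume "y \<in> ?U"
      then have y: "y \<in> chart_image c" by (auto simp: chart_image_def)
      have "C \<in> cotangent_bundle B" using phase.charts_atD[OF C] by blast
      from phase.transition_apply[OF this S(2)[OF y], of C']
      show "(transition C C' \<circ> ?S) y = (snd C' \<circ> differential_section B f \<circ> chart_inv c) y"
        by (simp add: S(1)[OF y])
    qed
    then show ?thesis
      using True by (simp add: tangent_map_def Let_def fderiv_eq phase.coord_vector_apply
          flip: c_def C_def m_def)
  next
    case False
    then show ?thesis by (simp add: tangent_map_def coord_vector_def m_def)
  qed
qed

lemma monge_ampere_equation_iff:
  "(f, b) \<in> monge_ampere_equation B \<alpha> \<longleftrightarrow> smooth_function B f \<and> b \<in> points B \<and>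
    (\<forall>v w. local_form (cotangent_chart B (some_chart B b)) \<alpha> (differential_section B f b)
      (section_jet f b v) (section_jet f b w) = 0)"
proof -
  have "(\<forall>X\<in>tangent_space B b. \<forall>Y\<in>tangent_space B b.
        \<alpha> (differential_section B f b)
          (tangent_map B (cotangent_bundle B) (differential_section B f) b X)
          (tangent_map B (cotangent_bundle B) (differential_section B f) b Y) = 0) \<longleftrightarrow>
    (\<forall>v w. local_form (cotangent_chart B (some_chart B b)) \<alpha> (differential_section B f b)
      (section_jet f b v) (section_jet f b w) = 0)" (is "?l \<longleftrightarrow> ?r")
    if f: "smooth_function B f" and b: "b \<in> points B"
  proof -
    note c = base.some_chart_in[OF b]
    have "?l \<longleftrightarrow> (\<forall>X\<in>tangent_space B b. \<forall>Y\<in>tangent_space B b.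
        local_form (cotangent_chart B (some_chart B b)) \<alpha> (differential_section B f b)
          (section_jet f b (X (some_chart B b))) (section_jet f b (Y (some_chart B b))) = 0)"
      by (simp add: tangent_map_differential_section[OF f b] local_form_def)
    also have "\<dots> \<longleftrightarrow> ?r"
      using base.coord_vector_in[OF c] base.coord_vector_self[OF c] by metis
    finally show ?thesis .
  qed
  then show ?thesis by (auto simp: monge_ampere_equation_def)
qed

text \<open>Every covector and every symmetric matrix is realized by a globally defined smooth
  function. So the equation tests the form at each point of the cotangent bundle, on all graphs of
  symmetric matrices.\<close>

lemma section_with_jet:
  assumes B: "smooth_manifold B" and b: "b \<in> points B" and \<xi>: "\<xi> \<in> cotangent_space B b"
  obtains f where "smooth_function B f" "differential_section B f b = (b, \<xi>)"
    "\<And>v. section_jet f b v = (v $ 1) *\<^sub>R (e1 + x *\<^sub>R e3 + y *\<^sub>R e4) + (v $ 2) *\<^sub>R (e2 + y *\<^sub>R e3 + z *\<^sub>R e4)"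
proof -
  define c where "c = some_chart B b"
  have c: "c \<in> charts_at B b" unfolding c_def by (rule base.some_chart_in[OF b])
  note cc = base.charts_atD[OF c]
  have op: "open (chart_image c)" using base.chart_image_open cc by blast
  have x: "snd c b \<in> chart_image c" using cc by (simp add: chart_image_def)
  obtain r where r: "r > 0" "cball (snd c b) r \<subseteq> chart_image c"
    using op x open_contains_cball by blast
  define p where "p = covector_components B c b \<xi>"
  define H :: "real^2 \<Rightarrow> real^2" where
    "H v = (v $ 1) *\<^sub>R (x *\<^sub>R axis 1 1 + y *\<^sub>R axis 2 1) + (v $ 2) *\<^sub>R (y *\<^sub>R axis 1 1 + z *\<^sub>R axis 2 1)" for v
  have H: "linear H" "H v \<bullet> w = v \<bullet> H w" for v w
    by (auto simp: linear_iff H_def algebra_simps inner_vec_def sum_2 axis_def)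
  obtain g where g: "smooth_on UNIV g" "\<And>y. r \<le> dist (snd c b) y \<Longrightarrow> g y = 0"
    and g1: "\<And>v. fderiv g (snd c b) v = p \<bullet> v"
    and g2: "\<And>u v. fderiv (\<lambda>y. fderiv g y v) (snd c b) u = H u \<bullet> v"
    using smooth_function_with_jet[OF r(1) H, of "snd c b" p] by blast
  define f where "f b = (if b \<in> fst c then g (snd c b) else 0)" for b
  have f: "smooth_function B f"
    unfolding f_def[abs_def]
    by (rule smooth_function_extend_zero[OF B _ _ r(2) g(1)]) (use cc g(2) in auto)
  have fg: "(f \<circ> chart_inv c) y = g y" if "y \<in> chart_image c" for y
    using base.chart_inv_in[OF that] base.chart_chart_inv[OF that] by (simp add: f_def)
  have d1: "fderiv (f \<circ> chart_inv c) y = fderiv g y" if "y \<in> chart_image c" for y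
    by (rule fderiv_cong_open[OF op that]) (rule fg)
  have d2: "fderiv (\<lambda>y. fderiv (f \<circ> chart_inv c) y i) (snd c b) = fderiv (\<lambda>y. fderiv g y i) (snd c b)" for i
    by (rule fderiv_cong_open[OF op x]) (simp add: d1)
  have "covector_components B c b (differential B f b) = p"
    by (simp add: base.covector_components_differential[OF f c] d1[OF x] g1 euclidean_representation)
  then have "differential B f b = \<xi>"
    using base.coord_covector_components[OF base.differential_in[OF f b] c]
      base.coord_covector_components[OF \<xi> c] unfolding p_def by metis
  moreover have "section_jet f b v =
      (v $ 1) *\<^sub>R (e1 + x *\<^sub>R e3 + y *\<^sub>R e4) + (v $ 2) *\<^sub>R (e2 + y *\<^sub>R e3 + z *\<^sub>R e4)" for v
  proof -
    have "section_jet f b v = (v, H v)"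
      by (simp add: section_jet_def Let_def d2 g2 euclidean_representation flip: c_def)
    then show ?thesis
      by (auto intro!: phase_eqI simp: H_def axis_def)
  qed
  ultimately show ?thesis
    using f that by (simp add: differential_section_def)
qed

text \<open>An inclusion of equations suffices: the planes annihilated by \<alpha> already determine
  it up to a factor, as its Pfaffian is nonzero, and \<beta> annihilates them too.\<close>

lemma equation_determines_form:
  assumes B: "smooth_manifold B" and m: "m \<in> points (cotangent_bundle B)"
    and \<alpha>: "effective_at \<alpha> m" "Pf B \<alpha> m \<noteq> 0" and \<beta>: "effective_at \<beta> m"
    and eq: "monge_ampere_equation B \<alpha> \<subseteq> monge_ampere_equation B \<beta>"
  shows "\<exists>h. \<forall>X\<in>TM m. \<forall>Y\<in>TM m. \<beta> m X Y = h * \<alpha> m X Y"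
proof -
  obtain b \<xi> where mb: "m = (b, \<xi>)" by (cases m)
  have b: "b \<in> points B" and \<xi>: "\<xi> \<in> cotangent_space B b"
    using m by (auto simp: mb points_cotangent_bundle)
  let ?C = "cotangent_chart B (some_chart B b)"
  have C: "?C \<in> atM m"
    unfolding mb charts_at_cotangent_bundle using base.some_chart_in[OF b] \<xi> by blast
  note alt = local_form_alternating[OF effective_at_two_form[OF \<alpha>(1)] C]
    local_form_alternating[OF effective_at_two_form[OF \<beta>] C]
  have "\<exists>h. \<forall>u v. local_form ?C \<beta> m u v = h * local_form ?C \<alpha> m u v"
  proof (rule effective_form_proportional[OF alt(1) effective_local_form[OF \<alpha>(1) C] _ alt(2) effective_local_form[OF \<beta> C]])
    show "pfaff (local_form ?C \<alpha> m) \<noteq> 0"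
      using \<alpha>(2) by (simp add: Pf_eq_pfaff[OF effective_at_two_form[OF \<alpha>(1)] C])
    fix x y z
    assume 0: "local_form ?C \<alpha> m (e1 + x *\<^sub>R e3 + y *\<^sub>R e4) (e2 + y *\<^sub>R e3 + z *\<^sub>R e4) = 0"
    obtain f where f: "smooth_function B f" and fm: "differential_section B f b = (b, \<xi>)"
      and j: "\<And>v. section_jet f b v =
        (v $ 1) *\<^sub>R (e1 + x *\<^sub>R e3 + y *\<^sub>R e4) + (v $ 2) *\<^sub>R (e2 + y *\<^sub>R e3 + z *\<^sub>R e4)"
      using section_with_jet[OF B b \<xi>] by blast
    define U V where "U = e1 + x *\<^sub>R e3 + y *\<^sub>R e4" and "V = e2 + y *\<^sub>R e3 + z *\<^sub>R e4"
    have "local_form ?C \<alpha> m V U = - local_form ?C \<alpha> m U V"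
      by (rule alternating_formD(2)[OF alt(1)])
    then have "local_form ?C \<alpha> m (section_jet f b v) (section_jet f b w) = 0" for v w
      using 0 by (simp add: j alternating_form_linear[OF alt(1)] flip: U_def V_def)
    then have "(f, b) \<in> monge_ampere_equation B \<alpha>"
      using f b by (simp add: monge_ampere_equation_iff fm mb)
    then have "(f, b) \<in> monge_ampere_equation B \<beta>" using eq by blast
    \<comment> \<open>The jets of the two axis vectors are the two spanning vectors of the
      plane.\<close>
    then have "local_form ?C \<beta> m (section_jet f b (axis 1 1)) (section_jet f b (axis 2 1)) = 0"
      by (simp add: monge_ampere_equation_iff fm mb)
    then show "local_form ?C \<beta> m (e1 + x *\<^sub>R e3 + y *\<^sub>R e4) (e2 + y *\<^sub>R e3 + z *\<^sub>R e4) = 0"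
      by (simp add: j axis_def)
  qed
  then obtain h where "\<And>u v. local_form ?C \<beta> m u v = h * local_form ?C \<alpha> m u v" by blast
  then have "\<beta> m X Y = h * \<alpha> m X Y" if "X \<in> TM m" "Y \<in> TM m" for X Y
    using two_form_apply[OF that C, of \<alpha>] two_form_apply[OF that C, of \<beta>] by simp
  then show ?thesis by blast
qed

end

section \<open>The sign of the Pfaffian and normalization\<close>

lemma connected_sgn_eq:
  fixes G :: "'a::topological_space \<Rightarrow> real"
  assumes "connected S" "continuous_on S G" "\<And>x. x \<in> S \<Longrightarrow> G x \<noteq> 0" "x \<in> S" "y \<in> S"
  shows "sgn (G x) = sgn (G y)"
proof (rule ccontr)
  assume ne: "sgn (G x) \<noteq> sgn (G y)"
  have "connected (G ` S)" by (rule connected_continuous_image[OF assms(2,1)])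
  moreover have "G x \<in> G ` S" "G y \<in> G ` S" using assms(4,5) by auto
  moreover have "(G x \<le> 0 \<and> 0 \<le> G y) \<or> (G y \<le> 0 \<and> 0 \<le> G x)"
    using ne by (auto simp: sgn_if split: if_splits)
  ultimately have "0 \<in> G ` S" by (auto simp: connected_iff_interval)
  then show False using assms(3) by auto
qed

context smooth_surface
begin

lemma zero_covector_in: "(\<lambda>_. 0) \<in> cotangent_space B b"
  by (simp add: cotangent_space_def)

lemma coord_covector_0: "coord_covector B c b 0 = (\<lambda>_. 0)"
  by (simp add: coord_covector_def fun_eq_iff)

text \<open>Only the sign of \<open>g\<close> has to be represented by a continuous function in each
  chart; \<open>g\<close> itself may be discontinuous, as the factor between two forms is not known
  to be continuous. Signs are first compared with that at the zero covector of the same fibre, and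
  then along the connected base.\<close>

lemma sgn_constant:
  fixes g :: "'b phase \<Rightarrow> real"
  assumes B: "smooth_manifold B" and conn: "connected_space (manifold_topology B)"
    and ne: "points B \<noteq> {}"
    and nz: "\<And>m. m \<in> points (cotangent_bundle B) \<Longrightarrow> g m \<noteq> 0"
    and loc: "\<And>C. C \<in> cotangent_bundle B \<Longrightarrow>
      \<exists>G. continuous_on (chart_image C) G \<and> (\<forall>x\<in>chart_image C. sgn (G x) = sgn (g (chart_inv C x)))"
  shows "\<exists>s\<in>{1, -1}. \<forall>m\<in>points (cotangent_bundle B). sgn (g m) = s"
proof -
  let ?z = "\<lambda>_. 0 :: real"
  have G: "\<exists>G. continuous_on (chart_image c \<times> UNIV) G \<and>
      (\<forall>x\<in>chart_image c. \<forall>p. sgn (G (x, p)) = sgn (g (chart_inv c x, coord_covector B c (chart_inv c x) p)))"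
    if c: "c \<in> B" for c
  proof -
    have "cotangent_chart B c \<in> cotangent_bundle B" using c by (simp add: cotangent_bundle_def)
    from loc[OF this] show ?thesis
      unfolding chart_image_cotangent_chart[OF c]
      by (auto simp: chart_inv_cotangent_chart[OF c] Ball_def)
  qed
  have pt: "(b, \<xi>) \<in> points (cotangent_bundle B)" if "b \<in> points B" "\<xi> \<in> cotangent_space B b" for b \<xi>
    using that by (simp add: points_cotangent_bundle)
  \<comment> \<open>In a chart the fibre is a vector space, hence connected, and a nonvanishing
    continuous function has one sign on it.\<close>
  have fibre: "sgn (g (b, \<xi>)) = sgn (g (b, ?z))" if b: "b \<in> points B" and \<xi>: "\<xi> \<in> cotangent_space B b" for b \<xi>
  proof -
    define c where "c = some_chart B b"
    have c: "c \<in> charts_at B b" unfolding c_def by (rule base.some_chart_in[OF b])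
    note cc = base.charts_atD[OF c]
    have x: "snd c b \<in> chart_image c" using cc by (simp add: chart_image_def)
    have ci: "chart_inv c (snd c b) = b" using base.chart_inv_chart cc by blast
    obtain G where cont: "continuous_on (chart_image c \<times> UNIV) G"
      and "\<forall>x\<in>chart_image c. \<forall>p. sgn (G (x, p)) = sgn (g (chart_inv c x, coord_covector B c (chart_inv c x) p))"
      using G cc by blast
    then have Gb: "sgn (G (snd c b, p)) = sgn (g (b, coord_covector B c b p))" for p
      using x ci by auto
    have "sgn (G (snd c b, covector_components B c b \<xi>)) = sgn (G (snd c b, 0))"
    proof (rule connected_sgn_eq[where G = G and S = "{snd c b} \<times> UNIV"])
      show "connected ({snd c b} \<times> (UNIV :: (real^2) set))" by (intro connected_Times) auto
      show "continuous_on ({snd c b} \<times> UNIV) G"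
        by (rule continuous_on_subset[OF cont]) (use x in auto)
      show "G y \<noteq> 0" if y: "y \<in> {snd c b} \<times> UNIV" for y
      proof -
        obtain p where "y = (snd c b, p)" using y by auto
        then show ?thesis
          using Gb[of p] nz[OF pt[OF b base.coord_covector_in[OF c, of p]]] by (metis sgn_zero_iff)
      qed
    qed auto
    then show ?thesis
      by (simp add: Gb base.coord_covector_components[OF \<xi> c] coord_covector_0)
  qed
  \<comment> \<open>For \<sigma> equal to \<open>1\<close> and \<open>-1\<close> these are the base
    points with positive and with negative value on the zero section: two disjoint open sets that
    cover the base.\<close>
  define P where "P \<sigma> = {b \<in> points B. 0 < \<sigma> * g (b, ?z)}" for \<sigma>
  have openP: "openin (manifold_topology B) (P \<sigma>)" for \<sigma>
    unfolding openin_manifold_topology[OF B]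
  proof (intro conjI ballI)
    show "P \<sigma> \<subseteq> points B" by (auto simp: P_def)
    fix c assume c: "c \<in> B"
    obtain G where cont: "continuous_on (chart_image c \<times> UNIV) G"
      and G: "\<forall>x\<in>chart_image c. \<forall>p. sgn (G (x, p)) = sgn (g (chart_inv c x, coord_covector B c (chart_inv c x) p))"
      using G[OF c] by blast
    have G0: "sgn (G (x, 0)) = sgn (g (chart_inv c x, ?z))" if "x \<in> chart_image c" for x
      using G that by (simp add: coord_covector_0)
    have iff: "0 < \<sigma> * G (x, 0) \<longleftrightarrow> 0 < \<sigma> * g (chart_inv c x, ?z)" if "x \<in> chart_image c" for x
    proof -
      have "0 < \<sigma> * y \<longleftrightarrow> sgn \<sigma> * sgn y = 1" for y :: real
        using sgn_1_pos[of "\<sigma> * y"] by (simp add: sgn_mult)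
      then show ?thesis by (simp add: G0[OF that])
    qed
    have "continuous_on (chart_image c) (\<lambda>x. \<sigma> * G (x, 0))"
      by (intro continuous_on_mult continuous_on_const continuous_on_compose2[OF cont] continuous_intros) auto
    then have "open (chart_image c \<inter> (\<lambda>x. \<sigma> * G (x, 0)) -` {0<..})"
      by (rule continuous_open_preimage[OF _ base.chart_image_open[OF c]]) auto
    moreover have "snd c ` (P \<sigma> \<inter> fst c) = chart_image c \<inter> (\<lambda>x. \<sigma> * G (x, 0)) -` {0<..}"
    proof (intro equalityI subsetI)
      fix x assume "x \<in> snd c ` (P \<sigma> \<inter> fst c)"
      then obtain b where b: "x = snd c b" "b \<in> P \<sigma>" "b \<in> fst c" by blast
      then have x: "x \<in> chart_image c" by (simp add: chart_image_def)
      show "x \<in> chart_image c \<inter> (\<lambda>x. \<sigma> * G (x, 0)) -` {0<..}"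
        using b x iff[OF x] base.chart_inv_chart[OF c b(3)] by (simp add: P_def)
    next
      fix x assume x': "x \<in> chart_image c \<inter> (\<lambda>x. \<sigma> * G (x, 0)) -` {0<..}"
      then have x: "x \<in> chart_image c" by blast
      have "chart_inv c x \<in> P \<sigma> \<inter> fst c"
        using x' iff[OF x] base.chart_inv_in[OF x] c by (auto simp: P_def points_def)
      then have "snd c (chart_inv c x) \<in> snd c ` (P \<sigma> \<inter> fst c)" by blast
      then show "x \<in> snd c ` (P \<sigma> \<inter> fst c)" by (simp only: base.chart_chart_inv[OF x])
    qed
    ultimately show "open (snd c ` (P \<sigma> \<inter> fst c))" by simp
  qed
  have zz: "(b, ?z) \<in> points (cotangent_bundle B)" if "b \<in> points B" for b
    using pt[OF that zero_covector_in] .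
  have "points B \<subseteq> P 1 \<union> P (-1)" using nz[OF zz] by (auto simp: P_def not_less less_le)
  moreover have "P 1 \<inter> P (-1) = {}" by (auto simp: P_def)
  ultimately have "P 1 = {} \<or> P (-1) = {}"
    using conn openP[of 1] openP[of "-1"]
    unfolding connected_space_def topspace_manifold_topology[OF B] by blast
  then obtain s where s: "s \<in> {1, -1}" "P (- s) = {}" by force
  have "sgn (g (b, ?z)) = s" if b: "b \<in> points B" for b
  proof -
    have "\<not> 0 < - s * g (b, ?z)" using s(2) b by (auto simp: P_def)
    then show ?thesis using s(1) nz[OF zz[OF b]] by (auto simp: sgn_if)
  qed
  then have "\<forall>m\<in>points (cotangent_bundle B). sgn (g m) = s"
    using fibre by (auto simp: points_cotangent_bundle)
  then show ?thesis using s(1) by blast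
qed

section \<open>Normalizations and their uniqueness up to sign\<close>

lemma effective_at_structure:
  assumes "monge_ampere_structure B \<alpha>" "m \<in> points (cotangent_bundle B)"
  shows "effective_at \<alpha> m"
  using assms unfolding monge_ampere_structure_def smooth_two_form_def effective_at_def two_form_at_def
  by blast

lemma smooth_local_form:
  assumes "monge_ampere_structure B \<alpha>" "C \<in> cotangent_bundle B"
  shows "smooth_on (chart_image C) (\<lambda>x. local_form C \<alpha> (chart_inv C x) u v)"
  using assms unfolding monge_ampere_structure_def smooth_two_form_def Let_def local_form_def
  by blast

lemma smooth_Pf:
  assumes \<alpha>: "monge_ampere_structure B \<alpha>" and C: "C \<in> cotangent_bundle B"
  shows "smooth_on (chart_image C) (\<lambda>x. Pf B \<alpha> (chart_inv C x))"
proof -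
  have op: "open (chart_image C)" by (rule phase.chart_image_open[OF C])
  let ?a = "\<lambda>x. local_form C \<alpha> (chart_inv C x)"
  have "smooth_on (chart_image C) (\<lambda>x. - (?a x e1 e2 * ?a x e3 e4 + - (?a x e1 e3 * ?a x e2 e4) + ?a x e1 e4 * ?a x e2 e3))"
    by (intro smooth_on_minus[OF op] smooth_on_add[OF op] smooth_on_mult[OF op] smooth_local_form[OF \<alpha> C])
  then show ?thesis
  proof (rule smooth_on_cong[OF op])
    fix x assume "x \<in> chart_image C"
    then have at: "C \<in> atM (chart_inv C x)" by (rule phase.chart_inv_charts_at[OF C])
    show "- (?a x e1 e2 * ?a x e3 e4 + - (?a x e1 e3 * ?a x e2 e4) + ?a x e1 e4 * ?a x e2 e3) = Pf B \<alpha> (chart_inv C x)"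
      using effective_at_two_form[OF effective_at_structure[OF \<alpha> phase.charts_at_imp_points[OF at]]]
      by (simp add: Pf_eq_pfaff[OF _ at] pfaff_def)
  qed
qed

lemma normalized_normalization:
  assumes \<alpha>: "monge_ampere_structure B \<alpha>"
    and nz: "\<And>m. m \<in> points (cotangent_bundle B) \<Longrightarrow> Pf B \<alpha> m \<noteq> 0"
    and s: "\<And>m. m \<in> points (cotangent_bundle B) \<Longrightarrow> sgn (Pf B \<alpha> m) = s"
  shows "normalized_structure s (normalization B \<alpha>)"
  unfolding normalized_structure_def
proof (intro conjI ballI allI)
  fix m assume m: "m \<in> points (cotangent_bundle B)"
  show "effective_at (normalization B \<alpha>) m"
    by (rule effective_at_scale[where r = "\<bar>Pf B \<alpha> m\<bar> powr (-1/2)", OF m effective_at_structure[OF \<alpha> m]])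
      (simp add: normalization_def)
  \<comment> \<open>The Pfaffian is quadratic in the form, so the exponent \<open>-1/2\<close>
    becomes \<open>-1\<close> and leaves just the sign.\<close>
  have "(\<bar>Pf B \<alpha> m\<bar> powr (-1/2))\<^sup>2 = \<bar>Pf B \<alpha> m\<bar> powr (-1)"
    using nz[OF m] by (simp add: powr_power)
  also have "\<dots> = 1 / \<bar>Pf B \<alpha> m\<bar>" using nz[OF m] by (simp add: powr_minus_divide)
  finally have "Pf B (normalization B \<alpha>) m = 1 / \<bar>Pf B \<alpha> m\<bar> * Pf B \<alpha> m"
    using Pf_scale[where \<tau> = "normalization B \<alpha>" and r = "\<bar>Pf B \<alpha> m\<bar> powr (-1/2)", OF m effective_at_structure[OF \<alpha> m]]
    by (simp add: normalization_def)
  also have "\<dots> = s" using nz[OF m] s[OF m] by (auto simp: sgn_if split: if_splits)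
  finally show "Pf B (normalization B \<alpha>) m = s" .
next
  fix C u v assume C: "C \<in> cotangent_bundle B"
  have op: "open (chart_image C)" by (rule phase.chart_image_open[OF C])
  have pos: "s * Pf B \<alpha> (chart_inv C x) = \<bar>Pf B \<alpha> (chart_inv C x)\<bar>" "\<bar>Pf B \<alpha> (chart_inv C x)\<bar> > 0"
    if "x \<in> chart_image C" for x
  proof -
    have m: "chart_inv C x \<in> points (cotangent_bundle B)"
      by (rule phase.charts_at_imp_points[OF phase.chart_inv_charts_at[OF C that]])
    show "s * Pf B \<alpha> (chart_inv C x) = \<bar>Pf B \<alpha> (chart_inv C x)\<bar>" "\<bar>Pf B \<alpha> (chart_inv C x)\<bar> > 0"
      using nz[OF m] s[OF m] by (auto simp: sgn_if abs_if split: if_splits)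
  qed
  \<comment> \<open>The absolute value is replaced by multiplication with the constant sign:
    \<open>s * Pf\<close> is visibly smooth and positive, so the power can be composed with
    it.\<close>
  have "smooth_on (chart_image C) (\<lambda>x. (s * Pf B \<alpha> (chart_inv C x)) powr (-1/2))"
  proof (rule smooth_on_compose[where g = "\<lambda>t. t powr (-1/2)" and T = "{0<..}", OF op open_greaterThan])
    show "smooth_on (chart_image C) (\<lambda>x. s * Pf B \<alpha> (chart_inv C x))"
      by (intro smooth_on_mult[OF op] smooth_on_const smooth_Pf[OF \<alpha> C])
    show "smooth_on {0<..} (\<lambda>t::real. t powr (-1/2))" by (rule smooth_on_powr)
  qed (use pos in auto)
  from smooth_on_mult[OF op this smooth_local_form[OF \<alpha> C, of u v]]
  show "smooth_on (chart_image C) (\<lambda>x. local_form C (normalization B \<alpha>) (chart_inv C x) u v)"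
    by (rule smooth_on_cong[OF op]) (simp add: pos local_form_def normalization_def)
qed

lemma points_cotangent_bundle_nonempty: "points B \<noteq> {} \<Longrightarrow> points (cotangent_bundle B) \<noteq> {}"
  using zero_covector_in unfolding points_cotangent_bundle by blast

lemma sgn_Pf_constant:
  assumes B: "smooth_manifold B" "points B \<noteq> {}" "connected_space (manifold_topology B)"
    and \<alpha>: "monge_ampere_structure B \<alpha>"
    and nz: "\<And>m. m \<in> points (cotangent_bundle B) \<Longrightarrow> Pf B \<alpha> m \<noteq> 0"
  shows "\<exists>s\<in>{1, -1}. \<forall>m\<in>points (cotangent_bundle B). sgn (Pf B \<alpha> m) = s"
proof (rule sgn_constant[OF B(1,3,2) nz])
  fix C assume C: "C \<in> cotangent_bundle B"
  show "\<exists>G. continuous_on (chart_image C) G \<and>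
      (\<forall>x\<in>chart_image C. sgn (G x) = sgn (Pf B \<alpha> (chart_inv C x)))"
    using smooth_on_continuous[OF smooth_Pf[OF \<alpha> C]] by blast
qed

text \<open>The Euclidean product of the coefficient vectors. Evaluated at \<alpha> and a multiple
  of \<alpha>, it gives the factor times a positive number.\<close>

definition form_inner ::
    "(phase_coords \<Rightarrow> phase_coords \<Rightarrow> real) \<Rightarrow> (phase_coords \<Rightarrow> phase_coords \<Rightarrow> real) \<Rightarrow> real" where
  "form_inner a b = a e1 e2 * b e1 e2 + a e1 e3 * b e1 e3 + a e1 e4 * b e1 e4
     + a e2 e3 * b e2 e3 + a e2 e4 * b e2 e4 + a e3 e4 * b e3 e4"

lemma form_inner_pos:
  assumes "pfaff a \<noteq> 0"
  shows "form_inner a a > 0"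
proof -
  have "form_inner a a \<ge> 0" by (simp add: form_inner_def)
  moreover have "form_inner a a \<noteq> 0"
  proof
    assume "form_inner a a = 0"
    then have "a e1 e2 = 0 \<and> a e1 e3 = 0 \<and> a e1 e4 = 0"
      unfolding form_inner_def by (smt (verit) mult_eq_0_iff zero_le_square)
    then show False using assms by (simp add: pfaff_def)
  qed
  ultimately show ?thesis by linarith
qed

lemma normalization_unique:
  assumes B: "smooth_manifold B" "points B \<noteq> {}" "connected_space (manifold_topology B)"
    and \<alpha>: "nondegenerate_structure B \<alpha>" and \<beta>: "nondegenerate_structure B \<beta>"
    and eq: "monge_ampere_equation B \<beta> = monge_ampere_equation B \<alpha>"
  obtains \<sigma> where "\<sigma> \<in> {1, -1}" "\<And>m. m \<in> points (cotangent_bundle B) \<Longrightarrow> sgn (Pf B \<beta> m) = sgn (Pf B \<alpha> m)"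
    "\<And>m X Y. m \<in> points (cotangent_bundle B) \<Longrightarrow> X \<in> TM m \<Longrightarrow> Y \<in> TM m \<Longrightarrow>
      normalization B \<beta> m X Y = \<sigma> * normalization B \<alpha> m X Y"
proof -
  have \<alpha>1: "monge_ampere_structure B \<alpha>" and \<alpha>2: "\<And>m. m \<in> points (cotangent_bundle B) \<Longrightarrow> Pf B \<alpha> m \<noteq> 0"
    and \<beta>1: "monge_ampere_structure B \<beta>" and \<beta>2: "\<And>m. m \<in> points (cotangent_bundle B) \<Longrightarrow> Pf B \<beta> m \<noteq> 0"
    using \<alpha> \<beta> by (auto simp: nondegenerate_structure_def)
  have "\<forall>m\<in>points (cotangent_bundle B). \<exists>h. \<forall>X\<in>TM m. \<forall>Y\<in>TM m. \<beta> m X Y = h * \<alpha> m X Y"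
    using equation_determines_form[OF B(1) _ effective_at_structure[OF \<alpha>1] \<alpha>2 effective_at_structure[OF \<beta>1]] eq
    by blast
  then obtain h where h: "\<And>m X Y. m \<in> points (cotangent_bundle B) \<Longrightarrow> X \<in> TM m \<Longrightarrow> Y \<in> TM m \<Longrightarrow>
      \<beta> m X Y = h m * \<alpha> m X Y" by metis
  have Pf: "Pf B \<beta> m = (h m)\<^sup>2 * Pf B \<alpha> m" if "m \<in> points (cotangent_bundle B)" for m
    by (rule Pf_scale[where \<tau> = \<beta> and r = "h m", OF that effective_at_structure[OF \<alpha>1 that] h[OF that]])
  have h0: "h m \<noteq> 0" if "m \<in> points (cotangent_bundle B)" for m
    using Pf[OF that] \<beta>2[OF that] by auto
  have "\<exists>\<sigma>\<in>{1, -1}. \<forall>m\<in>points (cotangent_bundle B). sgn (h m) = \<sigma>"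
  proof (rule sgn_constant[OF B(1,3,2) h0])
    fix C assume C: "C \<in> cotangent_bundle B"
    have op: "open (chart_image C)" by (rule phase.chart_image_open[OF C])
    \<comment> \<open>\<open>h\<close> was chosen pointwise; \<open>?G\<close> is the smooth
      function that shares its sign.\<close>
    let ?G = "\<lambda>x. form_inner (local_form C \<alpha> (chart_inv C x)) (local_form C \<beta> (chart_inv C x))"
    have "smooth_on (chart_image C) ?G"
      unfolding form_inner_def
      by (intro smooth_on_add[OF op] smooth_on_mult[OF op] smooth_local_form[OF \<alpha>1 C] smooth_local_form[OF \<beta>1 C])
    then have "continuous_on (chart_image C) ?G" by (rule smooth_on_continuous)
    moreover have "sgn (?G x) = sgn (h (chart_inv C x))" if x: "x \<in> chart_image C" for x
    proof -
      have at: "C \<in> atM (chart_inv C x)" by (rule phase.chart_inv_charts_at[OF C x])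
      note m = phase.charts_at_imp_points[OF at]
      have "local_form C \<beta> (chart_inv C x) u v = h (chart_inv C x) * local_form C \<alpha> (chart_inv C x) u v" for u v
        by (rule local_form_scale[where \<sigma> = \<alpha> and \<tau> = \<beta> and r = "h (chart_inv C x)", OF at h[OF m]])
      then have "?G x = h (chart_inv C x) * form_inner (local_form C \<alpha> (chart_inv C x)) (local_form C \<alpha> (chart_inv C x))"
        by (simp add: form_inner_def algebra_simps)
      moreover have "form_inner (local_form C \<alpha> (chart_inv C x)) (local_form C \<alpha> (chart_inv C x)) > 0"
        using \<alpha>2[OF m] effective_at_two_form[OF effective_at_structure[OF \<alpha>1 m]]
        by (intro form_inner_pos) (simp add: Pf_eq_pfaff[OF _ at])
      ultimately show ?thesis by (simp add: sgn_mult)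
    qed
    ultimately show "\<exists>G. continuous_on (chart_image C) G \<and>
      (\<forall>x\<in>chart_image C. sgn (G x) = sgn (h (chart_inv C x)))" by blast
  qed
  then obtain \<sigma> where \<sigma>: "\<sigma> \<in> {1, -1}" "\<And>m. m \<in> points (cotangent_bundle B) \<Longrightarrow> sgn (h m) = \<sigma>" by blast
  have "normalization B \<beta> m X Y = \<sigma> * normalization B \<alpha> m X Y"
    if m: "m \<in> points (cotangent_bundle B)" and X: "X \<in> TM m" "Y \<in> TM m" for m X Y
  proof -
    have "\<bar>Pf B \<beta> m\<bar> powr (-1/2) = ((h m)\<^sup>2) powr (-1/2) * \<bar>Pf B \<alpha> m\<bar> powr (-1/2)"
      by (simp add: Pf[OF m] abs_mult powr_mult)
    also have "((h m)\<^sup>2) powr (-1/2) = 1 / \<bar>h m\<bar>"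
    proof -
      have "(h m)\<^sup>2 = \<bar>h m\<bar> powr 2" using h0[OF m] by simp
      then have "((h m)\<^sup>2) powr (-1/2) = (\<bar>h m\<bar> powr 2) powr (-1/2)" by (simp only:)
      also have "\<dots> = \<bar>h m\<bar> powr (-1)" by (subst powr_powr) simp
      also have "\<dots> = 1 / \<bar>h m\<bar>" using h0[OF m] by (simp add: powr_minus_divide)
      finally show ?thesis .
    qed
    finally have "normalization B \<beta> m X Y = (h m / \<bar>h m\<bar>) * normalization B \<alpha> m X Y"
      by (simp add: normalization_def h[OF m X])
    also have "h m / \<bar>h m\<bar> = \<sigma>" using \<sigma>(2)[OF m] by (simp add: sgn_real_def split: if_splits)
    finally show ?thesis .
  qed
  moreover have "sgn (Pf B \<beta> m) = sgn (Pf B \<alpha> m)" if "m \<in> points (cotangent_bundle B)" for m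
    using Pf[OF that] h0[OF that] by (simp add: sgn_if zero_less_mult_iff)
  ultimately show ?thesis using that \<sigma>(1) by blast
qed

text \<open>With constant sign of the Pfaffian the conditions at all points are the same one; a
  nonempty base guarantees that it is imposed at all.\<close>

lemma quadric_eq:
  assumes "normalized_structure s \<beta>" "s \<in> {1, -1}" "points B \<noteq> {}"
  shows "(a\<^sub>1, a\<^sub>2, a\<^sub>3) \<in> quadric B \<beta> k \<epsilon>\<^sub>2 \<epsilon>\<^sub>3 \<longleftrightarrow> - s * a\<^sub>1\<^sup>2 + \<epsilon>\<^sub>2 * a\<^sub>2\<^sup>2 + \<epsilon>\<^sub>3 * a\<^sub>3\<^sup>2 = k"
proof -
  have "sgn (Pf B \<beta> m) = s" if "m \<in> points (cotangent_bundle B)" for m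
    using assms(1,2) that by (auto simp: normalized_structure_def)
  then show ?thesis
    using points_cotangent_bundle_nonempty[OF assms(3)] by (auto simp: quadric_def)
qed

text \<open>Being a generalized almost structure gives a scalar square with some unspecified sign.
  This removes the cross term, and then the quadric identifies the sign as \<open>k\<close>;
  skewness supplies the matching \<open>- k\<close>.\<close>

lemma quadric_endo_generalized_iff:
  assumes \<beta>: "normalized_structure s \<beta>" and s: "s \<in> {1, -1}" and ne: "points B \<noteq> {}"
    and k: "k \<in> {1, -1}" and a: "(a\<^sub>1, a\<^sub>2, a\<^sub>3) \<in> quadric B \<beta> k \<epsilon>\<^sub>2 \<epsilon>\<^sub>3"
  defines "A \<equiv> quadric_endo B \<beta> \<epsilon>\<^sub>2 \<epsilon>\<^sub>3 (a\<^sub>1, a\<^sub>2, a\<^sub>3)"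
  shows "generalized_almost_structure (cotangent_bundle B) A \<longleftrightarrow> a\<^sub>2 * a\<^sub>3 = 0 \<or> \<epsilon>\<^sub>2 = s * \<epsilon>\<^sub>3"
    and "generalized_almost_structure (cotangent_bundle B) A \<Longrightarrow> almost_structure k (- k) (cotangent_bundle B) A"
proof -
  have s': "\<bar>s\<bar> = 1" using s by auto
  have q: "- s * a\<^sub>1\<^sup>2 + \<epsilon>\<^sub>2 * a\<^sub>2\<^sup>2 + \<epsilon>\<^sub>3 * a\<^sub>3\<^sup>2 = k"
    using a unfolding quadric_eq[OF \<beta> s ne] .
  have \<mu>: "a\<^sub>2 * a\<^sub>3 * (\<epsilon>\<^sub>2 - s * \<epsilon>\<^sub>3) = 0" if A: "generalized_almost_structure (cotangent_bundle B) A"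
  proof -
    obtain m where m: "m \<in> points (cotangent_bundle B)"
      using points_cotangent_bundle_nonempty[OF ne] by blast
    obtain \<gamma> where "\<And>z. z \<in> big_tangent_space (cotangent_bundle B) m \<Longrightarrow> A m (A m z) = big_smul \<gamma> z"
      using A m unfolding generalized_almost_structure_def almost_structure_def by blast
    then show ?thesis
      unfolding A_def by (rule quadric_endo_square_scalar[OF \<beta> s' phase.some_chart_in[OF m]])
  qed
  have almost: "almost_structure k (- k) (cotangent_bundle B) A" if "a\<^sub>2 * a\<^sub>3 * (\<epsilon>\<^sub>2 - s * \<epsilon>\<^sub>3) = 0"
    unfolding A_def by (rule almost_structure_quadric_endo[OF \<beta> s' q that])
  then have gen: "generalized_almost_structure (cotangent_bundle B) A" if "a\<^sub>2 * a\<^sub>3 * (\<epsilon>\<^sub>2 - s * \<epsilon>\<^sub>3) = 0"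
    using that k unfolding generalized_almost_structure_def by fastforce
  show "generalized_almost_structure (cotangent_bundle B) A \<longleftrightarrow> a\<^sub>2 * a\<^sub>3 = 0 \<or> \<epsilon>\<^sub>2 = s * \<epsilon>\<^sub>3"
    using \<mu> gen by auto
  show "generalized_almost_structure (cotangent_bundle B) A \<Longrightarrow> almost_structure k (- k) (cotangent_bundle B) A"
    using \<mu> almost by blast
qed

lemma quadric_familyE:
  assumes "J \<in> quadric_family B \<beta>"
  obtains k \<epsilon>\<^sub>2 \<epsilon>\<^sub>3 a\<^sub>1 a\<^sub>2 a\<^sub>3 where "generalized_almost_structure (cotangent_bundle B) J"
    "k \<in> {1, -1}" "\<epsilon>\<^sub>2 \<in> {1, -1}" "\<epsilon>\<^sub>3 \<in> {1, -1}" "(a\<^sub>1, a\<^sub>2, a\<^sub>3) \<in> quadric B \<beta> k \<epsilon>\<^sub>2 \<epsilon>\<^sub>3"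
    "J = quadric_endo B \<beta> \<epsilon>\<^sub>2 \<epsilon>\<^sub>3 (a\<^sub>1, a\<^sub>2, a\<^sub>3)"
proof -
  obtain k \<epsilon>\<^sub>2 \<epsilon>\<^sub>3 a where "generalized_almost_structure (cotangent_bundle B) J"
    "k \<in> {1, -1}" "\<epsilon>\<^sub>2 \<in> {1, -1}" "\<epsilon>\<^sub>3 \<in> {1, -1}" "a \<in> quadric B \<beta> k \<epsilon>\<^sub>2 \<epsilon>\<^sub>3"
    "J = quadric_endo B \<beta> \<epsilon>\<^sub>2 \<epsilon>\<^sub>3 a"
    using assms unfolding quadric_family_def mem_Collect_eq by (elim conjE bexE)
  then show ?thesis by (cases a) (simp only: that)
qed

text \<open>The quadrics involve only the squares of the parameters, so the point corrected by
  \<sigma> lies on the same quadric. Exchanging the two forms gives the other inclusion, since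
  \<sigma> is its own inverse.\<close>

lemma quadric_family_subset_sign:
  assumes \<beta>: "normalized_structure s \<beta>" and s: "s \<in> {1, -1}" and \<beta>': "normalized_structure s \<beta>'"
    and ne: "points B \<noteq> {}" and \<sigma>: "\<sigma> \<in> {1, -1}"
    and eq: "\<And>m X Y. m \<in> points (cotangent_bundle B) \<Longrightarrow> X \<in> TM m \<Longrightarrow> Y \<in> TM m \<Longrightarrow> \<beta>' m X Y = \<sigma> * \<beta> m X Y"
  shows "quadric_family B \<beta>' \<subseteq> quadric_family B \<beta>"
proof
  have s': "\<bar>s\<bar> = 1" using s by auto
  have \<sigma>2: "(\<sigma> * x)\<^sup>2 = x\<^sup>2" for x using \<sigma> by auto
  fix J assume "J \<in> quadric_family B \<beta>'"
  then obtain k \<epsilon>\<^sub>2 \<epsilon>\<^sub>3 a\<^sub>1 a\<^sub>2 a\<^sub>3 where J: "generalized_almost_structure (cotangent_bundle B) J"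
    "k \<in> {1, -1}" "\<epsilon>\<^sub>2 \<in> {1, -1}" "\<epsilon>\<^sub>3 \<in> {1, -1}" and q: "(a\<^sub>1, a\<^sub>2, a\<^sub>3) \<in> quadric B \<beta>' k \<epsilon>\<^sub>2 \<epsilon>\<^sub>3"
    and Ja: "J = quadric_endo B \<beta>' \<epsilon>\<^sub>2 \<epsilon>\<^sub>3 (a\<^sub>1, a\<^sub>2, a\<^sub>3)"
    by (rule quadric_familyE)
  have "J = quadric_endo B \<beta> \<epsilon>\<^sub>2 \<epsilon>\<^sub>3 (\<sigma> * a\<^sub>1, \<sigma> * a\<^sub>2, a\<^sub>3)"
    unfolding Ja by (rule quadric_endo_sign[OF \<beta> s' \<beta>' eq])
  moreover have "(\<sigma> * a\<^sub>1, \<sigma> * a\<^sub>2, a\<^sub>3) \<in> quadric B \<beta> k \<epsilon>\<^sub>2 \<epsilon>\<^sub>3"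
    using q unfolding quadric_eq[OF \<beta> s ne] quadric_eq[OF \<beta>' s ne] by (simp add: \<sigma>2)
  ultimately show "J \<in> quadric_family B \<beta>"
    using J unfolding quadric_family_def by blast
qed

end


section \<open>The types of the quadrics\<close>

definition signed_quadric :: "real \<Rightarrow> real \<Rightarrow> real \<Rightarrow> real \<Rightarrow> (real \<times> real \<times> real) set" where
  "signed_quadric \<sigma>\<^sub>1 \<sigma>\<^sub>2 \<sigma>\<^sub>3 k = {(x, y, z). \<sigma>\<^sub>1 * x\<^sup>2 + \<sigma>\<^sub>2 * y\<^sup>2 + \<sigma>\<^sub>3 * z\<^sup>2 = k}"

text \<open>\<open>has_type\<close> expects the odd sign at the last coordinate; these permutations
  bring it there from any of the three positions.\<close>

lemma orthogonal_transformation_permute: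
  "orthogonal_transformation (\<lambda>(x, y, z). (x, y, z) :: real \<times> real \<times> real)"
  "orthogonal_transformation (\<lambda>(x, y, z). (x, z, y) :: real \<times> real \<times> real)"
  "orthogonal_transformation (\<lambda>(x, y, z). (z, x, y) :: real \<times> real \<times> real)"
  by (auto simp: orthogonal_transformation_def linear_iff)

lemma signed_quadric_image:
  "signed_quadric 1 1 (-1) k = (\<lambda>(x, y, z). (x, y, z)) ` {(x, y, z). 1 * x\<^sup>2 + 1 * y\<^sup>2 - 1 * z\<^sup>2 = k}"
  "signed_quadric 1 (-1) 1 k = (\<lambda>(x, y, z). (x, z, y)) ` {(x, y, z). 1 * x\<^sup>2 + 1 * y\<^sup>2 - 1 * z\<^sup>2 = k}"
  "signed_quadric (-1) 1 1 k = (\<lambda>(x, y, z). (z, x, y)) ` {(x, y, z). 1 * x\<^sup>2 + 1 * y\<^sup>2 - 1 * z\<^sup>2 = k}"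
  by (force simp: signed_quadric_def image_iff)+

lemma signed_quadric_sheets:
  assumes "(\<sigma>\<^sub>1, \<sigma>\<^sub>2, \<sigma>\<^sub>3) \<in> {(1, 1, -1), (1, -1, 1), (-1, 1, 1)}"
  shows "has_type (signed_quadric \<sigma>\<^sub>1 \<sigma>\<^sub>2 \<sigma>\<^sub>3 1) One_Sheeted" "has_type (signed_quadric \<sigma>\<^sub>1 \<sigma>\<^sub>2 \<sigma>\<^sub>3 (-1)) Two_Sheeted"
proof -
  obtain f where f: "orthogonal_transformation f"
    "\<And>k. signed_quadric \<sigma>\<^sub>1 \<sigma>\<^sub>2 \<sigma>\<^sub>3 k = f ` {(x, y, z). 1 * x\<^sup>2 + 1 * y\<^sup>2 - 1 * z\<^sup>2 = k}"
    using assms orthogonal_transformation_permute signed_quadric_image by auto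
  show "has_type (signed_quadric \<sigma>\<^sub>1 \<sigma>\<^sub>2 \<sigma>\<^sub>3 1) One_Sheeted" "has_type (signed_quadric \<sigma>\<^sub>1 \<sigma>\<^sub>2 \<sigma>\<^sub>3 (-1)) Two_Sheeted"
    unfolding has_type.simps using f zero_less_one by blast+
qed

lemma signed_quadric_sphere: "has_type (signed_quadric 1 1 1 1) Sphere"
proof -
  have "signed_quadric 1 1 1 1 = sphere (0, 0, 0) 1"
    by (auto simp: signed_quadric_def sphere_def dist_norm norm_Pair real_sqrt_eq_1_iff)
  then show ?thesis by (metis has_type.simps(2) zero_less_one)
qed

lemma signed_quadric_empty: "has_type (signed_quadric (-1) (-1) (-1) 1) Empty"
proof -
  have "- x\<^sup>2 - y\<^sup>2 - z\<^sup>2 \<noteq> 1" for x y z :: real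
    using zero_le_power2[of x] zero_le_power2[of y] zero_le_power2[of z] by linarith
  then show ?thesis by (auto simp: signed_quadric_def)
qed

lemma signed_quadric_minus: "signed_quadric \<sigma>\<^sub>1 \<sigma>\<^sub>2 \<sigma>\<^sub>3 (-1) = signed_quadric (- \<sigma>\<^sub>1) (- \<sigma>\<^sub>2) (- \<sigma>\<^sub>3) 1"
proof -
  have "\<sigma>\<^sub>1 * x\<^sup>2 + \<sigma>\<^sub>2 * y\<^sup>2 + \<sigma>\<^sub>3 * z\<^sup>2 = -1 \<longleftrightarrow> - \<sigma>\<^sub>1 * x\<^sup>2 + - \<sigma>\<^sub>2 * y\<^sup>2 + - \<sigma>\<^sub>3 * z\<^sup>2 = 1" for x y z
    by (simp, linarith)
  then show ?thesis by (simp only: signed_quadric_def)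
qed

text \<open>Changing all signs reduces \<open>k = -1\<close> to \<open>k = 1\<close>. There the type
  depends only on the number of negative coefficients: none gives a sphere, one a one-sheeted and
  two a two-sheeted hyperboloid, three the empty set.\<close>

lemma signed_quadric_listed_type:
  assumes "s \<in> {1, -1}" "k \<in> {1, -1}" "\<epsilon>\<^sub>2 \<in> {1, -1}" "\<epsilon>\<^sub>3 \<in> {1, -1}"
  shows "has_type (signed_quadric (- s) \<epsilon>\<^sub>2 \<epsilon>\<^sub>3 k) (listed_type s k \<epsilon>\<^sub>2 \<epsilon>\<^sub>3)"
proof -
  have 1: "has_type (signed_quadric 1 1 (-1) 1) One_Sheeted"
    "has_type (signed_quadric 1 (-1) 1 1) One_Sheeted"
    "has_type (signed_quadric (-1) 1 1 1) One_Sheeted"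
    by (rule signed_quadric_sheets(1); simp)+
  have 2: "has_type (signed_quadric (-1) (-1) 1 1) Two_Sheeted"
    "has_type (signed_quadric (-1) 1 (-1) 1) Two_Sheeted"
    "has_type (signed_quadric 1 (-1) (-1) 1) Two_Sheeted"
    using signed_quadric_sheets(2)[of 1 1 "-1"] signed_quadric_sheets(2)[of 1 "-1" 1]
      signed_quadric_sheets(2)[of "-1" 1 1]
    by (simp_all only: signed_quadric_minus minus_minus insert_iff simp_thms)
  show ?thesis
    using assms
    by (elim insertE emptyE;
        simp add: 1 2 signed_quadric_sphere signed_quadric_empty signed_quadric_minus listed_type_def
          del: has_type.simps)
qed

theorem theorem3p2:
  fixes B :: "'b surface" and \<alpha> :: "('b phase, phase_coords) two_form"
  assumes "smooth_manifold B"
    and "points B \<noteq> {}" and "connected_space (manifold_topology B)"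
    and "monge_ampere_structure B \<alpha>"
    and "\<And>m. m \<in> points (cotangent_bundle B) \<Longrightarrow> Pf B \<alpha> m \<noteq> 0"
  shows "(\<exists>!F. \<exists>\<beta>. nondegenerate_structure B \<beta> \<and>
             monge_ampere_equation B \<beta> = monge_ampere_equation B \<alpha> \<and>
             F = quadric_family B (normalization B \<beta>)) \<and>
    {J. associated_geometry B (monge_ampere_equation B \<alpha>) J} =
       quadric_family B (normalization B \<alpha>) \<and>
    (\<forall>J\<in>quadric_family B (normalization B \<alpha>).
       GaPC (cotangent_bundle B) J \<or> GaC (cotangent_bundle B) J) \<and>
    (\<exists>s\<in>{1, -1}. (\<forall>m\<in>points (cotangent_bundle B). sgn (Pf B (normalization B \<alpha>) m) = s) \<and>
       (\<forall>k\<in>{1, -1}. \<forall>\<epsilon>\<^sub>2\<in>{1, -1}. \<forall>\<epsilon>\<^sub>3\<in>{1, -1}.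
          has_type (quadric B (normalization B \<alpha>) k \<epsilon>\<^sub>2 \<epsilon>\<^sub>3) (listed_type s k \<epsilon>\<^sub>2 \<epsilon>\<^sub>3) \<and>
          inj_on (quadric_endo B (normalization B \<alpha>) \<epsilon>\<^sub>2 \<epsilon>\<^sub>3)
            (quadric B (normalization B \<alpha>) k \<epsilon>\<^sub>2 \<epsilon>\<^sub>3) \<and>
          (\<forall>(a\<^sub>1, a\<^sub>2, a\<^sub>3)\<in>quadric B (normalization B \<alpha>) k \<epsilon>\<^sub>2 \<epsilon>\<^sub>3.
             let A = quadric_endo B (normalization B \<alpha>) \<epsilon>\<^sub>2 \<epsilon>\<^sub>3 (a\<^sub>1, a\<^sub>2, a\<^sub>3)
             in (A \<in> quadric_family B (normalization B \<alpha>) \<longleftrightarrow> a\<^sub>2 * a\<^sub>3 = 0 \<or> \<epsilon>\<^sub>2 = s * \<epsilon>\<^sub>3) \<and>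
                (A \<in> quadric_family B (normalization B \<alpha>) \<longrightarrow>
                   (k = 1 \<longrightarrow> GaPC (cotangent_bundle B) A) \<and>
                   (k = -1 \<longrightarrow> GaC (cotangent_bundle B) A)))))"
proof -
  interpret smooth_surface B
    using smooth_manifold_imp_smooth_atlas[OF assms(1)] by (simp add: smooth_surface_def)
  have nd: "nondegenerate_structure B \<alpha>" using assms(4,5) by (simp add: nondegenerate_structure_def)
  obtain s where s: "s \<in> {1, -1}" and sPf: "\<And>m. m \<in> points (cotangent_bundle B) \<Longrightarrow> sgn (Pf B \<alpha> m) = s"
    using sgn_Pf_constant[OF assms] by blast
  have s': "\<bar>s\<bar> = 1" using s by auto
  let ?n = "normalization B \<alpha>"
  have n: "normalized_structure s ?n" by (rule normalized_normalization[OF assms(4,5) sPf])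
  \<comment> \<open>Every structure with the same equation has the same family, so the family
    belongs to the equation; both uniqueness and the description of all associated geometries follow
    from this.\<close>
  have fam: "quadric_family B (normalization B \<beta>) = quadric_family B ?n"
    if \<beta>: "nondegenerate_structure B \<beta>" and eq: "monge_ampere_equation B \<beta> = monge_ampere_equation B \<alpha>" for \<beta>
  proof -
    obtain \<sigma> where \<sigma>: "\<sigma> \<in> {1, -1}"
      and sg: "\<And>m. m \<in> points (cotangent_bundle B) \<Longrightarrow> sgn (Pf B \<beta> m) = sgn (Pf B \<alpha> m)"
      and nb: "\<And>m X Y. m \<in> points (cotangent_bundle B) \<Longrightarrow> X \<in> TM m \<Longrightarrow> Y \<in> TM m \<Longrightarrow>
        normalization B \<beta> m X Y = \<sigma> * ?n m X Y"
      using normalization_unique[OF assms(1-3) nd \<beta> eq] by blast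
    have n': "normalized_structure s (normalization B \<beta>)"
      by (rule normalized_normalization) (use \<beta> sg sPf in \<open>auto simp: nondegenerate_structure_def\<close>)
    have nb': "?n m X Y = \<sigma> * normalization B \<beta> m X Y"
      if "m \<in> points (cotangent_bundle B)" "X \<in> TM m" "Y \<in> TM m" for m X Y
      using nb[OF that] \<sigma> by auto
    show ?thesis
      using quadric_family_subset_sign[OF n s n' assms(2) \<sigma> nb]
        quadric_family_subset_sign[OF n' s n assms(2) \<sigma> nb'] by blast
  qed
  \<comment> \<open>For a point known to lie on a quadric, membership in the family leaves only the
    requirement of being a generalized almost structure, even though the family quantifies over all
    signs and points.\<close>
  have mem: "A \<in> quadric_family B ?n \<longleftrightarrow> generalized_almost_structure (cotangent_bundle B) A"
    if "k \<in> {1, -1}" "\<epsilon>\<^sub>2 \<in> {1, -1}" "\<epsilon>\<^sub>3 \<in> {1, -1}" "a \<in> quadric B ?n k \<epsilon>\<^sub>2 \<epsilon>\<^sub>3" "A = quadric_endo B ?n \<epsilon>\<^sub>2 \<epsilon>\<^sub>3 a"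
    for k \<epsilon>\<^sub>2 \<epsilon>\<^sub>3 a A
    using that unfolding quadric_family_def by blast
  have kinds: "(k = 1 \<longrightarrow> GaPC (cotangent_bundle B) A) \<and> (k = -1 \<longrightarrow> GaC (cotangent_bundle B) A)"
    if "almost_structure k (- k) (cotangent_bundle B) A" for k A
    using that by (auto simp: GaPC_def GaC_def)
  have f1: "\<exists>!F. \<exists>\<beta>. nondegenerate_structure B \<beta> \<and>
      monge_ampere_equation B \<beta> = monge_ampere_equation B \<alpha> \<and> F = quadric_family B (normalization B \<beta>)"
    using nd fam by blast
  have f2: "{J. associated_geometry B (monge_ampere_equation B \<alpha>) J} = quadric_family B ?n"
    using nd fam unfolding associated_geometry_def by blast
  have f3: "GaPC (cotangent_bundle B) J \<or> GaC (cotangent_bundle B) J" if J: "J \<in> quadric_family B ?n" for J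
  proof -
    obtain k \<epsilon>\<^sub>2 \<epsilon>\<^sub>3 a\<^sub>1 a\<^sub>2 a\<^sub>3 where g: "generalized_almost_structure (cotangent_bundle B) J"
      and k: "k \<in> {1, -1}" and q: "(a\<^sub>1, a\<^sub>2, a\<^sub>3) \<in> quadric B ?n k \<epsilon>\<^sub>2 \<epsilon>\<^sub>3"
      and Ja: "J = quadric_endo B ?n \<epsilon>\<^sub>2 \<epsilon>\<^sub>3 (a\<^sub>1, a\<^sub>2, a\<^sub>3)"
      using J by (rule quadric_familyE)
    have "almost_structure k (- k) (cotangent_bundle B) J"
      using quadric_endo_generalized_iff(2)[OF n s assms(2) k q] g by (simp add: Ja)
    then show ?thesis using kinds[of k J] k by blast
  qed
  have f4: "sgn (Pf B ?n m) = s" if "m \<in> points (cotangent_bundle B)" for m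
    using n s that by (auto simp: normalized_structure_def)
  have f5: "has_type (quadric B ?n k \<epsilon>\<^sub>2 \<epsilon>\<^sub>3) (listed_type s k \<epsilon>\<^sub>2 \<epsilon>\<^sub>3)"
    if "k \<in> {1, -1}" "\<epsilon>\<^sub>2 \<in> {1, -1}" "\<epsilon>\<^sub>3 \<in> {1, -1}" for k \<epsilon>\<^sub>2 \<epsilon>\<^sub>3
  proof -
    have "quadric B ?n k \<epsilon>\<^sub>2 \<epsilon>\<^sub>3 = signed_quadric (- s) \<epsilon>\<^sub>2 \<epsilon>\<^sub>3 k"
      using quadric_eq[OF n s assms(2)] by (auto simp: signed_quadric_def)
    then show ?thesis using signed_quadric_listed_type[OF s that] by simp
  qed
  have f6: "inj_on (quadric_endo B ?n \<epsilon>\<^sub>2 \<epsilon>\<^sub>3) (quadric B ?n k \<epsilon>\<^sub>2 \<epsilon>\<^sub>3)" for k \<epsilon>\<^sub>2 \<epsilon>\<^sub>3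
  proof -
    obtain m where "m \<in> points (cotangent_bundle B)"
      using points_cotangent_bundle_nonempty[OF assms(2)] by blast
    then show ?thesis
      using quadric_endo_inject[OF n s' phase.some_chart_in] by (intro inj_onI) blast
  qed
  have f7: "let A = quadric_endo B ?n \<epsilon>\<^sub>2 \<epsilon>\<^sub>3 (a\<^sub>1, a\<^sub>2, a\<^sub>3)
      in (A \<in> quadric_family B ?n \<longleftrightarrow> a\<^sub>2 * a\<^sub>3 = 0 \<or> \<epsilon>\<^sub>2 = s * \<epsilon>\<^sub>3) \<and>
         (A \<in> quadric_family B ?n \<longrightarrow>
            (k = 1 \<longrightarrow> GaPC (cotangent_bundle B) A) \<and> (k = -1 \<longrightarrow> GaC (cotangent_bundle B) A))"
    if k: "k \<in> {1, -1}" and \<epsilon>: "\<epsilon>\<^sub>2 \<in> {1, -1}" "\<epsilon>\<^sub>3 \<in> {1, -1}" and a: "(a\<^sub>1, a\<^sub>2, a\<^sub>3) \<in> quadric B ?n k \<epsilon>\<^sub>2 \<epsilon>\<^sub>3"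
    for k \<epsilon>\<^sub>2 \<epsilon>\<^sub>3 a\<^sub>1 a\<^sub>2 a\<^sub>3
    unfolding Let_def mem[OF k \<epsilon> a refl]
    using quadric_endo_generalized_iff[OF n s assms(2) k a] kinds by blast
  show ?thesis
  proof (intro conjI bexI[OF _ s] ballI)
    fix k \<epsilon>\<^sub>2 \<epsilon>\<^sub>3 :: real and x
    assume "k \<in> {1, -1}" "\<epsilon>\<^sub>2 \<in> {1, -1}" "\<epsilon>\<^sub>3 \<in> {1, -1}" "x \<in> quadric B ?n k \<epsilon>\<^sub>2 \<epsilon>\<^sub>3"
    then show "case x of (a\<^sub>1, a\<^sub>2, a\<^sub>3) \<Rightarrow>
      let A = quadric_endo B ?n \<epsilon>\<^sub>2 \<epsilon>\<^sub>3 (a\<^sub>1, a\<^sub>2, a\<^sub>3)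
      in (A \<in> quadric_family B ?n \<longleftrightarrow> a\<^sub>2 * a\<^sub>3 = 0 \<or> \<epsilon>\<^sub>2 = s * \<epsilon>\<^sub>3) \<and>
         (A \<in> quadric_family B ?n \<longrightarrow>
            (k = 1 \<longrightarrow> GaPC (cotangent_bundle B) A) \<and> (k = -1 \<longrightarrow> GaC (cotangent_bundle B) A))"
      by (cases x) (simp only: prod.case f7)
  qed (rule f1 f2 f3 f4 f5 f6; assumption?)+
qed

end
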